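(* There is an absolute constant $C_0$ such that the following holds. Let $(u,p,u_0,f,T)$ be a finite energy almost smooth solution to the Navier-Stokes system with $f$ divergence-free ($\nabla\cdot f=0$). Then for any $x_0\in\mathbf{R}^3$ and any $0<r<R/2$, one has $$\|u\|_{L^\infty_tL^2_x([0,T]\times B(x_0,R-r))}+\|\nabla u\|_{L^2_tL^2_x([0,T]\times B(x_0,R-r))}\le C_0\Bigl(\|u_0\|_{L^2_x(B(x_0,R))}+\|f\|_{L^1_tL^2_x([0,T]\times B(x_0,R))}+\frac{E(u_0,f,T)^{1/2}T^{1/2}}{r}+\frac{E(u_0,f,T)^{3/2}T^{1/2}}{r^2}\Bigr).$$
   Context: $B(x_0,R)=\{x\in\mathbf{R}^3:|x-x_0|\le R\}$. A finite energy almost smooth solution $(u,p,u_0,f,T)$, $0<T<\infty$, consists of: a smooth divergence-free $u_0:\mathbf{R}^3\to\mathbf{R}^3$ and a smooth $f:[0,T]\times\mathbf{R}^3\to\mathbf{R}^3$ with finite energy $E(u_0,f,T):=\frac12\bigl(\|u_0\|_{L^2_x(\mathbf{R}^3)}+\|f\|_{L^1_tL^2_x([0,T]\times\mathbf{R}^3)}\bigr)^2<\infty$; and functions $u:[0,T]\times\mathbf{R}^3\to\mathbf{R}^3$, $p:[0,T]\times\mathbf{R}^3\to\mathbf{R}$ that are smooth on $(0,T]\times\mathbf{R}^3$, such that for each $k\ge0$ the functions $\nabla_x^ku$, $\partial_t\nabla_x^ku$, $\nabla_x^kp$ exist and are continuous on $[0,T]\times\mathbf{R}^3$, and such that $\partial_tu+(u\cdot\nabla)u=\Delta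 u-\nabla p+f$ and $\nabla\cdot u=0$ on $[0,T]\times\mathbf{R}^3$, $u(0,\cdot)=u_0$, and $\|u\|_{L^\infty_tL^2_x([0,T]\times\mathbf{R}^3)}<\infty$. *)

theory Defs
  imports "HOL-Analysis.Analysis" "HOL-Probability.Essential_Supremum"
begin

section \<open>Smoothness on sets that need not be open\<close>

text \<open>
  Derivatives are taken within the set, so at the times bounding a slab \<open>I \<times> \<real>\<^sup>3\<close> they are
  one-sided in time, and all of them are continuous up to the boundary. For a nondegenerate
  interval \<open>I\<close> they are uniquely determined.
\<close>

primrec Ck_on ::
  "nat \<Rightarrow> 'a::real_normed_vector set \<Rightarrow> ('a \<Rightarrow> 'b::real_normed_vector) \<Rightarrow> bool" where
  "Ck_on 0 S g \<longleftrightarrow> continuous_on S g"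
| "Ck_on (Suc k) S g \<longleftrightarrow>
     (\<exists>g'. (\<forall>z\<in>S. (g has_derivative g' z) (at z within S)) \<and> (\<forall>v. Ck_on k S (\<lambda>z. g' z v)))"

definition smooth_on ::
  "'a::real_normed_vector set \<Rightarrow> ('a \<Rightarrow> 'b::real_normed_vector) \<Rightarrow> bool" where
  "smooth_on S g \<longleftrightarrow> (\<forall>k. Ck_on k S g)"


section \<open>Differential operators in the space variable\<close>

text \<open>
  These are total functions; they have their usual meaning only where the derivatives exist, which
  the definition of a solution below requires wherever it uses them.
\<close>

definition pd :: "3 \<Rightarrow> (real^3 \<Rightarrow> 'b::real_normed_vector) \<Rightarrow> real^3 \<Rightarrow> 'b" where
  "pd i g x = frechet_derivative g (at x) (axis i 1)"

definition pds :: "3 list \<Rightarrow> (real^3 \<Rightarrow> 'b::real_normed_vector) \<Rightarrow> real^3 \<Rightarrow> 'b" where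
  "pds js g = foldr pd js g"

text \<open>
  For vector-valued \<open>g\<close> the gradient is a matrix of type \<open>real^3^3\<close>, on which the library norm is
  the Frobenius norm.
\<close>

definition grad :: "(real^3 \<Rightarrow> 'b::real_normed_vector) \<Rightarrow> real^3 \<Rightarrow> 'b^3" where
  "grad g x = (\<chi> i. pd i g x)"

definition div3 :: "(real^3 \<Rightarrow> real^3) \<Rightarrow> real^3 \<Rightarrow> real" where
  "div3 g x = (\<Sum>i\<in>UNIV. pd i g x $ i)"

definition laplacian :: "(real^3 \<Rightarrow> 'b::real_normed_vector) \<Rightarrow> real^3 \<Rightarrow> 'b" where
  "laplacian g x = (\<Sum>i\<in>UNIV. pd i (pd i g) x)"

text \<open>\<open>(v \<cdot> \<nabla>) g\<close>\<close>

definition convect ::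
  "(real^3 \<Rightarrow> real^3) \<Rightarrow> (real^3 \<Rightarrow> 'b::real_normed_vector) \<Rightarrow> real^3 \<Rightarrow> 'b" where
  "convect v g x = (\<Sum>i\<in>UNIV. (v x $ i) *\<^sub>R pd i g x)"

definition dt_on ::
  "real set \<Rightarrow> (real \<Rightarrow> real^3 \<Rightarrow> 'b::real_normed_vector) \<Rightarrow> real \<Rightarrow> real^3 \<Rightarrow> 'b" where
  "dt_on I g t x = vector_derivative (\<lambda>s. g s x) (at t within I)"


section \<open>Lebesgue norms with values in \<open>[0,\<infinity>]\<close>\<close>

text \<open>Used only for exponents \<open>a > 0\<close>.\<close>

definition epowr :: "ennreal \<Rightarrow> real \<Rightarrow> ennreal" where
  "epowr c a = (if c = \<infinity> then \<infinity> else ennreal (enn2real c powr a))"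

definition L2x :: "(real^3) set \<Rightarrow> (real^3 \<Rightarrow> 'b::real_normed_vector) \<Rightarrow> ennreal" where
  "L2x A g = epowr (\<integral>\<^sup>+x\<in>A. ennreal ((norm (g x))\<^sup>2) \<partial>lborel) (1/2)"

definition L1tL2x ::
  "real set \<Rightarrow> (real^3) set \<Rightarrow> (real \<Rightarrow> real^3 \<Rightarrow> 'b::real_normed_vector) \<Rightarrow> ennreal" where
  "L1tL2x I A g = (\<integral>\<^sup>+t\<in>I. L2x A (g t) \<partial>lborel)"

definition L2tL2x ::
  "real set \<Rightarrow> (real^3) set \<Rightarrow> (real \<Rightarrow> real^3 \<Rightarrow> 'b::real_normed_vector) \<Rightarrow> ennreal" where
  "L2tL2x I A g = epowr (\<integral>\<^sup>+t\<in>I. (L2x A (g t))\<^sup>2 \<partial>lborel) (1/2)"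

definition LinftL2x ::
  "real set \<Rightarrow> (real^3) set \<Rightarrow> (real \<Rightarrow> real^3 \<Rightarrow> 'b::real_normed_vector) \<Rightarrow> ennreal" where
  "LinftL2x I A g = esssup (restrict_space lborel I) (\<lambda>t. L2x A (g t))"


section \<open>Finite energy almost smooth solutions of the Navier-Stokes system\<close>

definition energy ::
  "(real^3 \<Rightarrow> real^3) \<Rightarrow> (real \<Rightarrow> real^3 \<Rightarrow> real^3) \<Rightarrow> real \<Rightarrow> ennreal" where
  "energy u0 f T = (L2x UNIV u0 + L1tL2x {0..T} UNIV f)\<^sup>2 / 2"

text \<open>
  All \<open>\<nabla>\<^sub>x\<^sup>k g\<close> exist and are continuous on \<open>I \<times> \<real>\<^sup>3\<close>; in the second definition, so do all
  \<open>\<partial>\<^sub>t \<nabla>\<^sub>x\<^sup>k g\<close>.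
\<close>

definition space_derivs_cont ::
  "real set \<Rightarrow> (real \<Rightarrow> real^3 \<Rightarrow> 'b::real_normed_vector) \<Rightarrow> bool" where
  "space_derivs_cont I g \<longleftrightarrow> (\<forall>js.
     (\<forall>t\<in>I. \<forall>x. pds js (g t) differentiable (at x)) \<and>
     continuous_on (I \<times> UNIV) (\<lambda>(t, x). pds js (g t) x))"

definition time_space_derivs_cont ::
  "real set \<Rightarrow> (real \<Rightarrow> real^3 \<Rightarrow> 'b::real_normed_vector) \<Rightarrow> bool" where
  "time_space_derivs_cont I g \<longleftrightarrow> (\<forall>js.
     (\<forall>t\<in>I. \<forall>x. (\<lambda>s. pds js (g s) x) differentiable (at t within I)) \<and>
     continuous_on (I \<times> UNIV) (\<lambda>(t, x). dt_on I (\<lambda>s. pds js (g s)) t x))"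

definition finite_energy_almost_smooth_solution ::
  "(real \<Rightarrow> real^3 \<Rightarrow> real^3) \<Rightarrow> (real \<Rightarrow> real^3 \<Rightarrow> real) \<Rightarrow> (real^3 \<Rightarrow> real^3) \<Rightarrow>
   (real \<Rightarrow> real^3 \<Rightarrow> real^3) \<Rightarrow> real \<Rightarrow> bool" where
  "finite_energy_almost_smooth_solution u p u0 f T \<longleftrightarrow>
     0 < T \<and>
     smooth_on UNIV u0 \<and> (\<forall>x. div3 u0 x = 0) \<and>
     smooth_on ({0..T} \<times> UNIV) (\<lambda>(t, x). f t x) \<and>
     energy u0 f T < \<infinity> \<and>
     smooth_on ({0<..T} \<times> UNIV) (\<lambda>(t, x). u t x) \<and>
     smooth_on ({0<..T} \<times> UNIV) (\<lambda>(t, x). p t x) \<and>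
     space_derivs_cont {0..T} u \<and> time_space_derivs_cont {0..T} u \<and>
     space_derivs_cont {0..T} p \<and>
     (\<forall>t\<in>{0..T}. \<forall>x.
        dt_on {0..T} u t x + convect (u t) (u t) x = laplacian (u t) x - grad (p t) x + f t x) \<and>
     (\<forall>t\<in>{0..T}. \<forall>x. div3 (u t) x = 0) \<and>
     u 0 = u0 \<and>
     LinftL2x {0..T} UNIV u < \<infinity>"

end

theory Submission
  imports Defs "HOL-Real_Asymp.Real_Asymp"
begin

text \<open>
  Fix a time, write \<open>v\<close> for the velocity, \<open>\<eta>\<close> for a cutoff and \<open>h = div (\<eta> v) = \<nabla>\<eta> \<cdot> v\<close>. For bumps
  \<open>\<rho>\<^sub>s\<close> of mass one at scale \<open>s\<close> there is a compactly supported kernel \<open>K\<close> with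
  \<open>\<Delta>K = \<rho>\<^sub>L - \<rho>\<^sub>\<epsilon>\<close>, so that \<open>\<phi> = \<rho>\<^sub>\<epsilon> * (\<eta> v) - \<rho>\<^sub>L * (\<eta> v) + \<nabla>(K * h)\<close> is divergence-free with compact
  support. Testing the equation with \<open>\<phi>\<close>, a regularised Leray projection of \<open>\<eta> v\<close>, removes the pressure
  without any knowledge of its behaviour at infinity, and the gradient part only meets the nonlinearity,
  as \<open>\<integral> v \<otimes> v : D\<^sup>2(K * h)\<close>. Near the support of \<open>\<eta>\<close> this is bounded by \<open>\<parallel>v\<parallel>\<^sub>4\<^sup>2 \<parallel>h\<parallel>\<^sub>2\<close>, because
  \<open>\<parallel>D\<^sup>2 G\<parallel>\<^sub>2 = \<parallel>\<Delta>G\<parallel>\<^sub>2\<close>, and far from it by the decay \<open>|z|\<^sup>-\<^sup>3\<close> of \<open>D\<^sup>2K\<close>.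
  Letting \<open>\<epsilon> \<rightarrow> 0\<close> pointwise in time and, after integration in time, \<open>L \<rightarrow> \<infinity>\<close> gives a local energy
  inequality. With Ladyzhenskaya's inequality its error terms on a ball are one eighth of the dissipation on a larger
  ball plus lower-order terms, and an iteration over radii absorbs the former. The resulting estimate holds with
  any a priori bound \<open>M\<close> on the spatial \<open>L\<^sup>2\<close> norm; for balls growing to the whole space it shows that
  \<open>M\<^sup>2\<close> may be taken comparable to the energy of the data, and with this \<open>M\<close> it is the theorem.
\<close>

section \<open>Compactly supported functions and directional derivatives\<close>

text \<open>The obstacle is that over all of space only the velocity has an \<open>L^2\<close> bound
  at a fixed time; neither its time derivative nor the pressure is controlled there, and the force
  only in \<open>L^1\<close> in time. So all test fields have compact support, and the bump at scale
  \<open>L\<close> cannot be dropped at a fixed time, where it meets the time derivative. After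
  integration in time that derivative acts on the test field, whose size \<open>L^-3\<close> on a
  ball of volume \<open>L^3\<close> leaves errors of order \<open>L^(-3/2)\<close> or better. The
  shape of the right-hand side comes from two terms. Viscosity costs \<open>M^2 / d^2\<close> on a
  shell of width \<open>d\<close>. The cubic terms are \<open>M / d\<close> times the squared
  \<open>L^4\<close> norm, which Ladyzhenskaya's inequality bounds by \<open>M^(1/2) Z^(3/4)\<close>
  with \<open>Z\<close> essentially the dissipation; Young's inequality then leaves
  \<open>M^6 / d^4\<close>. With \<open>M^2\<close> comparable to the energy \<open>E\<close>,
  integration in time and a square root give \<open>E^(1/2) T^(1/2) / r\<close> and
  \<open>E^(3/2) T^(1/2) / r^2\<close>. The iteration over radii can be closed because the
  dissipation on one fixed ball is finite by continuity on the closed time interval; that bound has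
  no explicit size, but its share shrinks geometrically.\<close>

definition cts_cpt :: "('a::euclidean_space \<Rightarrow> real) \<Rightarrow> bool" where
  "cts_cpt f \<longleftrightarrow> continuous_on UNIV f \<and> (\<exists>r. \<forall>x. r < norm x \<longrightarrow> f x = 0)"

lemma cts_cptI: "continuous_on UNIV f \<Longrightarrow> (\<And>x. r < norm x \<Longrightarrow> f x = 0) \<Longrightarrow> cts_cpt f"
  by (auto simp: cts_cpt_def)

lemma cts_cpt_continuous: "cts_cpt f \<Longrightarrow> continuous_on UNIV f"
  by (simp add: cts_cpt_def)

lemma cts_cpt_mult_left: "continuous_on UNIV a \<Longrightarrow> cts_cpt f \<Longrightarrow> cts_cpt (\<lambda>x. a x * f x)"
  by (force simp: cts_cpt_def intro!: continuous_intros)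

lemma cts_cpt_mult_right: "cts_cpt f \<Longrightarrow> continuous_on UNIV a \<Longrightarrow> cts_cpt (\<lambda>x. f x * a x)"
  by (force simp: cts_cpt_def intro!: continuous_intros)

lemma cts_cpt_cmult: "cts_cpt f \<Longrightarrow> cts_cpt (\<lambda>x. c * f x)"
  by (rule cts_cpt_mult_left) simp_all

lemma cts_cpt_zero [simp]: "cts_cpt (\<lambda>x. 0)"
  by (auto simp: cts_cpt_def)

lemma cts_cpt_add: "cts_cpt f \<Longrightarrow> cts_cpt g \<Longrightarrow> cts_cpt (\<lambda>x. f x + g x)"
proof -
  assume "cts_cpt f" "cts_cpt g"
  then obtain r s where "\<forall>x. r < norm x \<longrightarrow> f x = 0" "\<forall>x. s < norm x \<longrightarrow> g x = 0"
    and "continuous_on UNIV f" "continuous_on UNIV g"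
    by (auto simp: cts_cpt_def)
  then show ?thesis
    by (intro cts_cptI[where r = "max r s"] continuous_intros) auto
qed

lemma cts_cpt_minus: "cts_cpt f \<Longrightarrow> cts_cpt (\<lambda>x. - f x)"
  using cts_cpt_cmult[of f "-1"] by simp

lemma cts_cpt_diff: "cts_cpt f \<Longrightarrow> cts_cpt g \<Longrightarrow> cts_cpt (\<lambda>x. f x - g x)"
  using cts_cpt_add[of f "\<lambda>x. - g x"] cts_cpt_minus[of g] by simp

lemma cts_cpt_sum: "(\<And>i. i \<in> I \<Longrightarrow> cts_cpt (f i)) \<Longrightarrow> cts_cpt (\<lambda>x. \<Sum>i\<in>I. f i x)"
  by (induction I rule: infinite_finite_induct) (auto intro: cts_cpt_add)

lemma cts_cpt_abs: "cts_cpt f \<Longrightarrow> cts_cpt (\<lambda>x. \<bar>f x\<bar>)"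
  by (force simp: cts_cpt_def intro!: continuous_intros)

lemma cts_cpt_power: "cts_cpt f \<Longrightarrow> 0 < n \<Longrightarrow> cts_cpt (\<lambda>x. f x ^ n)"
  by (force simp: cts_cpt_def intro!: continuous_intros)

section \<open>Integrals of compactly supported functions and their dependence on a
  parameter\<close>

lemma integrable_supp:
  fixes f :: "'a::euclidean_space \<Rightarrow> real"
  assumes "continuous_on (cball 0 r) f" "\<And>x. r < norm x \<Longrightarrow> f x = 0"
  shows "integrable lborel f"
proof -
  have "integrable lborel (\<lambda>x. indicator (cball 0 r) x *\<^sub>R f x)"
    by (rule borel_integrable_compact) (use assms in auto)
  also have "(\<lambda>x. indicator (cball 0 r) x *\<^sub>R f x) = f"
    using assms(2) by (auto simp: fun_eq_iff indicator_def)
  finally show ?thesis .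
qed

lemma cts_cpt_integrable: "cts_cpt f \<Longrightarrow> integrable lborel f"
  by (metis cts_cpt_def integrable_supp continuous_on_subset subset_UNIV)

lemma norm_le_imp_mem_cbox:
  fixes x :: "'a::euclidean_space"
  assumes "norm x \<le> r" shows "x \<in> cbox (- (r *\<^sub>R One)) (r *\<^sub>R One)"
  unfolding mem_box
proof safe
  fix i :: 'a assume "i \<in> Basis"
  then have "\<bar>x \<bullet> i\<bar> \<le> r" using Basis_le_norm[of i x] assms by linarith
  then show "- (r *\<^sub>R One) \<bullet> i \<le> x \<bullet> i" "x \<bullet> i \<le> (r *\<^sub>R One) \<bullet> i"
    using \<open>i \<in> Basis\<close> by (auto simp: inner_sum_left inner_Basis if_distrib cong: if_cong)
qed

lemma integral_lborel_eq_cbox: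
  fixes f :: "'a::euclidean_space \<Rightarrow> real"
  assumes "continuous_on (cball 0 r) f" "\<And>x. r < norm x \<Longrightarrow> f x = 0"
  shows "(\<integral>x. f x \<partial>lborel) = integral (cbox (- (r *\<^sub>R One)) (r *\<^sub>R One)) f"
proof -
  let ?C = "cbox (- (r *\<^sub>R One)) (r *\<^sub>R One) :: 'a set"
  have "f x = 0" if "x \<notin> ?C" for x
    using that norm_le_imp_mem_cbox assms(2) not_le by metis
  then have "f = (\<lambda>x. if x \<in> ?C then f x else 0)" by auto
  then have "integral UNIV f = integral ?C f"
    using integral_restrict_UNIV[of ?C f] by simp
  then show ?thesis
    using integral_lborel[OF integrable_supp[OF assms]] by simp
qed

lemma continuous_on_section:
  assumes "continuous_on (S \<times> UNIV) (\<lambda>(s, x). f s x)" "s \<in> S"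
  shows "continuous_on A (f s)"
proof -
  have "continuous_on A (\<lambda>x. (\<lambda>(s, x). f s x) (s, x))"
    by (rule continuous_on_compose2[OF assms(1)]) (use assms(2) in \<open>auto intro!: continuous_intros\<close>)
  then show ?thesis by simp
qed

text \<open>One radius for all parameters turns the integral over the whole space into one over a
  fixed compact box, where joint continuity suffices.\<close>

lemma continuous_on_integral_supp:
  fixes f :: "'b::topological_space \<Rightarrow> 'a::euclidean_space \<Rightarrow> real"
  assumes "continuous_on (S \<times> UNIV) (\<lambda>(s, x). f s x)"
    and "\<And>s x. s \<in> S \<Longrightarrow> r < norm x \<Longrightarrow> f s x = 0"
  shows "continuous_on S (\<lambda>s. \<integral>x. f s x \<partial>lborel)"
proof -
  have "continuous_on S (\<lambda>s. integral (cbox (- (r *\<^sub>R One)) (r *\<^sub>R One)) (f s))"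
    by (rule integral_continuous_on_param, rule continuous_on_subset[OF assms(1)]) auto
  then show ?thesis
    by (rule continuous_on_eq)
      (use assms in \<open>auto intro!: integral_lborel_eq_cbox[symmetric] continuous_on_section[OF assms(1)]\<close>)
qed

text \<open>On the common box the Leibniz rule applies. The derivative is taken within a convex
  \<open>S\<close>, so that it may be one-sided at the ends of a time interval.\<close>

lemma has_derivative_integral_supp:
  fixes f f' :: "real \<Rightarrow> 'a::euclidean_space \<Rightarrow> real"
  assumes "\<And>s x. s \<in> S \<Longrightarrow> ((\<lambda>s. f s x) has_real_derivative f' s x) (at s within S)"
    and "continuous_on (S \<times> UNIV) (\<lambda>(s, x). f' s x)"
    and "\<And>s. s \<in> S \<Longrightarrow> continuous_on UNIV (f s)"
    and "\<And>s x. s \<in> S \<Longrightarrow> r < norm x \<Longrightarrow> f s x = 0"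
    and "\<And>s x. s \<in> S \<Longrightarrow> r < norm x \<Longrightarrow> f' s x = 0"
    and "convex S" "t \<in> S"
  shows "((\<lambda>s. \<integral>x. f s x \<partial>lborel) has_real_derivative (\<integral>x. f' t x \<partial>lborel)) (at t within S)"
proof -
  let ?C = "cbox (- (r *\<^sub>R One)) (r *\<^sub>R One) :: 'a set"
  have eq: "(\<integral>x. f s x \<partial>lborel) = integral ?C (f s)" "(\<integral>x. f' s x \<partial>lborel) = integral ?C (f' s)"
    if "s \<in> S" for s
    using that assms(3)[OF that] by (auto intro!: integral_lborel_eq_cbox assms(4,5) continuous_on_section[OF assms(2)] intro: continuous_on_subset)
  have "((\<lambda>s. integral ?C (f s)) has_real_derivative integral ?C (f' t)) (at t within S)"
    by (rule leibniz_rule_field_derivative)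
      (use assms in \<open>auto intro!: integrable_continuous intro: continuous_on_subset\<close>)
  then have "((\<lambda>s. \<integral>x. f s x \<partial>lborel) has_real_derivative integral ?C (f' t)) (at t within S)"
    by (rule has_field_derivative_transform_within[OF _ zero_less_one \<open>t \<in> S\<close>]) (simp add: eq)
  then show ?thesis by (simp add: eq assms(7))
qed

text \<open>Continuity of \<open>g\<close> and of its derivative \<open>g'\<close> in direction \<open>e\<close> is part of the notion.\<close>

definition C1_dir :: "'a::euclidean_space \<Rightarrow> ('a \<Rightarrow> real) \<Rightarrow> ('a \<Rightarrow> real) \<Rightarrow> bool" where
  "C1_dir e g g' \<longleftrightarrow> continuous_on UNIV g \<and> continuous_on UNIV g' \<and>
     (\<forall>x. ((\<lambda>s. g (x + s *\<^sub>R e)) has_real_derivative g' x) (at 0))"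

lemma C1_dir_continuous: "C1_dir e g g' \<Longrightarrow> continuous_on UNIV g" "C1_dir e g g' \<Longrightarrow> continuous_on UNIV g'"
  by (auto simp: C1_dir_def)

lemma C1_dir_at:
  assumes "C1_dir e g g'"
  shows "((\<lambda>s. g (x + s *\<^sub>R e)) has_real_derivative g' (x + t *\<^sub>R e)) (at t within S)"
proof -
  have "((\<lambda>s. g ((x + t *\<^sub>R e) + s *\<^sub>R e)) has_real_derivative g' (x + t *\<^sub>R e)) (at (t - t))"
    using assms by (auto simp: C1_dir_def)
  then have "((\<lambda>r. g ((x + t *\<^sub>R e) + (r - t) *\<^sub>R e)) has_real_derivative g' (x + t *\<^sub>R e) * 1) (at t)"
    by (rule DERIV_chain2[where f = "\<lambda>s. g ((x + t *\<^sub>R e) + s *\<^sub>R e)"]) (auto intro!: derivative_eq_intros)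
  then have "((\<lambda>s. g (x + s *\<^sub>R e)) has_real_derivative g' (x + t *\<^sub>R e)) (at t)"
    by (simp add: algebra_simps)
  then show ?thesis by (rule has_field_derivative_at_within)
qed

lemma C1_dirI:
  assumes "\<And>x. (g has_derivative D x) (at x)" "\<And>x. D x e = g' x" "continuous_on UNIV g'"
  shows "C1_dir e g g'"
  unfolding C1_dir_def
proof (intro conjI allI)
  show "continuous_on UNIV g"
    using assms(1) by (meson has_derivative_continuous_on has_derivative_at_withinI)
  fix x
  have "((\<lambda>s. g (x + s *\<^sub>R e)) has_derivative (\<lambda>s. D x (s *\<^sub>R e))) (at 0)"
    by (rule has_derivative_compose[of "\<lambda>s. x + s *\<^sub>R e"])
       (use assms(1) in \<open>auto intro!: derivative_eq_intros\<close>)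
  moreover have "(\<lambda>s. D x (s *\<^sub>R e)) = (*) (g' x)"
    using assms(2)[of x] has_derivative_bounded_linear[OF assms(1)[of x]]
    by (auto simp: fun_eq_iff linear_simps)
  ultimately show "((\<lambda>s. g (x + s *\<^sub>R e)) has_real_derivative g' x) (at 0)"
    by (simp add: has_field_derivative_def)
qed (rule assms)

lemma C1_dir_eq: "C1_dir e g g' \<Longrightarrow> (\<And>x. g x = h x) \<Longrightarrow> (\<And>x. g' x = h' x) \<Longrightarrow> C1_dir e h h'"
  by (simp add: C1_dir_def cong: continuous_on_cong)

lemma C1_dir_const: "C1_dir e (\<lambda>x. c) (\<lambda>x. 0)"
  by (auto simp: C1_dir_def)

lemma C1_dir_add: "C1_dir e f f' \<Longrightarrow> C1_dir e g g' \<Longrightarrow> C1_dir e (\<lambda>x. f x + g x) (\<lambda>x. f' x + g' x)"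
  by (auto simp: C1_dir_def intro!: continuous_intros DERIV_add)

lemma C1_dir_mult:
  "C1_dir e f f' \<Longrightarrow> C1_dir e g g' \<Longrightarrow> C1_dir e (\<lambda>x. f x * g x) (\<lambda>x. f' x * g x + f x * g' x)"
  unfolding C1_dir_def by (auto intro!: continuous_intros derivative_eq_intros)

lemma C1_dir_cmult: "C1_dir e f f' \<Longrightarrow> C1_dir e (\<lambda>x. c * f x) (\<lambda>x. c * f' x)"
  by (auto simp: C1_dir_def intro!: continuous_intros DERIV_cmult)

lemma C1_dir_minus: "C1_dir e f f' \<Longrightarrow> C1_dir e (\<lambda>x. - f x) (\<lambda>x. - f' x)"
  using C1_dir_cmult[of e f f' "-1"] by simp

lemma C1_dir_diff: "C1_dir e f f' \<Longrightarrow> C1_dir e g g' \<Longrightarrow> C1_dir e (\<lambda>x. f x - g x) (\<lambda>x. f' x - g' x)"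
  using C1_dir_add[of e f f' "\<lambda>x. - g x" "\<lambda>x. - g' x"] C1_dir_minus[of e g g'] by simp

lemma C1_dir_sum:
  "(\<And>i. i \<in> I \<Longrightarrow> C1_dir e (f i) (f' i)) \<Longrightarrow> C1_dir e (\<lambda>x. \<Sum>i\<in>I. f i x) (\<lambda>x. \<Sum>i\<in>I. f' i x)"
  by (induction I rule: infinite_finite_induct) (auto intro: C1_dir_add C1_dir_const)

lemma C1_dir_compose:
  assumes "C1_dir e f f'" "\<And>t. (k has_real_derivative k' t) (at t)" "continuous_on UNIV k'"
  shows "C1_dir e (\<lambda>x. k (f x)) (\<lambda>x. k' (f x) * f' x)"
proof -
  have ck: "continuous_on UNIV k"
    using assms(2) DERIV_isCont continuous_at_imp_continuous_on by blast
  show ?thesis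
    unfolding C1_dir_def
  proof (intro conjI allI)
    show "continuous_on UNIV (\<lambda>x. k (f x))" "continuous_on UNIV (\<lambda>x. k' (f x) * f' x)"
      using assms ck by (auto simp: C1_dir_def intro!: continuous_intros intro: continuous_on_compose2)
    fix x
    have "((\<lambda>s. f (x + s *\<^sub>R e)) has_real_derivative f' x) (at 0)"
      using assms by (auto simp: C1_dir_def)
    then show "((\<lambda>s. k (f (x + s *\<^sub>R e))) has_real_derivative k' (f x) * f' x) (at 0)"
      using DERIV_chain2[where f = k and g = "\<lambda>s. f (x + s *\<^sub>R e)" and x = 0 and s = UNIV] assms(2)[of "f x"]
      by simp
  qed
qed

text \<open>The exterior of a ball is open, so at each of its points \<open>g\<close> vanishes on a
  short segment in direction \<open>e\<close>, and the derivative is that of the constant 0.\<close>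

lemma cts_cpt_C1_dir:
  assumes "C1_dir e g g'" "cts_cpt g" shows "cts_cpt g'"
proof -
  from assms(2) obtain r where r: "\<And>x. r < norm x \<Longrightarrow> g x = 0" by (auto simp: cts_cpt_def)
  have "g' x = 0" if x: "r < norm x" for x
  proof -
    have "\<forall>\<^sub>F s in at 0. r < norm (x + s *\<^sub>R e)"
      by (rule order_tendstoD[of _ "norm (x + 0 *\<^sub>R e)"]) (use x in \<open>auto intro!: tendsto_eq_intros\<close>)
    then have "\<forall>\<^sub>F s in at 0. g (x + s *\<^sub>R e) = 0"
      by (rule eventually_mono) (use r in auto)
    then have "((\<lambda>s. g (x + s *\<^sub>R e)) has_real_derivative g' x) (at 0) \<longleftrightarrow> ((\<lambda>s. 0) has_real_derivative g' x) (at 0)"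
      using r x by (intro has_field_derivative_cong_eventually) auto
    moreover have "((\<lambda>s. g (x + s *\<^sub>R e)) has_real_derivative g' x) (at 0)"
      using assms(1) by (auto simp: C1_dir_def)
    ultimately show ?thesis by (metis DERIV_const DERIV_unique)
  qed
  then show ?thesis
    using assms by (auto simp: C1_dir_def intro: cts_cptI)
qed

section \<open>Translation invariance and integration by parts\<close>

lemma lborel_integral_shift:
  fixes f :: "'a::euclidean_space \<Rightarrow> real"
  assumes "f \<in> borel_measurable borel"
  shows "(\<integral>x. f (x + t) \<partial>lborel) = (\<integral>x. f x \<partial>lborel)"
  by (subst (2) lborel_distr_plus[of t, symmetric])
     (use assms in \<open>simp add: integral_distr add.commute\<close>)

lemma lborel_integral_reflect:
  fixes f :: "'a::euclidean_space \<Rightarrow> real"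
  assumes [measurable]: "f \<in> borel_measurable borel"
  shows "(\<integral>y. f (x - y) \<partial>lborel) = (\<integral>y. f y \<partial>lborel)"
  by (subst (2) lborel_affine[of "-1" x]) (simp_all add: density_1 integral_distr)

lemma continuous_on_UNIV_measurable [measurable_dest]:
  "continuous_on UNIV (f :: 'a::topological_space \<Rightarrow> 'b::topological_space) \<Longrightarrow> f \<in> borel_measurable borel"
  by (rule borel_measurable_continuous_onI)

text \<open>By translation invariance the integral of \<open>g (x + s *\<^sub>R e)\<close> does not
  depend on \<open>s\<close>; differentiating it under the integral at \<open>s = 0\<close> gives
  the integral of \<open>g'\<close>.\<close>

lemma integral_C1_dir_eq_0:
  assumes "C1_dir e g g'" "cts_cpt g" shows "(\<integral>x. g' x \<partial>lborel) = 0"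
proof -
  obtain r where r: "\<And>x. r < norm x \<Longrightarrow> g x = 0" "\<And>x. r < norm x \<Longrightarrow> g' x = 0"
  proof -
    from assms cts_cpt_C1_dir[OF assms] obtain r s
      where "\<And>x. r < norm x \<Longrightarrow> g x = 0" "\<And>x. s < norm x \<Longrightarrow> g' x = 0"
      by (auto simp: cts_cpt_def)
    then show ?thesis by (intro that[of "max r s"]) auto
  qed
  have cont: "continuous_on UNIV g" "continuous_on UNIV g'"
    using assms by (auto simp: C1_dir_def)
  \<comment> \<open>Restricting the shift to \<open>{-1<..<1}\<close> keeps all supports in one
    ball, of radius \<open>r + norm e\<close>.\<close>
  have "((\<lambda>s. \<integral>x. g (x + s *\<^sub>R e) \<partial>lborel) has_real_derivative (\<integral>x. g' (x + 0 *\<^sub>R e) \<partial>lborel)) (at 0 within {-1<..<1})"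
  proof (rule has_derivative_integral_supp[where r = "r + norm e"])
    show "continuous_on ({-1<..<1} \<times> UNIV) (\<lambda>(s, x). g' (x + s *\<^sub>R e))"
      unfolding case_prod_beta by (intro continuous_intros continuous_on_compose2[OF cont(2)]) auto
    have *: "r < norm (x + s *\<^sub>R e)" if "s \<in> {-1<..<1}" "r + norm e < norm x" for s x
    proof -
      have "norm x \<le> norm (x + s *\<^sub>R e) + norm (s *\<^sub>R e)"
        using norm_triangle_ineq4[of "x + s *\<^sub>R e" "s *\<^sub>R e"] by simp
      moreover have "\<bar>s\<bar> \<le> 1" using that by auto
      then have "norm (s *\<^sub>R e) \<le> norm e" by (simp add: mult_left_le_one_le)
      ultimately show ?thesis using that by simp
    qed
    show "g (x + s *\<^sub>R e) = 0" "g' (x + s *\<^sub>R e) = 0" if "s \<in> {-1<..<1}" "r + norm e < norm x" for s x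
      using *[OF that] r by auto
  qed (auto intro!: C1_dir_at[OF assms(1)] continuous_intros continuous_on_compose2[OF cont(1)])
  moreover have "(\<integral>x. g (x + s *\<^sub>R e) \<partial>lborel) = (\<integral>x. g x \<partial>lborel)" for s
    by (rule lborel_integral_shift) (use cont in measurable)
  ultimately have "((\<lambda>s. \<integral>x. g x \<partial>lborel) has_real_derivative (\<integral>x. g' x \<partial>lborel)) (at 0 within {-1<..<1})"
    by simp
  moreover have "((\<lambda>s::real. \<integral>x. g x \<partial>lborel) has_real_derivative 0) (at 0 within {-1<..<1})"
    by simp
  ultimately show ?thesis
    by (simp add: at_within_open[of _ "{-1<..<1}"] DERIV_unique)
qed

lemma integral_by_parts_dir:
  assumes a: "C1_dir e a a'" and b: "C1_dir e b b'" and c: "cts_cpt b"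
  shows "(\<integral>x. a' x * b x \<partial>lborel) = - (\<integral>x. a x * b' x \<partial>lborel)"
proof -
  have "cts_cpt (\<lambda>x. a x * b x)"
    using a c by (intro cts_cpt_mult_left C1_dir_continuous)
  from integral_C1_dir_eq_0[OF C1_dir_mult[OF a b] this]
  have "(\<integral>x. a' x * b x + a x * b' x \<partial>lborel) = 0" .
  moreover have "integrable lborel (\<lambda>x. a' x * b x)" "integrable lborel (\<lambda>x. a x * b' x)"
    using a c cts_cpt_C1_dir[OF b c]
    by (auto intro!: cts_cpt_integrable cts_cpt_mult_left dest: C1_dir_continuous)
  ultimately show ?thesis by simp
qed

section \<open>Cauchy-Schwarz and Fubini in the form used below\<close>

lemma integrable_mult_squares:
  fixes f g :: "'a \<Rightarrow> real"
  assumes [measurable]: "f \<in> borel_measurable M" "g \<in> borel_measurable M"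
    and "integrable M (\<lambda>x. (f x)\<^sup>2)" "integrable M (\<lambda>x. (g x)\<^sup>2)"
  shows "integrable M (\<lambda>x. f x * g x)"
proof (rule Bochner_Integration.integrable_bound[of M "\<lambda>x. (f x)\<^sup>2 + (g x)\<^sup>2"])
  show "AE x in M. norm (f x * g x) \<le> norm ((f x)\<^sup>2 + (g x)\<^sup>2)"
  proof (intro AE_I2)
    fix x
    have "2 * \<bar>f x * g x\<bar> \<le> (f x)\<^sup>2 + (g x)\<^sup>2"
      using sum_squares_bound[of "\<bar>f x\<bar>" "\<bar>g x\<bar>"] by (simp add: abs_mult)
    then show "norm (f x * g x) \<le> norm ((f x)\<^sup>2 + (g x)\<^sup>2)" by simp
  qed
qed (use assms in auto)

lemma Cauchy_Schwarz_integral: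
  fixes f g :: "'a \<Rightarrow> real"
  assumes [measurable]: "f \<in> borel_measurable M" "g \<in> borel_measurable M"
    and f: "integrable M (\<lambda>x. (f x)\<^sup>2)" and g: "integrable M (\<lambda>x. (g x)\<^sup>2)"
  shows "(\<integral>x. \<bar>f x * g x\<bar> \<partial>M) \<le> sqrt (\<integral>x. (f x)\<^sup>2 \<partial>M) * sqrt (\<integral>x. (g x)\<^sup>2 \<partial>M)"
proof -
  have fg: "integrable M (\<lambda>x. \<bar>f x * g x\<bar>)"
    using integrable_mult_squares[OF assms] by simp
  have "(\<integral>\<^sup>+x. ennreal \<bar>f x\<bar> * ennreal \<bar>g x\<bar> \<partial>M)\<^sup>2
      \<le> (\<integral>\<^sup>+x. ennreal \<bar>f x\<bar> ^ 2 \<partial>M) * (\<integral>\<^sup>+x. ennreal \<bar>g x\<bar> ^ 2 \<partial>M)"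
    by (rule Cauchy_Schwarz_nn_integral) auto
  moreover have "(\<integral>\<^sup>+x. ennreal \<bar>f x\<bar> * ennreal \<bar>g x\<bar> \<partial>M) = ennreal (\<integral>x. \<bar>f x * g x\<bar> \<partial>M)"
    using nn_integral_eq_integral[OF fg] by (simp add: abs_mult ennreal_mult)
  moreover have "(\<integral>\<^sup>+x. ennreal \<bar>f x\<bar> ^ 2 \<partial>M) = ennreal (\<integral>x. (f x)\<^sup>2 \<partial>M)"
    using nn_integral_eq_integral[OF f] by (simp add: ennreal_power)
  moreover have "(\<integral>\<^sup>+x. ennreal \<bar>g x\<bar> ^ 2 \<partial>M) = ennreal (\<integral>x. (g x)\<^sup>2 \<partial>M)"
    using nn_integral_eq_integral[OF g] by (simp add: ennreal_power)
  ultimately have "ennreal ((\<integral>x. \<bar>f x * g x\<bar> \<partial>M)\<^sup>2) \<le> ennreal ((\<integral>x. (f x)\<^sup>2 \<partial>M) * (\<integral>x. (g x)\<^sup>2 \<partial>M))"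
    by (simp add: ennreal_power ennreal_mult)
  then have "(\<integral>x. \<bar>f x * g x\<bar> \<partial>M)\<^sup>2 \<le> (\<integral>x. (f x)\<^sup>2 \<partial>M) * (\<integral>x. (g x)\<^sup>2 \<partial>M)"
    by (subst (asm) ennreal_le_iff) auto
  then show ?thesis
    by (metis real_le_rsqrt real_sqrt_mult)
qed

lemma Cauchy_Schwarz_integral_abs:
  fixes f g :: "'a \<Rightarrow> real"
  assumes "f \<in> borel_measurable M" "g \<in> borel_measurable M"
    and "integrable M (\<lambda>x. (f x)\<^sup>2)" "integrable M (\<lambda>x. (g x)\<^sup>2)"
  shows "\<bar>\<integral>x. f x * g x \<partial>M\<bar> \<le> sqrt (\<integral>x. (f x)\<^sup>2 \<partial>M) * sqrt (\<integral>x. (g x)\<^sup>2 \<partial>M)"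
  using Cauchy_Schwarz_integral[OF assms] integral_abs_bound[of M "\<lambda>x. f x * g x"] by linarith

lemma integrable_pair_supp:
  fixes f :: "'a::euclidean_space \<Rightarrow> 'b::euclidean_space \<Rightarrow> real"
  assumes "continuous_on UNIV (\<lambda>(x, y). f x y)" "\<And>x y. r < norm x \<Longrightarrow> f x y = 0"
    "\<And>x y. r < norm y \<Longrightarrow> f x y = 0"
  shows "integrable (lborel \<Otimes>\<^sub>M lborel) (\<lambda>(x, y). f x y)"
  unfolding lborel_prod
proof (rule cts_cpt_integrable, rule cts_cptI[where r = "r + r"])
  fix z :: "'a \<times> 'b" assume "r + r < norm z"
  then have "r < norm (fst z) \<or> r < norm (snd z)"
    using norm_Pair_le[of "fst z" "snd z"] by auto
  then show "(case z of (x, y) \<Rightarrow> f x y) = 0"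
    using assms(2,3) by (auto simp: case_prod_beta)
qed (rule assms)


section \<open>Convolution\<close>

definition conv :: "('a::euclidean_space \<Rightarrow> real) \<Rightarrow> ('a \<Rightarrow> real) \<Rightarrow> 'a \<Rightarrow> real" where
  "conv a b x = (\<integral>y. a (x - y) * b y \<partial>lborel)"

lemma cts_cpt_conv_integrand:
  assumes "continuous_on UNIV a" "cts_cpt b"
  shows "cts_cpt (\<lambda>y. a (x - y) * b y)"
  by (intro cts_cpt_mult_left assms(2) continuous_on_compose2[OF assms(1)] continuous_intros) auto

lemmas integrable_conv = cts_cpt_integrable[OF cts_cpt_conv_integrand]

lemma conv_commute:
  assumes "continuous_on UNIV a" "continuous_on UNIV b"
  shows "conv a b = conv b a"
proof
  fix x
  have "(\<lambda>y. b (x - y) * a y) \<in> borel_measurable borel"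
    using assms by (intro borel_measurable_continuous_onI continuous_intros continuous_on_compose2[OF assms(2)]) auto
  from lborel_integral_reflect[OF this, of x] show "conv a b x = conv b a x"
    unfolding conv_def by (simp add: mult.commute)
qed

lemma continuous_conv:
  assumes "continuous_on UNIV a" "cts_cpt b"
  shows "continuous_on UNIV (conv a b)"
proof -
  from assms(2) obtain r where r: "\<And>x. r < norm x \<Longrightarrow> b x = 0" and b: "continuous_on UNIV b"
    by (auto simp: cts_cpt_def)
  show ?thesis
    unfolding conv_def
    by (rule continuous_on_integral_supp[where r = r])
      (use r in \<open>auto simp: case_prod_beta intro!: continuous_intros
         continuous_on_compose2[OF assms(1)] continuous_on_compose2[OF b]\<close>)
qed

lemma cts_cpt_conv:
  assumes "cts_cpt a" "cts_cpt b" shows "cts_cpt (conv a b)"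
proof -
  from assms obtain r s where r: "\<And>x. r < norm x \<Longrightarrow> a x = 0" and s: "\<And>x. s < norm x \<Longrightarrow> b x = 0"
    by (auto simp: cts_cpt_def)
  have "conv a b x = 0" if "r + s < norm x" for x
  proof -
    have *: "a (x - y) * b y = 0" for y
    proof -
      have "r < norm (x - y) \<or> s < norm y"
        using that norm_triangle_ineq[of "x - y" y] by auto
      then show ?thesis using r s by auto
    qed
    show ?thesis by (simp only: conv_def * Bochner_Integration.integral_zero)
  qed
  then show ?thesis
    using assms by (auto intro!: cts_cptI continuous_conv simp: cts_cpt_continuous)
qed

lemma C1_dir_conv:
  assumes a: "C1_dir e a a'" and b: "cts_cpt b"
  shows "C1_dir e (conv a b) (conv a' b)"
  unfolding C1_dir_def
proof (intro conjI allI continuous_conv b C1_dir_continuous(1)[OF a] C1_dir_continuous(2)[OF a])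
  fix x
  note ca = C1_dir_continuous[OF a]
  from b obtain r where r: "\<And>x. r < norm x \<Longrightarrow> b x = 0" and cb: "continuous_on UNIV b"
    by (auto simp: cts_cpt_def)
  have "((\<lambda>s. \<integral>y. a (x + s *\<^sub>R e - y) * b y \<partial>lborel) has_real_derivative
      (\<integral>y. a' (x + 0 *\<^sub>R e - y) * b y \<partial>lborel)) (at 0 within UNIV)"
  proof (rule has_derivative_integral_supp[where r = r])
    show "((\<lambda>s. a (x + s *\<^sub>R e - y) * b y) has_real_derivative a' (x + s *\<^sub>R e - y) * b y) (at s)" for s y
      using C1_dir_at[OF a, of "x - y" s UNIV] by (intro DERIV_cmult_right) (simp add: algebra_simps)
  qed (use r in \<open>auto simp: case_prod_beta intro!: continuous_intros
         continuous_on_compose2[OF ca(1)] continuous_on_compose2[OF ca(2)] continuous_on_compose2[OF cb]\<close>)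
  then show "((\<lambda>s. conv a b (x + s *\<^sub>R e)) has_real_derivative conv a' b x) (at 0)"
    by (simp add: conv_def)
qed

text \<open>Together with \<open>C1_dir_conv\<close> this splits two derivatives of a mollified
  field, one falling on the bump and one on the field.\<close>

lemma C1_dir_conv_right:
  assumes a: "cts_cpt a" and b: "C1_dir e b b'" "cts_cpt b"
  shows "C1_dir e (conv a b) (conv a b')"
  using C1_dir_conv[OF b(1) a] conv_commute[of a b] conv_commute[of a b'] C1_dir_continuous[OF b(1)]
    cts_cpt_continuous[OF a] by simp

lemma conv_diff_left:
  assumes "continuous_on UNIV a" "continuous_on UNIV a'" "cts_cpt b"
  shows "conv (\<lambda>x. a x - a' x) b x = conv a b x - conv a' b x"
  unfolding conv_def
  using integrable_conv[OF assms(1,3)] integrable_conv[OF assms(2,3)]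
  by (simp add: left_diff_distrib)

lemma conv_sum_left:
  assumes "\<And>i. i \<in> I \<Longrightarrow> continuous_on UNIV (a i)" "cts_cpt b"
  shows "conv (\<lambda>x. \<Sum>i\<in>I. a i x) b x = (\<Sum>i\<in>I. conv (a i) b x)"
  unfolding conv_def sum_distrib_right
  by (rule Bochner_Integration.integral_sum) (rule integrable_conv[OF assms])

lemma conv_sum_right:
  assumes "\<And>i. i \<in> I \<Longrightarrow> cts_cpt (b i)" "continuous_on UNIV a"
  shows "conv a (\<lambda>x. \<Sum>i\<in>I. b i x) x = (\<Sum>i\<in>I. conv a (b i) x)"
  unfolding conv_def sum_distrib_left
  by (rule Bochner_Integration.integral_sum) (rule integrable_conv[OF assms(2,1)])

section \<open>Size of convolutions and approximation by mollifiers\<close>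

lemma conv_bound:
  assumes "continuous_on UNIV a" "cts_cpt b" "\<And>x. \<bar>a x\<bar> \<le> A"
  shows "\<bar>conv a b x\<bar> \<le> A * (\<integral>y. \<bar>b y\<bar> \<partial>lborel)"
proof -
  have "\<bar>conv a b x\<bar> \<le> (\<integral>y. \<bar>a (x - y) * b y\<bar> \<partial>lborel)"
    unfolding conv_def by (rule integral_abs_bound)
  also have "\<dots> \<le> (\<integral>y. A * \<bar>b y\<bar> \<partial>lborel)"
    using assms by (intro integral_mono integrable_abs integrable_conv integrable_mult_right cts_cpt_integrable)
      (auto simp: abs_mult intro!: mult_right_mono)
  finally show ?thesis by simp
qed

lemma integral_conv:
  assumes "cts_cpt a" "cts_cpt b"
  shows "(\<integral>x. conv a b x \<partial>lborel) = (\<integral>x. a x \<partial>lborel) * (\<integral>x. b x \<partial>lborel)"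
proof -
  from assms obtain r s where r: "\<And>x. r < norm x \<Longrightarrow> a x = 0" and s: "\<And>x. s < norm x \<Longrightarrow> b x = 0"
    by (auto simp: cts_cpt_def)
  note c = cts_cpt_continuous[OF assms(1)] cts_cpt_continuous[OF assms(2)]
  define t where "t = max s (r + s)"
  have "integrable (lborel \<Otimes>\<^sub>M lborel) (\<lambda>(x, y). a (x - y) * b y)"
  proof (rule integrable_pair_supp[where r = t])
    show "a (x - y) * b y = 0" if "t < norm x" for x y
    proof -
      have "r < norm (x - y) \<or> s < norm y"
        using that norm_triangle_ineq[of "x - y" y] by (auto simp: t_def)
      then show ?thesis using r s by auto
    qed
  qed (use s in \<open>auto simp: t_def case_prod_beta intro!: continuous_intros
        continuous_on_compose2[OF c(1)] continuous_on_compose2[OF c(2)]\<close>)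
  from lborel_pair.Fubini_integral[OF this]
  have "(\<integral>x. conv a b x \<partial>lborel) = (\<integral>y. (\<integral>x. a (x - y) * b y \<partial>lborel) \<partial>lborel)"
    by (simp add: conv_def)
  also have "\<dots> = (\<integral>y. (\<integral>x. a x \<partial>lborel) * b y \<partial>lborel)"
    using lborel_integral_shift[of a "- y" for y] continuous_on_UNIV_measurable[OF c(1)] by simp
  finally show ?thesis by simp
qed

text \<open>Jensen's inequality for the probability density \<open>a (x - y)\<close>: the variance
  of \<open>b\<close> about its mean \<open>conv a b x\<close> is nonnegative.\<close>

lemma conv_square_le:
  assumes "cts_cpt a" "\<And>x. 0 \<le> a x" "(\<integral>x. a x \<partial>lborel) = 1" "cts_cpt b"
  shows "(conv a b x)\<^sup>2 \<le> conv a (\<lambda>x. (b x)\<^sup>2) x"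
proof -
  note c = cts_cpt_continuous[OF assms(1)] cts_cpt_continuous[OF assms(4)]
  have c2: "cts_cpt (\<lambda>y. (b y)\<^sup>2)" using assms(4) by (auto intro: cts_cpt_power)
  have I: "integrable lborel (\<lambda>y. a (x - y))"
  proof -
    from assms(1) obtain r where r: "\<And>x. r < norm x \<Longrightarrow> a x = 0" by (auto simp: cts_cpt_def)
    have "a (x - y) = 0" if "norm x + r < norm y" for y
      using that norm_triangle_ineq2[of y x] by (intro r) (simp add: norm_minus_commute)
    then show ?thesis
      by (intro cts_cpt_integrable cts_cptI[where r = "norm x + r"] continuous_on_compose2[OF c(1)] continuous_intros) auto
  qed
  have one: "(\<integral>y. a (x - y) \<partial>lborel) = 1"
    using lborel_integral_reflect[OF continuous_on_UNIV_measurable[OF c(1)], of x] assms(3) by simp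
  have "0 \<le> (\<integral>y. a (x - y) * (b y - conv a b x)\<^sup>2 \<partial>lborel)"
    by (rule integral_nonneg_AE) (simp add: assms)
  also have "(\<lambda>y. a (x - y) * (b y - conv a b x)\<^sup>2) =
     (\<lambda>y. a (x - y) * (b y)\<^sup>2 - 2 * conv a b x * (a (x - y) * b y) + (conv a b x)\<^sup>2 * a (x - y))"
    by (simp add: fun_eq_iff power2_eq_square algebra_simps)
  also have "(\<integral>y. a (x - y) * (b y)\<^sup>2 - 2 * conv a b x * (a (x - y) * b y) + (conv a b x)\<^sup>2 * a (x - y) \<partial>lborel)
     = conv a (\<lambda>x. (b x)\<^sup>2) x - 2 * conv a b x * conv a b x + (conv a b x)\<^sup>2"
    using integrable_conv[OF c(1) c2, of x] integrable_conv[OF c(1) assms(4), of x] I one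
    by (simp add: conv_def)
  finally show ?thesis by (simp add: power2_eq_square)
qed

lemma integral_conv_square_le:
  assumes "cts_cpt a" "\<And>x. 0 \<le> a x" "(\<integral>x. a x \<partial>lborel) = 1" "cts_cpt b"
  shows "(\<integral>x. (conv a b x)\<^sup>2 \<partial>lborel) \<le> (\<integral>x. (b x)\<^sup>2 \<partial>lborel)"
proof -
  have c2: "cts_cpt (\<lambda>y. (b y)\<^sup>2)" using assms(4) by (auto intro: cts_cpt_power)
  have "(\<integral>x. (conv a b x)\<^sup>2 \<partial>lborel) \<le> (\<integral>x. conv a (\<lambda>x. (b x)\<^sup>2) x \<partial>lborel)"
    using assms c2 by (intro integral_mono conv_square_le) (auto intro!: cts_cpt_integrable cts_cpt_power cts_cpt_conv)
  also have "\<dots> = (\<integral>x. (b x)\<^sup>2 \<partial>lborel)"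
    using integral_conv[OF assms(1) c2] assms(3) by simp
  finally show ?thesis .
qed

lemma cts_cpt_uniform:
  fixes g :: "'a::euclidean_space \<Rightarrow> real"
  assumes "cts_cpt g" "0 < \<kappa>"
  obtains \<delta> where "0 < \<delta>" "\<And>x y. norm y \<le> \<delta> \<Longrightarrow> \<bar>g (x - y) - g x\<bar> \<le> \<kappa>"
proof -
  from assms obtain r where r: "\<And>x. r < norm x \<Longrightarrow> g x = 0" and c: "continuous_on UNIV g"
    by (auto simp: cts_cpt_def)
  have "uniformly_continuous_on (cball 0 (r + 2)) g"
    by (intro compact_uniformly_continuous continuous_on_subset[OF c]) auto
  then obtain d where d: "0 < d"
    "\<And>x y. x \<in> cball 0 (r + 2) \<Longrightarrow> y \<in> cball 0 (r + 2) \<Longrightarrow> dist y x < d \<Longrightarrow> dist (g y) (g x) < \<kappa>"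
    unfolding uniformly_continuous_on_def using assms(2) by metis
  show thesis
  \<comment> \<open>The bound 1 keeps \<open>x - y\<close> in the ball of radius
    \<open>r + 2\<close> when \<open>x\<close> is in that of radius \<open>r + 1\<close>; half of
    \<open>d\<close> gives the strict inequality that uniform continuity asks for.\<close>
  proof (rule that[of "min 1 (d / 2)"])
    fix x y :: 'a assume y: "norm y \<le> min 1 (d / 2)"
    show "\<bar>g (x - y) - g x\<bar> \<le> \<kappa>"
    proof (cases "norm x \<le> r + 1")
      case True
      then have "norm (x - y) \<le> r + 2" using norm_triangle_ineq4[of x y] y by linarith
      then show ?thesis
        using True d(2)[of x "x - y"] y d(1) by (simp add: dist_norm norm_minus_commute)
    next
      case False
      then have "r < norm (x - y)" using norm_triangle_ineq2[of x y] y by linarith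
      then show ?thesis using False r assms(2) by simp
    qed
  qed (use d in auto)
qed

lemma conv_approx:
  assumes "cts_cpt a" "\<And>x. 0 \<le> a x" "(\<integral>x. a x \<partial>lborel) = 1" "\<And>x. \<epsilon> < norm x \<Longrightarrow> a x = 0"
    and "continuous_on UNIV g" "\<And>x y. norm y \<le> \<epsilon> \<Longrightarrow> \<bar>g (x - y) - g x\<bar> \<le> \<kappa>"
  shows "\<bar>conv a g x - g x\<bar> \<le> \<kappa>"
proof -
  note c = cts_cpt_continuous[OF assms(1)]
  have I: "integrable lborel (\<lambda>y. g (x - y) * a y)"
    by (rule integrable_conv[OF assms(5,1)])
  have Ia: "integrable lborel a" by (rule cts_cpt_integrable[OF assms(1)])
  have "conv a g x - g x = (\<integral>y. g (x - y) * a y \<partial>lborel) - (\<integral>y. g x * a y \<partial>lborel)"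
    using conv_commute[OF c assms(5)] assms(3) by (simp add: conv_def)
  also have "\<dots> = (\<integral>y. g (x - y) * a y - g x * a y \<partial>lborel)"
    using I Ia by simp
  finally have "\<bar>conv a g x - g x\<bar> \<le> (\<integral>y. \<bar>g (x - y) * a y - g x * a y\<bar> \<partial>lborel)"
    by (metis integral_abs_bound)
  also have "\<dots> \<le> (\<integral>y. \<kappa> * a y \<partial>lborel)"
  proof (rule integral_mono)
    fix y
    show "\<bar>g (x - y) * a y - g x * a y\<bar> \<le> \<kappa> * a y"
      using assms(2,4,6) by (cases "norm y \<le> \<epsilon>") (auto simp: abs_mult left_diff_distrib[symmetric] intro!: mult_right_mono)
  qed (use I Ia in auto)
  also have "\<dots> = \<kappa>" using assms(3) by simp
  finally show ?thesis .
qed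

text \<open>\<open>N\<close> may grow at infinity. Uniform convergence of the mollified
  \<open>g\<close> is therefore paired with the integral \<open>B\<close> of the absolute value of
  \<open>N\<close> over a ball that contains all supports once \<epsilon> < 1.\<close>

lemma tendsto_integral_conv_approx:
  assumes a: "\<And>\<epsilon>. 0 < \<epsilon> \<Longrightarrow> cts_cpt (a \<epsilon>)" "\<And>\<epsilon> x. 0 < \<epsilon> \<Longrightarrow> 0 \<le> a \<epsilon> x"
    "\<And>\<epsilon>. 0 < \<epsilon> \<Longrightarrow> (\<integral>x. a \<epsilon> x \<partial>lborel) = 1" "\<And>\<epsilon> x. 0 < \<epsilon> \<Longrightarrow> \<epsilon> < norm x \<Longrightarrow> a \<epsilon> x = 0"
    and g: "cts_cpt g" and N: "continuous_on UNIV N"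
  shows "((\<lambda>\<epsilon>. \<integral>x. N x * conv (a \<epsilon>) g x \<partial>lborel) \<longlongrightarrow> (\<integral>x. N x * g x \<partial>lborel)) (at_right 0)"
proof (rule tendstoI)
  fix e :: real assume e: "0 < e"
  from g obtain r where r: "\<And>x. r < norm x \<Longrightarrow> g x = 0" and c: "continuous_on UNIV g"
    by (auto simp: cts_cpt_def)
  define B where "B = (\<integral>x. indicator (cball 0 (r + 1)) x *\<^sub>R \<bar>N x\<bar> \<partial>lborel)"
  have IB: "integrable lborel (\<lambda>x. indicator (cball 0 (r + 1)) x *\<^sub>R \<bar>N x\<bar>)"
    by (rule borel_integrable_compact) (auto intro!: continuous_intros continuous_on_subset[OF N])
  have B: "0 \<le> B" unfolding B_def by (rule integral_nonneg_AE) simp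
  define \<kappa> where "\<kappa> = e / (2 * (B + 1))"
  have \<kappa>: "0 < \<kappa>" using e B by (simp add: \<kappa>_def)
  from cts_cpt_uniform[OF g \<kappa>] obtain \<delta> where \<delta>: "0 < \<delta>"
    "\<And>x y. norm y \<le> \<delta> \<Longrightarrow> \<bar>g (x - y) - g x\<bar> \<le> \<kappa>" by blast
  have main: "\<bar>(\<integral>x. N x * conv (a \<epsilon>) g x \<partial>lborel) - (\<integral>x. N x * g x \<partial>lborel)\<bar> < e"
    if \<epsilon>: "0 < \<epsilon>" "\<epsilon> < min 1 \<delta>" for \<epsilon>
  proof -
    have ap: "\<bar>conv (a \<epsilon>) g x - g x\<bar> \<le> \<kappa>" for x
      by (rule conv_approx[of "a \<epsilon>" \<epsilon>]) (use a \<epsilon> \<delta> c in auto)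
    have supp: "conv (a \<epsilon>) g x - g x = 0" if "x \<notin> cball 0 (r + 1)" for x
    proof -
      have *: "a \<epsilon> (x - y) * g y = 0" for y
        using a(4)[of \<epsilon> "x - y"] r[of y] \<epsilon> that norm_triangle_ineq2[of x y] by fastforce
      have "g x = 0" using that r[of x] by simp
      then show ?thesis by (simp only: conv_def * Bochner_Integration.integral_zero)
    qed
    have i1: "integrable lborel (\<lambda>x. N x * conv (a \<epsilon>) g x)" "integrable lborel (\<lambda>x. N x * g x)"
      using a \<epsilon> g N by (auto intro!: cts_cpt_integrable cts_cpt_mult_left cts_cpt_conv)
    then have "(\<integral>x. N x * conv (a \<epsilon>) g x \<partial>lborel) - (\<integral>x. N x * g x \<partial>lborel)
      = (\<integral>x. N x * (conv (a \<epsilon>) g x - g x) \<partial>lborel)"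
      by (simp add: right_diff_distrib)
    also have "\<bar>\<dots>\<bar> \<le> (\<integral>x. \<bar>N x * (conv (a \<epsilon>) g x - g x)\<bar> \<partial>lborel)" by (rule integral_abs_bound)
    also have "\<dots> \<le> (\<integral>x. \<kappa> * (indicator (cball 0 (r + 1)) x *\<^sub>R \<bar>N x\<bar>) \<partial>lborel)"
    proof (rule integral_mono)
      show "integrable lborel (\<lambda>x. \<bar>N x * (conv (a \<epsilon>) g x - g x)\<bar>)"
        using i1 by (simp add: right_diff_distrib)
      show "\<bar>N x * (conv (a \<epsilon>) g x - g x)\<bar> \<le> \<kappa> * (indicator (cball 0 (r + 1)) x *\<^sub>R \<bar>N x\<bar>)" for x
        using mult_right_mono[OF ap[of x] abs_ge_zero[of "N x"]] supp[of x]
        by (auto simp: abs_mult indicator_def mult.commute)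
    qed (use IB in auto)
    also have "\<dots> = \<kappa> * B" by (simp add: B_def)
    also have "\<dots> < \<kappa> * (2 * (B + 1))" using \<kappa> B by (intro mult_strict_left_mono) auto
    also have "\<dots> = e" using B by (simp add: \<kappa>_def)
    finally show ?thesis .
  qed
  show "\<forall>\<^sub>F \<epsilon> in at_right 0. dist (\<integral>x. N x * conv (a \<epsilon>) g x \<partial>lborel) (\<integral>x. N x * g x \<partial>lborel) < e"
    unfolding eventually_at_right_field
    by (rule exI[of _ "min 1 \<delta>"]) (use main \<delta>(1) in \<open>auto simp: dist_real_def\<close>)
qed

section \<open>A truncated Newtonian kernel\<close>

text \<open>An exponent of at least two smooths the kink at 0: there the difference quotient is
  \<open>max 0 h ^ Suc n\<close>, which tends to 0.\<close>

lemma DERIV_pos_part_power: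
  "((\<lambda>x::real. max 0 x ^ Suc (Suc n)) has_real_derivative real (Suc (Suc n)) * max 0 x ^ Suc n) (at x)"
proof -
  consider "x > 0" | "x < 0" | "x = 0" by linarith
  then show ?thesis
  proof cases
    case 1
    have "((\<lambda>x. x ^ Suc (Suc n)) has_real_derivative real (Suc (Suc n)) * x ^ Suc n) (at x)"
      using DERIV_pow[of "Suc (Suc n)" x] by simp
    then have "((\<lambda>x. max 0 x ^ Suc (Suc n)) has_real_derivative real (Suc (Suc n)) * x ^ Suc n) (at x)"
      by (rule has_field_derivative_transform_within_open[of _ _ _ "{0<..}"]) (use 1 in auto)
    then show ?thesis using 1 by simp
  next
    case 2
    have "((\<lambda>x. 0) has_real_derivative 0) (at x)" by simp
    then have "((\<lambda>x. max 0 x ^ Suc (Suc n)) has_real_derivative 0) (at x)"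
      by (rule has_field_derivative_transform_within_open[of _ _ _ "{..<0}"]) (use 2 in auto)
    then show ?thesis using 2 by simp
  next
    case 3
    have "((\<lambda>h. (max 0 h) ^ Suc n) \<longlongrightarrow> max 0 0 ^ Suc n) (at (0::real))"
      by (intro tendsto_intros)
    then have "((\<lambda>h. (max 0 h) ^ Suc n) \<longlongrightarrow> 0) (at (0::real))" by simp
    then have "((\<lambda>h. (max 0 h ^ Suc (Suc n)) / h) \<longlongrightarrow> 0) (at (0::real))"
      by (rule Lim_transform_eventually) (auto simp: eventually_at_filter max_def)
    then show ?thesis using 3 by (simp add: has_field_derivative_iff)
  qed
qed

text \<open>
  The kernel is \<open>kq 0 \<epsilon> L (|z|\<^sup>2)\<close> up to a factor, a superposition over the scales \<open>\<epsilon> \<le> s \<le> L\<close>, and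
  \<open>kq m\<close> is a multiple of its \<open>m\<close>-th derivative. The Laplacian of \<open>s\<^sup>-\<^sup>2 (1 - |z|\<^sup>2/s\<^sup>2)\<^sub>+\<^sup>4\<close> is eight times the
  \<open>s\<close>-derivative of \<open>s\<^sup>-\<^sup>3 (1 - |z|\<^sup>2/s\<^sup>2)\<^sub>+\<^sup>3\<close>, so the Laplacian of the kernel is a difference of two bumps.
\<close>

definition kq :: "nat \<Rightarrow> real \<Rightarrow> real \<Rightarrow> real \<Rightarrow> real" where
  "kq m \<epsilon> L q = integral {\<epsilon>..L} (\<lambda>s. (1 / s) ^ (2 + 2 * m) * max 0 (1 - q / s\<^sup>2) ^ (4 - m))"

lemma continuous_kq_integrand:
  assumes "0 < \<epsilon>"
  shows "continuous_on (UNIV \<times> {\<epsilon>..L}) (\<lambda>(q, s). (1 / s) ^ n * max 0 (1 - q / s\<^sup>2) ^ m :: real)"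
  unfolding case_prod_beta by (intro continuous_intros) (use assms in auto)

lemma kq_integrand_integrable:
  "0 < \<epsilon> \<Longrightarrow> (\<lambda>s. (1 / s) ^ n * max 0 (1 - q / s\<^sup>2) ^ m :: real) integrable_on {\<epsilon>..L}"
  by (rule integrable_continuous_real) (auto intro!: continuous_intros)

lemma continuous_kq: "0 < \<epsilon> \<Longrightarrow> continuous_on UNIV (kq m \<epsilon> L)"
  unfolding kq_def[abs_def] cbox_interval[symmetric]
  by (rule integral_continuous_on_param) (simp only: cbox_interval continuous_kq_integrand)

text \<open>Each derivative in \<open>q\<close> lowers the power of the positive part by one and
  brings a factor \<open>1 / s^2\<close>, which is the passage from \<open>2 + 2 * m\<close> to
  \<open>2 + 2 * Suc m\<close>. For \<open>m < 3\<close> the exponent \<open>4 - m\<close> is at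
  least two, so the integrand is still continuously differentiable.\<close>

lemma DERIV_kq:
  assumes "0 < \<epsilon>" "m < 3"
  shows "(kq m \<epsilon> L has_real_derivative - (real (4 - m) * kq (Suc m) \<epsilon> L q)) (at q)"
proof -
  obtain n where n: "4 - m = Suc (Suc n)" "4 - Suc m = Suc n"
    by (rule that[of "2 - m"]) (use assms(2) in auto)
  let ?f = "\<lambda>q s. (1 / s) ^ (2 + 2 * m) * max 0 (1 - q / s\<^sup>2) ^ Suc (Suc n) :: real"
  let ?f' = "\<lambda>q s. - (real (Suc (Suc n)) * ((1 / s) ^ (2 + 2 * Suc m) * max 0 (1 - q / s\<^sup>2) ^ Suc n)) :: real"
  have "((\<lambda>q. integral (cbox \<epsilon> L) (?f q)) has_real_derivative integral (cbox \<epsilon> L) (?f' q)) (at q within UNIV)"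
  proof (rule leibniz_rule_field_derivative)
    fix q s :: real assume s: "s \<in> cbox \<epsilon> L"
    have 1: "((\<lambda>q. 1 - q / s\<^sup>2) has_real_derivative - (1 / s\<^sup>2)) (at q)"
      using DERIV_diff[OF DERIV_const DERIV_cdivide[OF DERIV_ident], of 1 "s\<^sup>2" q UNIV] by simp
    have e: "(1 / s) ^ (2 + 2 * Suc m) = (1 / s) ^ (2 + 2 * m) * (1 / s\<^sup>2)"
      by (simp add: power2_eq_square)
    show "((\<lambda>q. ?f q s) has_real_derivative ?f' q s) (at q within UNIV)"
      by (rule DERIV_cong[OF DERIV_cmult[OF DERIV_chain2[OF DERIV_pos_part_power[of n] 1]]]) (unfold e, simp only: mult_ac mult_minus_left mult_minus_right)
  next
    show "continuous_on (UNIV \<times> cbox \<epsilon> L) (\<lambda>(q, s). ?f' q s)"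
      unfolding case_prod_beta by (intro continuous_intros) (use assms in auto)
  next
    show "?f q integrable_on cbox \<epsilon> L" for q
      unfolding cbox_interval by (rule kq_integrand_integrable[OF assms(1)])
  qed auto
  moreover have "integral (cbox \<epsilon> L) (?f' q) = - (real (4 - m) * kq (Suc m) \<epsilon> L q)"
    unfolding kq_def n by (simp only: cbox_interval integral_neg integral_mult_right)
  ultimately show ?thesis
    unfolding kq_def n by simp
qed

lemma kq_eq_0:
  assumes "0 < \<epsilon>" "0 \<le> L" "L\<^sup>2 \<le> q" "m \<le> 3"
  shows "kq m \<epsilon> L q = 0"
proof -
  have "(1 / s) ^ (2 + 2 * m) * max 0 (1 - q / s\<^sup>2) ^ (4 - m) = 0" if "s \<in> {\<epsilon>..L}" for s
  proof -
    have "s\<^sup>2 \<le> q" using that assms by (intro order_trans[OF power_mono assms(3)]) auto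
    then have "1 - q / s\<^sup>2 \<le> 0" using that assms by (auto simp: field_simps)
    \<comment> \<open>\<open>m \<le> 3\<close> makes the exponent \<open>4 - m\<close> positive, so
      that the vanishing positive part annihilates the integrand; \<open>0 ^ 0\<close> would be
      1.\<close>
    then show ?thesis using assms(4) by (auto simp: max_def)
  qed
  then have "kq m \<epsilon> L q = integral {\<epsilon>..L} (\<lambda>s. 0)"
    unfolding kq_def by (intro integral_cong) auto
  then show ?thesis by simp
qed

text \<open>For \<open>s < a\<close> the left-hand side vanishes, and for \<open>s \<ge> a\<close> one has \<open>s + a \<le> 2 s\<close>.\<close>

lemma kq_integrand_le:
  fixes s a :: real
  assumes "0 < s" "0 \<le> a" "0 < k"
  shows "(1 / s) ^ n * max 0 (1 - a\<^sup>2 / s\<^sup>2) ^ k \<le> (2 / (s + a)) ^ n"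
proof (cases "s < a")
  case True
  then have "1 - a\<^sup>2 / s\<^sup>2 \<le> 0" using assms power_mono[of s a 2] by (auto simp: field_simps)
  then have "max 0 (1 - a\<^sup>2 / s\<^sup>2) = 0" by simp
  then show ?thesis using assms by (simp add: power_0_left)
next
  case False
  have "max 0 (1 - a\<^sup>2 / s\<^sup>2) ^ k \<le> 1" using assms by (intro power_le_one) auto
  then have "(1 / s) ^ n * max 0 (1 - a\<^sup>2 / s\<^sup>2) ^ k \<le> (1 / s) ^ n"
    using assms by (intro mult_left_le) auto
  also have "\<dots> \<le> (2 / (s + a)) ^ n"
    using False assms by (intro power_mono) (auto simp: field_simps)
  finally show ?thesis .
qed

lemma integral_inverse_4:
  fixes \<epsilon> L a :: real
  assumes "0 < \<epsilon>" "\<epsilon> \<le> L" "0 < a"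
  shows "integral {\<epsilon>..L} (\<lambda>s. 1 / (s + a) ^ 4) \<le> 1 / (3 * a ^ 3)"
    and "(\<lambda>s. 1 / (s + a) ^ 4) integrable_on {\<epsilon>..L}"
proof -
  have "((\<lambda>s. 1 / (s + a) ^ 4) has_integral (- 1 / (3 * (L + a) ^ 3)) - (- 1 / (3 * (\<epsilon> + a) ^ 3))) {\<epsilon>..L}"
  proof (rule fundamental_theorem_of_calculus)
    fix s assume "s \<in> {\<epsilon>..L}"
    then have "s + a \<noteq> 0" using assms by auto
    then have 1: "((\<lambda>s. 1 / (s + a)) has_real_derivative - ((1 / (s + a))\<^sup>2)) (at s within {\<epsilon>..L})"
      by (auto intro!: derivative_eq_intros simp: power2_eq_square)
    have "((\<lambda>s. - (1 / 3) * (1 / (s + a)) ^ 3) has_real_derivative - (1 / 3) * (of_nat 3 * (- ((1 / (s + a))\<^sup>2)) * (1 / (s + a)) ^ (3 - 1))) (at s within {\<epsilon>..L})"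
      using DERIV_cmult[OF DERIV_power[OF 1, of 3], of "- (1 / 3)"] by (simp add: mult_ac)
    then have "((\<lambda>s. - 1 / (3 * (s + a) ^ 3)) has_real_derivative 1 / (s + a) ^ 4) (at s within {\<epsilon>..L})"
      by (simp add: power_divide flip: power_add)
    then show "((\<lambda>s. - 1 / (3 * (s + a) ^ 3)) has_vector_derivative 1 / (s + a) ^ 4) (at s within {\<epsilon>..L})"
      by (simp add: has_real_derivative_iff_has_vector_derivative)
  qed (use assms in auto)
  moreover have "0 \<le> 1 / (3 * (L + a) ^ 3)" using assms by (intro divide_nonneg_nonneg mult_nonneg_nonneg zero_le_power) auto
  moreover have "1 / (3 * (\<epsilon> + a) ^ 3) \<le> 1 / (3 * a ^ 3)"
    using assms by (intro divide_left_mono mult_left_mono power_mono) auto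
  ultimately show "integral {\<epsilon>..L} (\<lambda>s. 1 / (s + a) ^ 4) \<le> 1 / (3 * a ^ 3)"
    "(\<lambda>s. 1 / (s + a) ^ 4) integrable_on {\<epsilon>..L}"
    unfolding has_integral_iff by linarith+
qed

text \<open>The powers of \<open>2 / (s + a)\<close> are integrable over all scales, so neither
  \<epsilon> nor \<open>L\<close> enters; this is the source of the decay \<open>|z|^-3\<close>. In
  the second bound \<open>a\<^sup>2 \<le> (s + a)\<^sup>2\<close> reduces the sixth power to the
  fourth. The numerators are \<open>2^4\<close> and \<open>2^6\<close>.\<close>

lemma kq_bounds:
  assumes "0 < \<epsilon>" "\<epsilon> \<le> L" "0 < a"
  shows "\<bar>kq 1 \<epsilon> L (a\<^sup>2)\<bar> \<le> 16 / (3 * a ^ 3)" "a\<^sup>2 * \<bar>kq 2 \<epsilon> L (a\<^sup>2)\<bar> \<le> 64 / (3 * a ^ 3)"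
proof -
  note I = integral_inverse_4[OF assms]
  have J: "(\<lambda>s. c * (1 / (s + a) ^ 4)) integrable_on {\<epsilon>..L}" for c
    using integrable_cmul[OF I(2), of c] by simp
  have "\<bar>kq 1 \<epsilon> L (a\<^sup>2)\<bar> \<le> integral {\<epsilon>..L} (\<lambda>s. 16 * (1 / (s + a) ^ 4))"
    unfolding kq_def real_norm_def[symmetric]
  proof (rule integral_norm_bound_integral)
    fix s assume s: "s \<in> {\<epsilon>..L}"
    then show "norm ((1 / s) ^ (2 + 2 * 1) * max 0 (1 - a\<^sup>2 / s\<^sup>2) ^ (4 - 1)) \<le> 16 * (1 / (s + a) ^ 4)"
      using kq_integrand_le[of s a 3 4] assms by (simp add: power_divide abs_mult)
  qed (use J[of 16] J[of 64] kq_integrand_integrable[OF assms(1), of 4 "a\<^sup>2" 3] in \<open>simp_all\<close>)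
  also have "\<dots> \<le> 16 * (1 / (3 * a ^ 3))" unfolding integral_mult_right using I(1) by (rule mult_left_mono) simp
  finally show "\<bar>kq 1 \<epsilon> L (a\<^sup>2)\<bar> \<le> 16 / (3 * a ^ 3)" by simp
  have "\<bar>a\<^sup>2 * kq 2 \<epsilon> L (a\<^sup>2)\<bar> \<le> integral {\<epsilon>..L} (\<lambda>s. 64 * (1 / (s + a) ^ 4))"
    unfolding kq_def real_norm_def[symmetric] integral_mult_right[symmetric]
  proof (rule integral_norm_bound_integral)
    fix s assume s: "s \<in> {\<epsilon>..L}"
    then have "a\<^sup>2 \<le> (s + a)\<^sup>2" "0 < s" using assms by (auto intro!: power_mono)
    have "norm (a\<^sup>2 * ((1 / s) ^ (2 + 2 * 2) * max 0 (1 - a\<^sup>2 / s\<^sup>2) ^ (4 - 2))) \<le> (s + a)\<^sup>2 * (2 / (s + a)) ^ 6"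
      unfolding norm_mult
    proof (rule mult_mono)
      show "norm ((1 / s) ^ (2 + 2 * 2)) * norm (max 0 (1 - a\<^sup>2 / s\<^sup>2) ^ (4 - 2)) \<le> (2 / (s + a)) ^ 6"
        using kq_integrand_le[of s a 2 6] assms \<open>0 < s\<close> by (simp add: power_divide abs_mult)
    qed (use \<open>a\<^sup>2 \<le> (s + a)\<^sup>2\<close> in auto)
    also have "\<dots> = 64 * (1 / (s + a) ^ 4)"
    proof -
      have "s + a \<noteq> 0" using \<open>0 < s\<close> assms by linarith
      then have "(s + a)\<^sup>2 * (2 / (s + a)) ^ (2 + 4) = 2 ^ 6 / (s + a) ^ 4"
        unfolding power_add power_divide by (simp add: field_simps)
      then show ?thesis by simp
    qed
    finally show "norm (a\<^sup>2 * ((1 / s) ^ (2 + 2 * 2) * max 0 (1 - a\<^sup>2 / s\<^sup>2) ^ (4 - 2))) \<le> 64 * (1 / (s + a) ^ 4)" .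
  qed (use J[of 16] J[of 64] integrable_cmul[OF kq_integrand_integrable[OF assms(1), of 6 "a\<^sup>2" 2], of "a\<^sup>2"] in \<open>simp_all\<close>)
  also have "\<dots> \<le> 64 * (1 / (3 * a ^ 3))" unfolding integral_mult_right using I(1) by (rule mult_left_mono) simp
  finally show "a\<^sup>2 * \<bar>kq 2 \<epsilon> L (a\<^sup>2)\<bar> \<le> 64 / (3 * a ^ 3)" by (simp add: abs_mult)
qed

text \<open>In three dimensions the Laplacian of \<open>k (|z|^2)\<close> is
  \<open>4 q k'' + 6 k'\<close> at \<open>q = |z|^2\<close>. For \<open>k = kq 0\<close> one has
  \<open>k' = -4 kq 1\<close> and \<open>k'' = 12 kq 2\<close>, which gives the left-hand side. Its
  integrand is an exact derivative in \<open>s\<close>, and only the two end scales remain.\<close>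

lemma kq_telescope:
  assumes "0 < \<epsilon>" "\<epsilon> \<le> L"
  shows "48 * q * kq 2 \<epsilon> L q - 24 * kq 1 \<epsilon> L q =
    8 * ((1 / L) ^ 3 * max 0 (1 - q / L\<^sup>2) ^ 3 - (1 / \<epsilon>) ^ 3 * max 0 (1 - q / \<epsilon>\<^sup>2) ^ 3)"
proof -
  let ?F = "\<lambda>s. 8 * ((1 / s) ^ 3 * max 0 (1 - q / s\<^sup>2) ^ 3)"
  let ?f = "\<lambda>s. 48 * q * ((1 / s) ^ 6 * max 0 (1 - q / s\<^sup>2) ^ 2) - 24 * ((1 / s) ^ 4 * max 0 (1 - q / s\<^sup>2) ^ 3)"
  have "(?f has_integral ?F L - ?F \<epsilon>) {\<epsilon>..L}"
  proof (rule fundamental_theorem_of_calculus)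
    fix s assume "s \<in> {\<epsilon>..L}"
    then have s: "s \<noteq> 0" using assms by auto
    have 0: "((\<lambda>s. 1 / s) has_real_derivative - ((1 / s)\<^sup>2)) (at s)"
      using s by (auto intro!: derivative_eq_intros simp: power2_eq_square)
    have 1: "((\<lambda>s. 1 - q / s\<^sup>2) has_real_derivative 2 * q / s ^ 3) (at s)"
      using DERIV_diff[OF DERIV_const DERIV_cmult[OF DERIV_power[OF 0, of 2], of q], of 1]
      by (simp add: power_divide power2_eq_square power3_eq_cube mult.commute[of q])
    have 2: "((\<lambda>s. max 0 (1 - q / s\<^sup>2) ^ 3) has_real_derivative 3 * max 0 (1 - q / s\<^sup>2) ^ 2 * (2 * q / s ^ 3)) (at s)"
      using DERIV_chain2[OF DERIV_pos_part_power[of 1] 1] by (simp add: numeral_eq_Suc)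
    have 3: "((\<lambda>s. (1 / s) ^ 3) has_real_derivative - 3 * (1 / s) ^ 4) (at s)"
      using DERIV_power[OF 0, of 3] by (simp add: power_divide flip: power_add)
    have "(?F has_real_derivative 8 * (- 3 * (1 / s) ^ 4 * max 0 (1 - q / s\<^sup>2) ^ 3 +
        3 * max 0 (1 - q / s\<^sup>2) ^ 2 * (2 * q / s ^ 3) * (1 / s) ^ 3)) (at s)"
      by (rule DERIV_cmult[OF DERIV_mult[OF 3 2]])
    moreover have "8 * (- 3 * (1 / s) ^ 4 * max 0 (1 - q / s\<^sup>2) ^ 3 +
        3 * max 0 (1 - q / s\<^sup>2) ^ 2 * (2 * q / s ^ 3) * (1 / s) ^ 3) = ?f s"
    proof -
      have "(1 / s) ^ (3 + 3) = (1 / s ^ 3) * (1 / s) ^ 3"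
        by (simp only: power_add power_divide power_one)
      then show ?thesis by (simp add: algebra_simps)
    qed
    ultimately show "(?F has_vector_derivative ?f s) (at s within {\<epsilon>..L})"
      by (simp add: has_real_derivative_iff_has_vector_derivative has_vector_derivative_at_within)
  qed (use assms in auto)
  moreover have "(?f has_integral 48 * q * kq 2 \<epsilon> L q - 24 * kq 1 \<epsilon> L q) {\<epsilon>..L}"
    unfolding kq_def
    using kq_integrand_integrable[OF assms(1), of 6 q 2] kq_integrand_integrable[OF assms(1), of 4 q 3]
    by (intro has_integral_diff has_integral_mult_right) (auto simp: has_integral_integral)
  ultimately have "48 * q * kq 2 \<epsilon> L q - 24 * kq 1 \<epsilon> L q = ?F L - ?F \<epsilon>"
    by (rule has_integral_unique[rotated])
  then show ?thesis by (simp only: right_diff_distrib)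
qed

abbreviation ax :: "3 \<Rightarrow> real^3" where "ax i \<equiv> axis i 1"

lemma integral_lborel_scale:
  fixes f :: "'a::euclidean_space \<Rightarrow> real"
  assumes [measurable]: "f \<in> borel_measurable borel" and c: "0 < c"
  shows "(\<integral>x. f x \<partial>lborel) = c ^ DIM('a) * (\<integral>x. f (c *\<^sub>R x) \<partial>lborel)"
    and "integrable lborel f \<longleftrightarrow> integrable lborel (\<lambda>x. f (c *\<^sub>R x))"
proof -
  have eq: "lborel = density (distr lborel borel (\<lambda>x::'a. c *\<^sub>R x)) (\<lambda>_. ennreal (c ^ DIM('a)))"
    using lborel_affine[of c 0] c by simp
  show "(\<integral>x. f x \<partial>lborel) = c ^ DIM('a) * (\<integral>x. f (c *\<^sub>R x) \<partial>lborel)"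
    by (subst eq, subst integral_density) (use c in \<open>auto simp: integral_distr\<close>)
  show "integrable lborel f \<longleftrightarrow> integrable lborel (\<lambda>x. f (c *\<^sub>R x))"
    by (subst eq, subst integrable_density) (use c in \<open>auto simp: integrable_distr_eq\<close>)
qed

lemma C1_dir_coord: "C1_dir (ax j) (\<lambda>z. z $ i) (\<lambda>z. if i = j then 1 else 0)"
  by (rule C1_dirI[where D = "\<lambda>_ h. h $ i"])
     (auto simp: axis_def intro!: bounded_linear_imp_has_derivative bounded_linear_vec_nth)

lemma C1_dir_radial:
  fixes k :: "real \<Rightarrow> real"
  assumes "\<And>q. (k has_real_derivative k' q) (at q)" "continuous_on UNIV k'"
  shows "C1_dir (ax i) (\<lambda>z. k (z \<bullet> z)) (\<lambda>z. 2 * z $ i * k' (z \<bullet> z))"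
proof -
  have "C1_dir (ax i) (\<lambda>z. z \<bullet> z) (\<lambda>z. 2 * z $ i)"
    by (rule C1_dirI[where D = "\<lambda>z h. z \<bullet> h + h \<bullet> z"])
       (auto intro!: derivative_eq_intros continuous_intros simp: inner_axis inner_axis')
  from C1_dir_compose[OF this assms] show ?thesis by (simp add: mult.commute)
qed

lemma norm_vec_sq: "(norm (z::real^3))\<^sup>2 = (\<Sum>i\<in>UNIV. (z $ i)\<^sup>2)"
  by (simp add: norm_vec_def L2_set_def sum_nonneg)

subsection \<open>Bumps of mass one\<close>

definition bump_mass :: real where
  "bump_mass = (\<integral>z. max 0 (1 - z \<bullet> (z::real^3)) ^ 3 \<partial>lborel)"

text \<open>The cube is dictated by the kernel: up to the factor that makes the mass one, these are
  the profiles that remain at the two end scales of \<open>kq_telescope\<close>.\<close>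

definition bump :: "real \<Rightarrow> real^3 \<Rightarrow> real" where
  "bump s z = (1 / s) ^ 3 * max 0 (1 - (z \<bullet> z) / s\<^sup>2) ^ 3 / bump_mass"

definition bump_d :: "3 \<Rightarrow> real \<Rightarrow> real^3 \<Rightarrow> real" where
  "bump_d i s z = - (6 * z $ i * (1 / s) ^ 5 * max 0 (1 - (z \<bullet> z) / s\<^sup>2) ^ 2 / bump_mass)"

lemma bump_mass_pos: "0 < bump_mass"
proof -
  let ?f = "\<lambda>z::real^3. max 0 (1 - z \<bullet> z) ^ 3"
  have I: "integrable lborel ?f"
  proof (rule cts_cpt_integrable, rule cts_cptI[where r = 1])
    show "max 0 (1 - z \<bullet> z) ^ 3 = 0" if "1 < norm z" for z :: "real^3"
      using one_less_power[OF that, of 2] by (simp add: dot_square_norm)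
  qed (intro continuous_intros)
  \<comment> \<open>On the ball of radius 1/2 the base of the cube is at least 1/2, hence the lower
    bound 1/8.\<close>
  have "0 < 1 / 8 * measure lborel (cball (0::real^3) (1 / 2))"
    using content_cball_pos[of "1/2" "0::real^3"] by simp
  also have "\<dots> = (\<integral>z. 1 / 8 * indicator (cball (0::real^3) (1 / 2)) z \<partial>lborel)"
    by simp
  also have "\<dots> \<le> bump_mass"
    unfolding bump_mass_def
  proof (rule integral_mono[OF _ I])
    show "integrable lborel (\<lambda>z. 1 / 8 * indicator (cball (0::real^3) (1 / 2)) z :: real)"
      by (intro integrable_mult_right integrable_real_indicator) (auto simp: emeasure_lborel_cball_finite simp flip: infinity_ennreal_def)
    show "1 / 8 * indicator (cball 0 (1 / 2)) z \<le> ?f z" for z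
    proof (cases "z \<in> cball 0 (1 / 2)")
      case True
      then have "z \<bullet> z \<le> (1 / 2)\<^sup>2" by (simp add: dot_square_norm power_mono)
      then have "1 / 2 \<le> max 0 (1 - z \<bullet> z)" by (simp add: power2_eq_square)
      then have "(1 / 2) ^ 3 \<le> ?f z" by (rule power_mono) simp
      then show ?thesis using True by (simp add: power3_eq_cube)
    qed simp
  qed
  finally show ?thesis .
qed

lemma bump_nonneg: "0 < s \<Longrightarrow> 0 \<le> bump s z"
  using bump_mass_pos by (auto simp: bump_def)

lemma pos_part_radial_eq_0:
  fixes z :: "'a::real_inner"
  shows "0 < s \<Longrightarrow> s < norm z \<Longrightarrow> max 0 (1 - (z \<bullet> z) / s\<^sup>2) = 0"
  using power_strict_mono[of s "norm z" 2] by (simp add: dot_square_norm field_simps max_def)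

lemma pos_part_radial_le_1: "max 0 (1 - (z \<bullet> z) / s\<^sup>2) \<le> 1"
  by simp

lemma bump_supp: "0 < s \<Longrightarrow> s < norm z \<Longrightarrow> bump s z = 0"
  using pos_part_radial_eq_0[of s z] by (simp add: bump_def)

lemma bump_le: "0 < s \<Longrightarrow> \<bar>bump s z\<bar> \<le> 1 / (s ^ 3 * bump_mass)"
proof -
  assume s: "0 < s"
  have "max 0 (1 - (z \<bullet> z) / s\<^sup>2) ^ 3 \<le> 1"
    using pos_part_radial_le_1 by (intro power_le_one) auto
  then have "bump s z \<le> (1 / s) ^ 3 * 1 / bump_mass"
    unfolding bump_def using s bump_mass_pos by (intro divide_right_mono mult_left_mono) auto
  then show ?thesis using bump_nonneg[OF s, of z] by (simp add: power_divide)
qed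

lemma bump_d_le: "0 < s \<Longrightarrow> \<bar>bump_d i s z\<bar> \<le> 6 / (s ^ 4 * bump_mass)"
proof (cases "s < norm z")
  case True
  assume s: "0 < s"
  then show ?thesis using pos_part_radial_eq_0[OF s True] bump_mass_pos by (simp add: bump_d_def)
next
  case False
  assume s: "0 < s"
  have "max 0 (1 - (z \<bullet> z) / s\<^sup>2) ^ 2 \<le> 1"
    using pos_part_radial_le_1 by (intro power_le_one) auto
  moreover have "\<bar>z $ i\<bar> \<le> s" using False component_le_norm_cart[of z i] by linarith
  ultimately have "6 * \<bar>z $ i\<bar> * (1 / s) ^ 5 * max 0 (1 - (z \<bullet> z) / s\<^sup>2) ^ 2 / bump_mass \<le> 6 * s * (1 / s) ^ 5 * 1 / bump_mass"
    using s bump_mass_pos by (intro divide_right_mono mult_mono) auto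
  then show ?thesis using s bump_mass_pos by (simp add: bump_d_def abs_mult power_divide field_simps eval_nat_numeral)
qed

lemma C1_dir_bump: "0 < s \<Longrightarrow> C1_dir (ax i) (bump s) (bump_d i s)"
proof -
  assume s: "0 < s"
  have 1: "((\<lambda>q. 1 - q / s\<^sup>2) has_real_derivative - (1 / s\<^sup>2)) (at q)" for q
    using DERIV_diff[OF DERIV_const DERIV_cdivide[OF DERIV_ident], of 1 "s\<^sup>2" q UNIV] by simp
  have "((\<lambda>q. max 0 (1 - q / s\<^sup>2) ^ 3) has_real_derivative 3 * max 0 (1 - q / s\<^sup>2) ^ 2 * - (1 / s\<^sup>2)) (at q)" for q
    using DERIV_chain2[OF DERIV_pos_part_power[of 1] 1] by (simp add: numeral_eq_Suc)
  moreover have "continuous_on UNIV (\<lambda>q. 3 * max 0 (1 - q / s\<^sup>2) ^ 2 * - (1 / s\<^sup>2))"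
    using s by (intro continuous_intros) auto
  ultimately have "C1_dir (ax i) (\<lambda>z. max 0 (1 - (z \<bullet> z) / s\<^sup>2) ^ 3)
      (\<lambda>z. 2 * z $ i * (3 * max 0 (1 - (z \<bullet> z) / s\<^sup>2) ^ 2 * - (1 / s\<^sup>2)))"
    by (rule C1_dir_radial)
  from C1_dir_cmult[OF this, where c = "(1 / s) ^ 3 / bump_mass"]
  show ?thesis
    by (rule C1_dir_eq) (use s in \<open>auto simp: bump_def bump_d_def power_divide eval_nat_numeral mult_ac\<close>)
qed

lemma cts_cpt_bump: "0 < s \<Longrightarrow> cts_cpt (bump s)"
  using C1_dir_bump bump_supp by (intro cts_cptI[where r = s]) (auto dest: C1_dir_continuous)

lemma cts_cpt_bump_d: "0 < s \<Longrightarrow> cts_cpt (bump_d i s)"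
  using cts_cpt_C1_dir[OF C1_dir_bump cts_cpt_bump] .

lemma integral_bump: "0 < s \<Longrightarrow> (\<integral>z. bump s z \<partial>lborel) = 1"
proof -
  assume s: "0 < s"
  have "(\<integral>z. bump s z \<partial>lborel) = s ^ 3 * (\<integral>z. bump s (s *\<^sub>R z) \<partial>lborel)"
    using integral_lborel_scale(1)[of "bump s" s] s cts_cpt_continuous[OF cts_cpt_bump[OF s]] by simp
  also have "(\<lambda>z. bump s (s *\<^sub>R z)) = (\<lambda>z. (1 / s) ^ 3 / bump_mass * max 0 (1 - z \<bullet> z) ^ 3)"
    using s by (simp add: bump_def fun_eq_iff power2_eq_square)
  finally show ?thesis
    using s bump_mass_pos by (simp add: bump_mass_def[symmetric] power_divide)
qed

subsection \<open>The kernel in space\<close>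

text \<open>The 8 cancels the one in \<open>kq_telescope\<close>; division by
  \<open>bump_mass\<close> turns the remaining profiles into bumps of mass one.\<close>

definition krn :: "real \<Rightarrow> real \<Rightarrow> real^3 \<Rightarrow> real" where
  "krn \<epsilon> L z = kq 0 \<epsilon> L (z \<bullet> z) / (8 * bump_mass)"

text \<open>\<open>krn1\<close>, \<open>krn2\<close> and \<open>krn3\<close> are the partial
  derivatives of \<open>krn\<close> of orders one to three. Differentiating
  \<open>kq m (|z|^2)\<close> in direction \<open>i\<close> produces \<open>-2 (4 - m) z_i\<close>
  and raises \<open>m\<close> by one; the coefficients -1, 6 and -24 arise in this way.\<close>

definition krn1 :: "real \<Rightarrow> real \<Rightarrow> 3 \<Rightarrow> real^3 \<Rightarrow> real" where
  "krn1 \<epsilon> L i z = z $ i * (- kq 1 \<epsilon> L (z \<bullet> z)) / bump_mass"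

definition krn2 :: "real \<Rightarrow> real \<Rightarrow> 3 \<Rightarrow> 3 \<Rightarrow> real^3 \<Rightarrow> real" where
  "krn2 \<epsilon> L i j z = ((if i = j then - kq 1 \<epsilon> L (z \<bullet> z) else 0) + 6 * z $ i * z $ j * kq 2 \<epsilon> L (z \<bullet> z)) / bump_mass"

definition krn3 :: "real \<Rightarrow> real \<Rightarrow> 3 \<Rightarrow> 3 \<Rightarrow> 3 \<Rightarrow> real^3 \<Rightarrow> real" where
  "krn3 \<epsilon> L i j l z = (6 * ((if i = j then z $ l else 0) + (if i = l then z $ j else 0) + (if j = l then z $ i else 0)) * kq 2 \<epsilon> L (z \<bullet> z)
     - 24 * z $ i * z $ j * z $ l * kq 3 \<epsilon> L (z \<bullet> z)) / bump_mass"

lemma C1_dir_kq: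
  assumes "0 < \<epsilon>" "m < 3"
  shows "C1_dir (ax i) (\<lambda>z. kq m \<epsilon> L (z \<bullet> z)) (\<lambda>z. 2 * z $ i * (- (real (4 - m) * kq (Suc m) \<epsilon> L (z \<bullet> z))))"
  by (rule C1_dir_radial[OF DERIV_kq[OF assms]]) (intro continuous_intros continuous_kq assms)

lemma C1_dir_krn: "0 < \<epsilon> \<Longrightarrow> C1_dir (ax i) (krn \<epsilon> L) (krn1 \<epsilon> L i)"
  by (rule C1_dir_eq[OF C1_dir_cmult[OF C1_dir_kq[of \<epsilon> 0 i L], of "1 / (8 * bump_mass)"]])
     (auto simp: krn_def krn1_def)

lemma C1_dir_krn1: "0 < \<epsilon> \<Longrightarrow> C1_dir (ax j) (krn1 \<epsilon> L i) (krn2 \<epsilon> L i j)"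
  by (rule C1_dir_eq[OF C1_dir_cmult[OF C1_dir_mult[OF C1_dir_coord[of j i] C1_dir_minus[OF C1_dir_kq[of \<epsilon> 1 j L]]], of "1 / bump_mass"]])
     (auto simp: krn1_def krn2_def numeral_2_eq_2 field_simps)

lemma C1_dir_krn2: "0 < \<epsilon> \<Longrightarrow> C1_dir (ax l) (krn2 \<epsilon> L i j) (krn3 \<epsilon> L i j l)"
  by (rule C1_dir_eq[OF C1_dir_cmult[OF C1_dir_add[OF C1_dir_cmult[OF C1_dir_minus[OF C1_dir_kq[of \<epsilon> 1 l L]], of "if i = j then 1 else 0"]
        C1_dir_cmult[OF C1_dir_mult[OF C1_dir_mult[OF C1_dir_coord[of l i] C1_dir_coord[of l j]] C1_dir_kq[of \<epsilon> 2 l L]], of 6]], of "1 / bump_mass"]])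
     (auto simp: krn2_def krn3_def numeral_2_eq_2 numeral_3_eq_3 field_simps)

lemma krn3_swap: "krn3 \<epsilon> L i j j = krn3 \<epsilon> L j j i" "krn2 \<epsilon> L i j = krn2 \<epsilon> L j i"
  by (auto simp: krn3_def krn2_def fun_eq_iff)

lemma kq_supp: "0 < \<epsilon> \<Longrightarrow> 0 \<le> L \<Longrightarrow> L < norm z \<Longrightarrow> m \<le> 3 \<Longrightarrow> kq m \<epsilon> L (z \<bullet> z) = 0"
  by (rule kq_eq_0) (auto simp: dot_square_norm power_mono)

lemma cts_cpt_krn: "0 < \<epsilon> \<Longrightarrow> 0 \<le> L \<Longrightarrow> cts_cpt (krn \<epsilon> L)"
  by (rule cts_cptI[where r = L], erule C1_dir_continuous(1)[OF C1_dir_krn]) (simp add: krn_def kq_supp)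

lemma cts_cpt_krn1: "0 < \<epsilon> \<Longrightarrow> 0 \<le> L \<Longrightarrow> cts_cpt (krn1 \<epsilon> L i)"
  by (rule cts_cpt_C1_dir[OF C1_dir_krn cts_cpt_krn])

lemma cts_cpt_krn2: "0 < \<epsilon> \<Longrightarrow> 0 \<le> L \<Longrightarrow> cts_cpt (krn2 \<epsilon> L i j)"
  by (rule cts_cpt_C1_dir[OF C1_dir_krn1 cts_cpt_krn1])

lemma laplacian_krn:
  assumes "0 < \<epsilon>" "\<epsilon> \<le> L"
  shows "(\<Sum>i\<in>UNIV. krn2 \<epsilon> L i i z) = bump L z - bump \<epsilon> z"
proof -
  have "(\<Sum>i\<in>UNIV. krn2 \<epsilon> L i i z) = (6 * (z \<bullet> z) * kq 2 \<epsilon> L (z \<bullet> z) - 3 * kq 1 \<epsilon> L (z \<bullet> z)) / bump_mass"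
    by (simp add: krn2_def sum_3 inner_vec_def add_divide_distrib[symmetric] algebra_simps)
  also have "6 * (z \<bullet> z) * kq 2 \<epsilon> L (z \<bullet> z) - 3 * kq 1 \<epsilon> L (z \<bullet> z) =
     (1 / L) ^ 3 * max 0 (1 - (z \<bullet> z) / L\<^sup>2) ^ 3 - (1 / \<epsilon>) ^ 3 * max 0 (1 - (z \<bullet> z) / \<epsilon>\<^sup>2) ^ 3"
    using kq_telescope[OF assms, of "z \<bullet> z"]
      arg_cong[where f = "\<lambda>x. x / 8", of "48 * (z \<bullet> z) * kq 2 \<epsilon> L (z \<bullet> z) - 24 * kq 1 \<epsilon> L (z \<bullet> z)"]
    by (simp add: diff_divide_distrib)
  finally show ?thesis by (simp add: bump_def diff_divide_distrib)
qed

text \<open>\<open>|z_i z_j| \<le> |z|^2\<close> makes the second bound of \<open>kq_bounds\<close>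
  applicable; the sum \<open>16/3 + 6 * 64/3 = 400/3\<close> is rounded up to 150.\<close>

lemma krn2_le:
  assumes "0 < \<epsilon>" "\<epsilon> \<le> L" "z \<noteq> 0"
  shows "\<bar>krn2 \<epsilon> L i j z\<bar> \<le> 150 / (bump_mass * norm z ^ 3)"
proof -
  have b: "\<bar>kq 1 \<epsilon> L (z \<bullet> z)\<bar> \<le> 16 / (3 * norm z ^ 3)" "(norm z)\<^sup>2 * \<bar>kq 2 \<epsilon> L (z \<bullet> z)\<bar> \<le> 64 / (3 * norm z ^ 3)"
    using kq_bounds[OF assms(1,2), of "norm z"] assms(3) by (auto simp: dot_square_norm)
  have "\<bar>z $ i\<bar> * \<bar>z $ j\<bar> \<le> norm z * norm z"
    by (intro mult_mono component_le_norm_cart) auto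
  then have "\<bar>z $ i * z $ j\<bar> * \<bar>kq 2 \<epsilon> L (z \<bullet> z)\<bar> \<le> (norm z)\<^sup>2 * \<bar>kq 2 \<epsilon> L (z \<bullet> z)\<bar>"
    by (intro mult_right_mono) (auto simp: power2_eq_square abs_mult)
  then have "\<bar>6 * z $ i * z $ j * kq 2 \<epsilon> L (z \<bullet> z)\<bar> \<le> 6 * (64 / (3 * norm z ^ 3))"
    using b(2) by (simp add: abs_mult mult.assoc)
  moreover have "\<bar>if i = j then - kq 1 \<epsilon> L (z \<bullet> z) else 0\<bar> \<le> 16 / (3 * norm z ^ 3)"
    using b(1) by auto
  ultimately have "\<bar>(if i = j then - kq 1 \<epsilon> L (z \<bullet> z) else 0) + 6 * z $ i * z $ j * kq 2 \<epsilon> L (z \<bullet> z)\<bar> \<le> 16 / (3 * norm z ^ 3) + 6 * (64 / (3 * norm z ^ 3))"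
    by linarith
  also have "\<dots> = 400 / 3 / norm z ^ 3" using assms(3) by (simp add: field_simps)
  also have "\<dots> \<le> 150 / norm z ^ 3" using assms(3) by (intro divide_right_mono) auto
  finally show ?thesis
    using bump_mass_pos by (simp add: krn2_def field_simps)
qed

section \<open>A square-integrable majorant of the kernel's far field\<close>

lemma lborel_integrable_reflect:
  fixes f :: "'a::euclidean_space \<Rightarrow> real"
  assumes "integrable lborel f"
  shows "integrable lborel (\<lambda>y. f (x - y))"
proof -
  have [measurable]: "f \<in> borel_measurable borel" using assms by auto
  have "integrable (density (distr lborel borel (\<lambda>y. x + (-1) *\<^sub>R y)) (\<lambda>_. 1)) f"
    using assms lborel_affine[of "-1" x] by simp
  then show ?thesis by (simp add: density_1 integrable_distr_eq)
qed

text \<open>The integrand is dominated by a sum of \<open>n^-6\<close> times indicators of balls of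
  radius \<open>n\<close>; their volumes grow like \<open>n^3\<close>, so the series of integrals
  behaves like the sum of \<open>n^-3\<close>.\<close>

lemma integrable_inverse_6: "integrable lborel (\<lambda>z::real^3. 1 / (norm z + 1) ^ 6)"
proof (rule integrableI_bounded)
  let ?t = "\<lambda>n z. ennreal (1 / real (Suc n) ^ 6) * indicator (cball (0::real^3) (real (Suc n))) z"
  let ?V = "unit_ball_vol 3"
  have "(\<integral>\<^sup>+z. ennreal (norm (1 / (norm (z::real^3) + 1) ^ 6)) \<partial>lborel) \<le> (\<integral>\<^sup>+z. (\<Sum>n. ?t n z) \<partial>lborel)"
  proof (rule nn_integral_mono)
    fix z :: "real^3"
    define n where "n = nat \<lfloor>norm z\<rfloor>"
    have n: "real n \<le> norm z" "norm z \<le> real (Suc n)"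
      using real_of_int_floor_add_one_ge[of "norm z"] by (auto simp: n_def add.commute)
    have "ennreal (norm (1 / (norm z + 1) ^ 6)) \<le> ennreal (1 / real (Suc n) ^ 6)"
      using n by (auto intro!: ennreal_leI divide_left_mono power_mono zero_less_power simp: add.commute)
    also have "\<dots> = ?t n z" using n by simp
    also have "\<dots> \<le> (\<Sum>n. ?t n z)"
    proof -
      have "(\<Sum>n\<in>{n}. ?t n z) \<le> (\<Sum>n. ?t n z)" by (rule sum_le_suminf) auto
      then show ?thesis by (simp only: sum.insert finite.emptyI empty_iff not_False_eq_True sum.empty add_0_right)
    qed
    finally show "ennreal (norm (1 / (norm z + 1) ^ 6)) \<le> (\<Sum>n. ?t n z)" .
  qed
  also have "\<dots> = (\<Sum>n. \<integral>\<^sup>+z. ?t n z \<partial>lborel)"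
    by (rule nn_integral_suminf) (intro borel_measurable_times_ennreal borel_measurable_indicator, auto)
  also have "\<dots> = (\<Sum>n. ennreal (?V * (1 / real (Suc n) ^ 3)))"
  proof (rule suminf_cong)
    fix n
    have "(\<integral>\<^sup>+z. ?t n z \<partial>lborel) = ennreal (1 / real (Suc n) ^ 6) * ennreal (?V * real (Suc n) ^ 3)"
      by (subst nn_integral_cmult_indicator) (auto simp: emeasure_cball)
    also have "\<dots> = ennreal ((1 / real (Suc n) ^ (3 + 3)) * (?V * real (Suc n) ^ 3))"
      by (subst ennreal_mult) auto
    also have "(1 / real (Suc n) ^ (3 + 3)) * (?V * real (Suc n) ^ 3) = ?V * (1 / real (Suc n) ^ 3)"
      unfolding power_add by (simp add: divide_simps del: of_nat_Suc)
    finally show "(\<integral>\<^sup>+z. ?t n z \<partial>lborel) = ennreal (?V * (1 / real (Suc n) ^ 3))" .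
  qed
  also have "\<dots> < \<infinity>"
  proof -
    have "summable (\<lambda>n. 1 / real n ^ 3)"
      using inverse_power_summable[of 3, where 'a = real] by (simp add: inverse_eq_divide power_divide)
    then have "summable (\<lambda>n. ?V * (1 / real (Suc n) ^ 3))"
      by (subst (asm) summable_Suc_iff[symmetric]) (rule summable_mult)
    then show ?thesis by (subst suminf_ennreal2) auto
  qed
  finally show "(\<integral>\<^sup>+z. ennreal (norm (1 / (norm (z::real^3) + 1) ^ 6)) \<partial>lborel) < \<infinity>" .
qed simp

text \<open>The squared \<open>L^2\<close> norm of \<open>(|z| + 1)^-3\<close>, which replaces the
  tail \<open>|z|^-3\<close> without its singularity.\<close>

definition far_mass :: real where
  "far_mass = (\<integral>z. 1 / (norm (z::real^3) + 1) ^ 6 \<partial>lborel)"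

lemma far_mass_nonneg: "0 \<le> far_mass"
  unfolding far_mass_def by (rule integral_nonneg_AE) simp

text \<open>Scaling by \<open>d\<close> takes \<open>d^-6\<close> out of the integrand and
  \<open>d^3\<close> out of the volume.\<close>

lemma integral_far:
  fixes x :: "real^3"
  assumes d: "0 < d"
  shows "integrable lborel (\<lambda>y. 1 / (norm (x - y) + d) ^ 6)"
    and "(\<integral>y. 1 / (norm (x - y) + d) ^ 6 \<partial>lborel) = far_mass / d ^ 3"
proof -
  let ?f = "\<lambda>z::real^3. 1 / (norm z + d) ^ 6"
  have [measurable]: "?f \<in> borel_measurable borel" by measurable
  have e: "?f (d *\<^sub>R z) = 1 / d ^ 6 * (1 / (norm z + 1) ^ 6)" for z
  proof -
    have "norm (d *\<^sub>R z) + d = d * (norm z + 1)" using d by (simp add: algebra_simps)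
    then show ?thesis by (simp add: power_mult_distrib)
  qed
  have "integrable lborel (\<lambda>z. ?f (d *\<^sub>R z))"
    unfolding e using integrable_inverse_6 by (rule integrable_mult_right)
  then have I: "integrable lborel ?f"
    by (subst integral_lborel_scale(2)[OF _ d]) auto
  then show "integrable lborel (\<lambda>y. 1 / (norm (x - y) + d) ^ 6)"
    by (rule lborel_integrable_reflect)
  have "(\<integral>y. ?f (x - y) \<partial>lborel) = (\<integral>y. ?f y \<partial>lborel)"
    by (rule lborel_integral_reflect) measurable
  also have "\<dots> = d ^ 3 * (\<integral>z. ?f (d *\<^sub>R z) \<partial>lborel)"
    using integral_lborel_scale(1)[of ?f d] d by simp
  also have "\<dots> = d ^ 3 * (1 / d ^ (3 + 3) * far_mass)"
    unfolding e far_mass_def by (simp add: Bochner_Integration.integral_mult_right_zero del: times_divide_eq_left times_divide_eq_right divide_divide_eq_left)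
  also have "\<dots> = far_mass / d ^ 3" using d unfolding power_add by (simp add: field_simps)
  finally show "(\<integral>y. 1 / (norm (x - y) + d) ^ 6 \<partial>lborel) = far_mass / d ^ 3" .
qed

text \<open>At distance at least \<open>d\<close> one has
  \<open>|z|^-3 \<le> 8 (|z| + d)^-3\<close>, whence \<open>1200 = 8 * 150\<close>. Cauchy-Schwarz
  against this weight leaves the \<open>L^2\<close> norm of \<open>h\<close> and the power
  \<open>d^(-3/2)\<close>.\<close>

lemma conv_krn2_far:
  assumes "0 < \<epsilon>" "\<epsilon> \<le> L" "0 < d" "cts_cpt h" "\<And>y. h y \<noteq> 0 \<Longrightarrow> d \<le> norm (x - y)"
  shows "\<bar>conv (krn2 \<epsilon> L i j) h x\<bar> \<le> 1200 / bump_mass * sqrt (far_mass / d ^ 3) * sqrt (\<integral>y. (h y)\<^sup>2 \<partial>lborel)"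
proof -
  let ?m = "\<lambda>y. 1 / (norm (x - y) + d) ^ 3"
  have c: "cts_cpt (krn2 \<epsilon> L i j)" using assms by (intro cts_cpt_krn2) auto
  have hm [measurable]: "h \<in> borel_measurable borel" using cts_cpt_continuous[OF assms(4)] by measurable
  have mm [measurable]: "?m \<in> borel_measurable borel" by measurable
  have m2: "(?m y)\<^sup>2 = 1 / (norm (x - y) + d) ^ 6" for y by (simp add: power_divide flip: power_mult)
  have I: "integrable lborel (\<lambda>y. (?m y)\<^sup>2)" "(\<integral>y. (?m y)\<^sup>2 \<partial>lborel) = far_mass / d ^ 3"
    unfolding m2 using integral_far[OF assms(3), of x] by auto
  have h2: "integrable lborel (\<lambda>y. (h y)\<^sup>2)"
    using assms(4) by (intro cts_cpt_integrable cts_cpt_power) auto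
  have le: "\<bar>krn2 \<epsilon> L i j (x - y) * h y\<bar> \<le> 1200 / bump_mass * \<bar>?m y * h y\<bar>" for y
  proof (cases "h y = 0")
    case False
    then have d: "d \<le> norm (x - y)" by (rule assms(5))
    then have z: "x - y \<noteq> 0" using assms(3) by auto
    have "(norm (x - y) + d) ^ 3 \<le> (2 * norm (x - y)) ^ 3" using d assms(3) by (intro power_mono) auto
    then have "150 * (norm (x - y) + d) ^ 3 \<le> 1200 * norm (x - y) ^ 3" by (simp add: power_mult_distrib)
    moreover have "150 / (bump_mass * a) \<le> 1200 / bump_mass * (1 / b)" if "150 * b \<le> 1200 * a" "0 < a" "0 < b" for a b
      using that bump_mass_pos by (simp add: field_simps)
    moreover have "0 < norm (x - y) ^ 3" "0 < (norm (x - y) + d) ^ 3" using z assms(3) by (auto intro!: add_nonneg_pos)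
    ultimately have "150 / (bump_mass * norm (x - y) ^ 3) \<le> 1200 / bump_mass * ?m y" by blast
    with krn2_le[OF assms(1,2) z, of i j] have "\<bar>krn2 \<epsilon> L i j (x - y)\<bar> \<le> 1200 / bump_mass * ?m y" by linarith
    then have "\<bar>krn2 \<epsilon> L i j (x - y)\<bar> * \<bar>h y\<bar> \<le> 1200 / bump_mass * ?m y * \<bar>h y\<bar>" by (rule mult_right_mono) simp
    then show ?thesis using assms(3) by (simp add: abs_mult)
  qed simp
  have "\<bar>conv (krn2 \<epsilon> L i j) h x\<bar> \<le> (\<integral>y. \<bar>krn2 \<epsilon> L i j (x - y) * h y\<bar> \<partial>lborel)"
    unfolding conv_def by (rule integral_abs_bound)
  also have "\<dots> \<le> (\<integral>y. 1200 / bump_mass * \<bar>?m y * h y\<bar> \<partial>lborel)"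
    by (intro integral_mono integrable_abs integrable_conv integrable_mult_right integrable_mult_squares I h2 le
        cts_cpt_continuous[OF c] assms(4)) auto
  also have "\<dots> = 1200 / bump_mass * (\<integral>y. \<bar>?m y * h y\<bar> \<partial>lborel)"
    by (rule Bochner_Integration.integral_mult_right_zero)
  also have "\<dots> \<le> 1200 / bump_mass * (sqrt (\<integral>y. (?m y)\<^sup>2 \<partial>lborel) * sqrt (\<integral>y. (h y)\<^sup>2 \<partial>lborel))"
    using bump_mass_pos I h2 by (intro mult_left_mono Cauchy_Schwarz_integral) auto
  finally show ?thesis by (simp only: I(2) mult.assoc)
qed

text \<open>For \<open>G = K * h\<close> both \<open>\<integral> (G\<^sub>i\<^sub>j)\<^sup>2\<close> and \<open>\<integral> G\<^sub>i\<^sub>i G\<^sub>j\<^sub>j\<close> equal \<open>- \<integral> G\<^sub>i G\<^sub>i\<^sub>j\<^sub>j\<close>, by the symmetry of the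
  third derivatives of \<open>K\<close>.\<close>

lemma integral_hessian_conv:
  assumes "0 < \<epsilon>" "\<epsilon> \<le> L" "cts_cpt h"
  shows "(\<Sum>i\<in>UNIV. \<Sum>j\<in>UNIV. \<integral>x. (conv (krn2 \<epsilon> L i j) h x)\<^sup>2 \<partial>lborel) =
    (\<integral>x. (conv (bump L) h x - conv (bump \<epsilon>) h x)\<^sup>2 \<partial>lborel)"
proof -
  have L: "0 \<le> L" "0 < L" using assms by auto
  let ?G1 = "\<lambda>i. conv (krn1 \<epsilon> L i) h" and ?G2 = "\<lambda>i j. conv (krn2 \<epsilon> L i j) h"
    and ?G3 = "\<lambda>i j l. conv (krn3 \<epsilon> L i j l) h"
  have G1: "C1_dir (ax j) (?G1 i) (?G2 i j)" for i j by (intro C1_dir_conv C1_dir_krn1 assms)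
  have G2: "C1_dir (ax l) (?G2 i j) (?G3 i j l)" for i j l by (intro C1_dir_conv C1_dir_krn2 assms)
  have c2: "cts_cpt (?G2 i j)" for i j by (intro cts_cpt_conv cts_cpt_krn2 assms L)
  have "(\<integral>x. (?G2 i j x)\<^sup>2 \<partial>lborel) = (\<integral>x. ?G2 i i x * ?G2 j j x \<partial>lborel)" for i j
  proof -
    have "(\<integral>x. (?G2 i j x)\<^sup>2 \<partial>lborel) = - (\<integral>x. ?G1 i x * ?G3 i j j x \<partial>lborel)"
      unfolding power2_eq_square by (rule integral_by_parts_dir[OF G1 G2 c2])
    also have "\<dots> = - (\<integral>x. ?G1 i x * ?G3 j j i x \<partial>lborel)" by (subst krn3_swap(1)) (rule refl)
    also have "\<dots> = (\<integral>x. ?G2 i i x * ?G2 j j x \<partial>lborel)"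
      by (rule integral_by_parts_dir[OF G1 G2 c2, symmetric])
    finally show ?thesis .
  qed
  then have "(\<Sum>i\<in>UNIV. \<Sum>j\<in>UNIV. \<integral>x. (?G2 i j x)\<^sup>2 \<partial>lborel) = (\<Sum>i\<in>UNIV. \<Sum>j\<in>UNIV. \<integral>x. ?G2 i i x * ?G2 j j x \<partial>lborel)"
    by simp
  also have "\<dots> = (\<integral>x. (\<Sum>i\<in>UNIV. \<Sum>j\<in>UNIV. ?G2 i i x * ?G2 j j x) \<partial>lborel)"
    using c2 by (subst Bochner_Integration.integral_sum, fastforce intro!: cts_cpt_integrable cts_cpt_sum cts_cpt_mult_left cts_cpt_continuous,
      intro sum.cong refl, subst Bochner_Integration.integral_sum) (auto intro!: cts_cpt_integrable cts_cpt_mult_left cts_cpt_continuous)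
  also have "(\<lambda>x. \<Sum>i\<in>UNIV. \<Sum>j\<in>UNIV. ?G2 i i x * ?G2 j j x) = (\<lambda>x. (conv (bump L) h x - conv (bump \<epsilon>) h x)\<^sup>2)"
  proof
    fix x
    have "(\<Sum>i\<in>UNIV. ?G2 i i x) = conv (\<lambda>x. \<Sum>i\<in>UNIV. krn2 \<epsilon> L i i x) h x"
      by (rule conv_sum_left[symmetric]) (use assms cts_cpt_continuous[OF cts_cpt_krn2[OF assms(1) L(1)]] in auto)
    also have "\<dots> = conv (bump L) h x - conv (bump \<epsilon>) h x"
      unfolding laplacian_krn[OF assms(1,2)]
      by (rule conv_diff_left) (use assms L cts_cpt_continuous[OF cts_cpt_bump] in auto)
    finally show "(\<Sum>i\<in>UNIV. \<Sum>j\<in>UNIV. ?G2 i i x * ?G2 j j x) = (conv (bump L) h x - conv (bump \<epsilon>) h x)\<^sup>2"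
      by (simp only: sum_product[symmetric] power2_eq_square)
  qed
  finally show ?thesis .
qed

text \<open>The square of a difference costs a factor 2 for each term, and mollification contracts
  \<open>L^2\<close>. The bound is uniform in \<epsilon> and \<open>L\<close>.\<close>

lemma integral_hessian_conv_le:
  assumes "0 < \<epsilon>" "\<epsilon> \<le> L" "cts_cpt h"
  shows "(\<integral>x. (\<Sum>i\<in>UNIV. \<Sum>j\<in>UNIV. (conv (krn2 \<epsilon> L i j) h x)\<^sup>2) \<partial>lborel) \<le> 4 * (\<integral>x. (h x)\<^sup>2 \<partial>lborel)"
proof -
  have L: "0 \<le> L" "0 < L" using assms by auto
  have I: "integrable lborel (\<lambda>x. (conv (krn2 \<epsilon> L i j) h x)\<^sup>2)" for i j
    by (intro cts_cpt_integrable cts_cpt_power cts_cpt_conv cts_cpt_krn2 assms L) simp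
  have J': "cts_cpt (conv (bump s) h)" if "0 < s" for s
    by (intro cts_cpt_conv cts_cpt_bump assms that)
  then have J: "integrable lborel (\<lambda>x. (conv (bump s) h x)\<^sup>2)" if "0 < s" for s
    using that by (simp add: cts_cpt_integrable cts_cpt_power)
  have "(\<integral>x. (\<Sum>i\<in>UNIV. \<Sum>j\<in>UNIV. (conv (krn2 \<epsilon> L i j) h x)\<^sup>2) \<partial>lborel)
      = (\<Sum>i\<in>UNIV. \<Sum>j\<in>UNIV. \<integral>x. (conv (krn2 \<epsilon> L i j) h x)\<^sup>2 \<partial>lborel)"
    using I by simp
  also have "\<dots> = (\<integral>x. (conv (bump L) h x - conv (bump \<epsilon>) h x)\<^sup>2 \<partial>lborel)"
    by (rule integral_hessian_conv[OF assms])
  also have "\<dots> \<le> (\<integral>x. 2 * (conv (bump L) h x)\<^sup>2 + 2 * (conv (bump \<epsilon>) h x)\<^sup>2 \<partial>lborel)"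
  proof (rule integral_mono)
    show "integrable lborel (\<lambda>x. (conv (bump L) h x - conv (bump \<epsilon>) h x)\<^sup>2)"
      using J' L assms by (intro cts_cpt_integrable cts_cpt_power cts_cpt_diff) auto
    show "integrable lborel (\<lambda>x. 2 * (conv (bump L) h x)\<^sup>2 + 2 * (conv (bump \<epsilon>) h x)\<^sup>2)"
      using J[OF L(2)] J[OF assms(1)] by simp
    show "(conv (bump L) h x - conv (bump \<epsilon>) h x)\<^sup>2 \<le> 2 * (conv (bump L) h x)\<^sup>2 + 2 * (conv (bump \<epsilon>) h x)\<^sup>2" for x
      using zero_le_power2[of "conv (bump L) h x + conv (bump \<epsilon>) h x"] by (simp add: power2_eq_square algebra_simps)
  qed
  also have "\<dots> = 2 * (\<integral>x. (conv (bump L) h x)\<^sup>2 \<partial>lborel) + 2 * (\<integral>x. (conv (bump \<epsilon>) h x)\<^sup>2 \<partial>lborel)"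
    using J[OF L(2)] J[OF assms(1)] by simp
  also have "\<dots> \<le> 2 * (\<integral>x. (h x)\<^sup>2 \<partial>lborel) + 2 * (\<integral>x. (h x)\<^sup>2 \<partial>lborel)"
    using L assms by (intro add_mono mult_left_mono integral_conv_square_le cts_cpt_bump bump_nonneg integral_bump) auto
  finally show ?thesis by simp
qed

section \<open>Ladyzhenskaya's inequality\<close>

lemma continuous_on_vector3:
  assumes "continuous_on S f" "continuous_on S g" "continuous_on S h"
  shows "continuous_on S (\<lambda>w. vector [f w, g w, h w] :: real^3)"
proof -
  have "vector [a, b, c] = a *\<^sub>R axis 1 1 + b *\<^sub>R axis 2 1 + c *\<^sub>R (axis 3 1 :: real^3)" for a b c
    by (simp add: vec_eq_iff forall_3 axis_def)
  then show ?thesis by (simp only:) (intro continuous_intros assms)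
qed

text \<open>Lebesgue measure is identified by its values on boxes. The order
  \<open>(c, b, a)\<close> makes the third coordinate the outermost variable, so that
  \<open>Ladyzhenskaya_nn\<close> can work in the planes where it is fixed.\<close>

lemma lborel_vec3:
  "(lborel :: (real^3) measure) = distr lborel borel (\<lambda>(c, b, a). vector [a, b, c])"
proof (rule lborel_eqI)
  let ?T = "\<lambda>(c, b, a). vector [a, b, c] :: real^3"
  have "continuous_on UNIV ?T"
    unfolding case_prod_beta by (intro continuous_on_vector3 continuous_intros)
  then have T [measurable]: "?T \<in> borel_measurable borel" by (rule borel_measurable_continuous_onI)
  fix l u :: "real^3" assume lu: "\<And>b. b \<in> Basis \<Longrightarrow> l \<bullet> b \<le> u \<bullet> b"
  have le: "l $ i \<le> u $ i" for i using lu[of "axis i 1"] by (simp add: axis_in_Basis_iff inner_axis)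
  have pre: "?T -` box l u = {l $ 3 <..< u $ 3} \<times> {l $ 2 <..< u $ 2} \<times> {l $ 1 <..< u $ 1}"
    by (auto simp: mem_box_cart forall_3 vector_3)
  have B: "(Basis :: (real^3) set) = (\<lambda>i. axis i 1) ` UNIV"
    by (auto simp: Basis_vec_def)
  have "inj (\<lambda>i. axis i 1 :: real^3)" by (auto simp: inj_on_def axis_eq_axis)
  then have P: "(\<Prod>b\<in>Basis. (u - l) \<bullet> b) = (\<Prod>i\<in>UNIV. u $ i - l $ i)"
    unfolding B by (subst prod.reindex) (auto simp: inner_axis)
  have "emeasure (distr lborel borel ?T) (box l u) = emeasure lborel ({l $ 3 <..< u $ 3} \<times> {l $ 2 <..< u $ 2} \<times> {l $ 1 <..< u $ 1})"
    by (subst emeasure_distr) (auto simp: pre)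
  also have "\<dots> = ennreal (u $ 3 - l $ 3) * (ennreal (u $ 2 - l $ 2) * ennreal (u $ 1 - l $ 1))"
  proof -
    have E: "emeasure lborel (A \<times> B) = emeasure lborel A * emeasure lborel B"
      if "A \<in> sets borel" "B \<in> sets borel" for A :: "'a::euclidean_space set" and B :: "'b::euclidean_space set"
      using that lborel.emeasure_pair_measure_Times[of A lborel B] by (simp add: lborel_prod)
    show ?thesis
      by (subst E) (auto simp: E le intro!: borel_open open_Times)
  qed
  also have "\<dots> = ennreal (\<Prod>b\<in>Basis. (u - l) \<bullet> b)"
    unfolding P UNIV_3 by (simp add: ennreal_mult[symmetric] le mult_ac)
  finally show "emeasure (distr lborel borel ?T) (box l u) = ennreal (\<Prod>b\<in>Basis. (u - l) \<bullet> b)" .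
qed simp

lemma measurable_vec3 [measurable]: "(\<lambda>(c, b, a). vector [a, b, c] :: real^3) \<in> borel_measurable borel"
proof (rule borel_measurable_continuous_onI)
  show "continuous_on UNIV (\<lambda>(c, b, a). vector [a, b, c] :: real^3)"
    unfolding case_prod_beta by (intro continuous_on_vector3 continuous_intros)
qed

lemma nn_integral_vec3:
  fixes f :: "real^3 \<Rightarrow> ennreal"
  assumes [measurable]: "f \<in> borel_measurable borel"
  shows "(\<integral>\<^sup>+x. f x \<partial>lborel) = (\<integral>\<^sup>+c. \<integral>\<^sup>+b. \<integral>\<^sup>+a. f (vector [a, b, c]) \<partial>lborel \<partial>lborel \<partial>lborel)"
proof -
  have m: "(\<lambda>(c, b, a). f (vector [a, b, c])) \<in> borel_measurable borel"
    using measurable_compose[OF measurable_vec3 assms] by (simp add: case_prod_beta')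
  have "(\<integral>\<^sup>+x. f x \<partial>lborel) = (\<integral>\<^sup>+p. f (case p of (c, b, a) \<Rightarrow> vector [a, b, c]) \<partial>lborel)"
    by (subst lborel_vec3, subst nn_integral_distr) auto
  also have "\<dots> = (\<integral>\<^sup>+p. (case p of (c, b, a) \<Rightarrow> f (vector [a, b, c])) \<partial>lborel)"
    by (simp add: case_prod_beta')
  also have "\<dots> = (\<integral>\<^sup>+c. \<integral>\<^sup>+q. (case q of (b, a) \<Rightarrow> f (vector [a, b, c])) \<partial>lborel \<partial>lborel)"
    using m by (subst lborel_prod[symmetric], subst lborel.nn_integral_fst[symmetric])
      (auto simp: lborel_prod borel_prod)
  also have "\<dots> = (\<integral>\<^sup>+c. \<integral>\<^sup>+b. \<integral>\<^sup>+a. f (vector [a, b, c]) \<partial>lborel \<partial>lborel \<partial>lborel)"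
  proof (rule nn_integral_cong)
    fix c :: real
    have "(\<lambda>q. (c, q)) \<in> (borel :: (real \<times> real) measure) \<rightarrow>\<^sub>M borel"
      by (intro borel_measurable_continuous_onI continuous_intros)
    from measurable_compose[OF this m]
    have "(\<lambda>(b, a). f (vector [a, b, c])) \<in> borel_measurable borel" by simp
    then show "(\<integral>\<^sup>+q. (case q of (b, a) \<Rightarrow> f (vector [a, b, c])) \<partial>lborel) = (\<integral>\<^sup>+b. \<integral>\<^sup>+a. f (vector [a, b, c]) \<partial>lborel \<partial>lborel)"
      by (subst lborel_prod[symmetric], subst lborel.nn_integral_fst[symmetric])
        (auto simp: lborel_prod borel_prod)
  qed
  finally show ?thesis .
qed

text \<open>\<open>\<phi>\<^sup>2\<close> at \<open>s\<close> is the integral of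
  \<open>2 * \<phi> * \<phi>'\<close> from the left of the support up to \<open>s\<close>, and minus
  the integral from \<open>s\<close> to its right. Averaging the two representations cancels the
  2.\<close>

lemma square_le_line_integral:
  fixes \<phi> \<phi>' :: "real \<Rightarrow> real"
  assumes d: "\<And>s. (\<phi> has_real_derivative \<phi>' s) (at s)" and c: "continuous_on UNIV \<phi>'"
    and N: "\<And>s. N < \<bar>s\<bar> \<Longrightarrow> \<phi> s = 0"
  shows "ennreal ((\<phi> s)\<^sup>2) \<le> (\<integral>\<^sup>+t. ennreal \<bar>\<phi> t * \<phi>' t\<bar> \<partial>lborel)"
proof -
  have cont: "continuous_on UNIV \<phi>" using d by (meson DERIV_isCont continuous_at_imp_continuous_on)
  have int: "(\<lambda>t. \<bar>\<phi> t * \<phi>' t\<bar>) integrable_on {a..b}" for a b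
    by (intro integrable_continuous_real continuous_intros continuous_on_subset[OF cont] continuous_on_subset[OF c]) auto
  have ftc: "\<bar>(\<phi> b)\<^sup>2 - (\<phi> a)\<^sup>2\<bar> \<le> 2 * integral {a..b} (\<lambda>t. \<bar>\<phi> t * \<phi>' t\<bar>)" if "a \<le> b" for a b
  proof -
    have "((\<lambda>t. 2 * (\<phi> t * \<phi>' t)) has_integral (\<phi> b)\<^sup>2 - (\<phi> a)\<^sup>2) {a..b}"
    proof (rule fundamental_theorem_of_calculus[OF that])
      fix t
      have "((\<lambda>t. (\<phi> t)\<^sup>2) has_real_derivative 2 * (\<phi> t * \<phi>' t)) (at t)"
        using DERIV_power[OF d[of t], of 2] by (simp add: mult_ac)
      then show "((\<lambda>t. (\<phi> t)\<^sup>2) has_vector_derivative 2 * (\<phi> t * \<phi>' t)) (at t within {a..b})"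
        by (simp add: has_real_derivative_iff_has_vector_derivative has_vector_derivative_at_within)
    qed
    then have "integral {a..b} (\<lambda>t. 2 * (\<phi> t * \<phi>' t)) = (\<phi> b)\<^sup>2 - (\<phi> a)\<^sup>2" "(\<lambda>t. 2 * (\<phi> t * \<phi>' t)) integrable_on {a..b}"
      by (auto simp: has_integral_iff)
    moreover have "norm (integral {a..b} (\<lambda>t. 2 * (\<phi> t * \<phi>' t))) \<le> integral {a..b} (\<lambda>t. 2 * \<bar>\<phi> t * \<phi>' t\<bar>)"
      using calculation(2) integrable_cmul[OF int[of a b], of 2]
      by (intro integral_norm_bound_integral) (auto simp: abs_mult)
    ultimately show ?thesis by (simp add: integral_mult_right)
  qed
  define M where "M = max \<bar>s\<bar> N + 1"
  have M: "- M \<le> s" "s \<le> M" "\<phi> M = 0" "\<phi> (- M) = 0" "N < M" by (auto simp: M_def intro!: N)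
  have "2 * (\<phi> s)\<^sup>2 \<le> 2 * (integral {-M..s} (\<lambda>t. \<bar>\<phi> t * \<phi>' t\<bar>) + integral {s..M} (\<lambda>t. \<bar>\<phi> t * \<phi>' t\<bar>))"
    using ftc[OF M(1)] ftc[OF M(2)] M by simp
  also have "integral {-M..s} (\<lambda>t. \<bar>\<phi> t * \<phi>' t\<bar>) + integral {s..M} (\<lambda>t. \<bar>\<phi> t * \<phi>' t\<bar>) = integral {-M..M} (\<lambda>t. \<bar>\<phi> t * \<phi>' t\<bar>)"
    by (rule Henstock_Kurzweil_Integration.integral_combine[OF M(1,2) int])
  also have "\<dots> = (\<integral>t. \<bar>\<phi> t * \<phi>' t\<bar> \<partial>lborel)"
  proof -
    have "continuous_on (cball 0 M) (\<lambda>t. \<bar>\<phi> t * \<phi>' t\<bar>)"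
      by (intro continuous_intros continuous_on_subset[OF cont] continuous_on_subset[OF c]) auto
    then show ?thesis
      using integral_lborel_eq_cbox[of M "\<lambda>t. \<bar>\<phi> t * \<phi>' t\<bar>"] M(5) by (simp add: N)
  qed
  finally have "ennreal ((\<phi> s)\<^sup>2) \<le> ennreal (\<integral>t. \<bar>\<phi> t * \<phi>' t\<bar> \<partial>lborel)" by (intro ennreal_leI) simp
  also have "\<dots> = (\<integral>\<^sup>+t. ennreal \<bar>\<phi> t * \<phi>' t\<bar> \<partial>lborel)"
  proof (rule nn_integral_eq_integral[symmetric])
    show "integrable lborel (\<lambda>t. \<bar>\<phi> t * \<phi>' t\<bar>)"
      by (rule integrable_supp[where r = N]) (auto intro!: continuous_intros continuous_on_subset[OF cont] continuous_on_subset[OF c] simp: N)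
  qed auto
  finally show ?thesis .
qed

lemma square_le_line_integral_dir:
  assumes v: "C1_dir e v v'" and N: "\<And>s. N < \<bar>s\<bar> \<Longrightarrow> v (x + s *\<^sub>R e) = 0"
  shows "ennreal ((v (x + s *\<^sub>R e))\<^sup>2) \<le> (\<integral>\<^sup>+t. ennreal \<bar>v (x + t *\<^sub>R e) * v' (x + t *\<^sub>R e)\<bar> \<partial>lborel)"
proof (rule square_le_line_integral[where \<phi> = "\<lambda>s. v (x + s *\<^sub>R e)" and N = N])
  show "continuous_on UNIV (\<lambda>s. v' (x + s *\<^sub>R e))"
    by (intro continuous_on_compose2[OF C1_dir_continuous(2)[OF v]] continuous_intros) auto
qed (use C1_dir_at[OF v] N in auto)

lemma two_mult_le_squares_ennreal: "2 * (a * b) \<le> a\<^sup>2 + (b::ennreal)\<^sup>2"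
proof (cases "a = top \<or> b = top")
  case False
  then obtain x y where xy: "a = ennreal x" "0 \<le> x" "b = ennreal y" "0 \<le> y"
    by (metis ennreal_cases)
  have "2 * (x * y) \<le> x\<^sup>2 + y\<^sup>2" using sum_squares_bound[of x y] by simp
  then have "ennreal (2 * (x * y)) \<le> ennreal (x\<^sup>2 + y\<^sup>2)" by (rule ennreal_leI)
  then show ?thesis using xy by (simp add: ennreal_mult ennreal_power)
qed (auto simp: power2_eq_square ennreal_mult_top ennreal_top_mult)

lemma vector3_add_axis:
  "vector [a, b, c] = vector [0, b, c] + a *\<^sub>R (axis 1 1 :: real^3)"
  "vector [a, b, c] = vector [a, 0, c] + b *\<^sub>R (axis 2 1 :: real^3)"
  "vector [a, b, c] = vector [a, b, 0] + c *\<^sub>R (axis 3 1 :: real^3)"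
  by (simp_all add: vec_eq_iff forall_3 axis_def)

text \<open>In a plane of fixed third coordinate, \<open>v^2\<close> is bounded by a line integral
  in direction 1 and by one in direction 2, and the product of the two integrates to
  \<open>P 1 c * P 2 c\<close>. The arithmetic-geometric mean inequality and Cauchy-Schwarz in the
  plane turn this into \<open>m c\<close> times squared derivatives within the plane. Line integrals
  in direction 3 bound \<open>m c\<close>, the mass of a single plane, by the total
  \<open>X3\<close>.\<close>

lemma Ladyzhenskaya_nn:
  fixes v :: "real^3 \<Rightarrow> real"
  assumes v: "\<And>i. C1_dir (ax i) v (v' i)" "cts_cpt v"
  shows "2 * (\<integral>\<^sup>+x. ennreal ((v x) ^ 4) \<partial>lborel) \<le>
    (\<integral>\<^sup>+x. ennreal \<bar>v x * v' 3 x\<bar> \<partial>lborel) *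
    ((\<integral>\<^sup>+x. ennreal ((v' 1 x)\<^sup>2) \<partial>lborel) + (\<integral>\<^sup>+x. ennreal ((v' 2 x)\<^sup>2) \<partial>lborel))"
proof -
  note cont = C1_dir_continuous[OF v(1)]
  have [measurable]: "v \<in> borel_measurable borel" "v' i \<in> borel_measurable borel" for i
    using cont by measurable
  let ?X = "\<lambda>a b c. vector [a, b, c] :: real^3"
  have mT: "(\<lambda>p. ?X (fst p) (fst (snd p)) (snd (snd p))) \<in> borel_measurable borel"
  proof (rule borel_measurable_continuous_onI)
    show "continuous_on UNIV (\<lambda>p. ?X (fst p) (fst (snd p)) (snd (snd p)))"
      by (intro continuous_on_vector3 continuous_intros)
  qed
  have mX [measurable (raw)]: "(\<lambda>w. ?X (f w) (g w) (h w)) \<in> borel_measurable M"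
    if [measurable]: "f \<in> borel_measurable M" "g \<in> borel_measurable M" "h \<in> borel_measurable M" for f g h and M :: "'z measure"
    using measurable_compose[of "\<lambda>w. (f w, g w, h w)" M borel, OF _ mT] by simp
  obtain N where N: "\<And>x. N < norm x \<Longrightarrow> v x = 0" using v(2) by (auto simp: cts_cpt_def)
  have N': "v (?X a b c) = 0" if "N < \<bar>a\<bar> \<or> N < \<bar>b\<bar> \<or> N < \<bar>c\<bar>" for a b c
    using that component_le_norm_cart[of "?X a b c" 1] component_le_norm_cart[of "?X a b c" 2] component_le_norm_cart[of "?X a b c" 3]
    by (intro N) auto
  define W where "W i x = ennreal \<bar>v x * v' i x\<bar>" for i x
  have [measurable]: "W i \<in> borel_measurable borel" for i unfolding W_def by measurable
  have sq1: "ennreal ((v (?X a b c))\<^sup>2) \<le> (\<integral>\<^sup>+a. W 1 (?X a b c) \<partial>lborel)" for a b c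
    unfolding W_def
    using square_le_line_integral_dir[OF v(1)[of 1], of N "?X 0 b c" a] N'
    by (simp add: vector3_add_axis(1)[symmetric])
  have sq2: "ennreal ((v (?X a b c))\<^sup>2) \<le> (\<integral>\<^sup>+b. W 2 (?X a b c) \<partial>lborel)" for a b c
    unfolding W_def
    using square_le_line_integral_dir[OF v(1)[of 2], of N "?X a 0 c" b] N'
    by (simp add: vector3_add_axis(2)[symmetric])
  have sq3: "ennreal ((v (?X a b c))\<^sup>2) \<le> (\<integral>\<^sup>+c. W 3 (?X a b c) \<partial>lborel)" for a b c
    unfolding W_def
    using square_le_line_integral_dir[OF v(1)[of 3], of N "?X a b 0" c] N'
    by (simp add: vector3_add_axis(3)[symmetric])
  define P where "P i c = (\<integral>\<^sup>+b. \<integral>\<^sup>+a. W i (?X a b c) \<partial>lborel \<partial>lborel)" for i c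
  define D where "D i c = (\<integral>\<^sup>+b. \<integral>\<^sup>+a. ennreal ((v' i (?X a b c))\<^sup>2) \<partial>lborel \<partial>lborel)" for i c
  define m where "m c = (\<integral>\<^sup>+b. \<integral>\<^sup>+a. ennreal ((v (?X a b c))\<^sup>2) \<partial>lborel \<partial>lborel)" for c
  define X3 where "X3 = (\<integral>\<^sup>+x. W 3 x \<partial>lborel)"
  have mD [measurable]: "D i \<in> borel_measurable borel" for i unfolding D_def by measurable
  have slice: "(\<integral>\<^sup>+b. \<integral>\<^sup>+a. ennreal (v (?X a b c) ^ 4) \<partial>lborel \<partial>lborel) \<le> P 1 c * P 2 c" for c
  proof -
    have "(\<integral>\<^sup>+b. \<integral>\<^sup>+a. ennreal (v (?X a b c) ^ 4) \<partial>lborel \<partial>lborel)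
      \<le> (\<integral>\<^sup>+b. \<integral>\<^sup>+a. (\<integral>\<^sup>+a. W 1 (?X a b c) \<partial>lborel) * (\<integral>\<^sup>+b. W 2 (?X a b c) \<partial>lborel) \<partial>lborel \<partial>lborel)"
    proof (intro nn_integral_mono)
      fix a b
      have "ennreal (v (?X a b c) ^ 4) = ennreal ((v (?X a b c))\<^sup>2) * ennreal ((v (?X a b c))\<^sup>2)"
        by (simp add: ennreal_mult[symmetric] flip: power_add)
      also have "\<dots> \<le> (\<integral>\<^sup>+a. W 1 (?X a b c) \<partial>lborel) * (\<integral>\<^sup>+b. W 2 (?X a b c) \<partial>lborel)"
        by (intro mult_mono sq1 sq2) auto
      finally show "ennreal (v (?X a b c) ^ 4) \<le> (\<integral>\<^sup>+a. W 1 (?X a b c) \<partial>lborel) * (\<integral>\<^sup>+b. W 2 (?X a b c) \<partial>lborel)" .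
    qed
    also have "\<dots> = (\<integral>\<^sup>+b. \<integral>\<^sup>+a. W 1 (?X a b c) \<partial>lborel \<partial>lborel) * (\<integral>\<^sup>+a. \<integral>\<^sup>+b. W 2 (?X a b c) \<partial>lborel \<partial>lborel)"
      by (simp add: nn_integral_cmult nn_integral_multc)
    also have "(\<integral>\<^sup>+a. \<integral>\<^sup>+b. W 2 (?X a b c) \<partial>lborel \<partial>lborel) = (\<integral>\<^sup>+b. \<integral>\<^sup>+a. W 2 (?X a b c) \<partial>lborel \<partial>lborel)"
      by (rule lborel_pair.Fubini') measurable
    finally show ?thesis by (simp add: P_def)
  qed
  have mX3: "m c \<le> X3" for c
  proof -
    have "m c \<le> (\<integral>\<^sup>+b. \<integral>\<^sup>+a. \<integral>\<^sup>+c. W 3 (?X a b c) \<partial>lborel \<partial>lborel \<partial>lborel)"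
      unfolding m_def by (intro nn_integral_mono sq3)
    also have "\<dots> = (\<integral>\<^sup>+b. \<integral>\<^sup>+c. \<integral>\<^sup>+a. W 3 (?X a b c) \<partial>lborel \<partial>lborel \<partial>lborel)"
      by (intro nn_integral_cong lborel_pair.Fubini') measurable
    also have "\<dots> = (\<integral>\<^sup>+c. \<integral>\<^sup>+b. \<integral>\<^sup>+a. W 3 (?X a b c) \<partial>lborel \<partial>lborel \<partial>lborel)"
      by (rule lborel_pair.Fubini') measurable
    also have "\<dots> = X3" unfolding X3_def by (rule nn_integral_vec3[symmetric]) measurable
    finally show ?thesis .
  qed
  have P2: "(P i c)\<^sup>2 \<le> m c * D i c" for i c
  proof -
    have eq: "(\<integral>\<^sup>+b. \<integral>\<^sup>+a. F a b \<partial>lborel \<partial>lborel) = (\<integral>\<^sup>+(b, a). F a b \<partial>(lborel \<Otimes>\<^sub>M lborel))"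
      if "(\<lambda>(b, a). F a b) \<in> borel_measurable (lborel \<Otimes>\<^sub>M lborel)" for F :: "real \<Rightarrow> real \<Rightarrow> ennreal"
      using lborel.nn_integral_fst[OF that] by simp
    have "P i c = (\<integral>\<^sup>+(b, a). W i (?X a b c) \<partial>(lborel \<Otimes>\<^sub>M lborel))"
      unfolding P_def by (rule eq) measurable
    also have "\<dots> = (\<integral>\<^sup>+p. ennreal \<bar>v (?X (snd p) (fst p) c)\<bar> * ennreal \<bar>v' i (?X (snd p) (fst p) c)\<bar> \<partial>(lborel \<Otimes>\<^sub>M lborel))"
      by (simp add: W_def case_prod_beta' abs_mult ennreal_mult)
    finally have "(P i c)\<^sup>2 \<le> (\<integral>\<^sup>+p. (ennreal \<bar>v (?X (snd p) (fst p) c)\<bar>)\<^sup>2 \<partial>(lborel \<Otimes>\<^sub>M lborel)) *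
       (\<integral>\<^sup>+p. (ennreal \<bar>v' i (?X (snd p) (fst p) c)\<bar>)\<^sup>2 \<partial>(lborel \<Otimes>\<^sub>M lborel))"
      by (simp only:) (rule Cauchy_Schwarz_nn_integral; measurable)
    also have "(\<integral>\<^sup>+p. (ennreal \<bar>v (?X (snd p) (fst p) c)\<bar>)\<^sup>2 \<partial>(lborel \<Otimes>\<^sub>M lborel)) = m c"
      unfolding m_def by (subst eq) (measurable, simp add: ennreal_power case_prod_beta')
    also have "(\<integral>\<^sup>+p. (ennreal \<bar>v' i (?X (snd p) (fst p) c)\<bar>)\<^sup>2 \<partial>(lborel \<Otimes>\<^sub>M lborel)) = D i c"
      unfolding D_def by (subst eq) (measurable, simp add: ennreal_power case_prod_beta')
    finally show ?thesis .
  qed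
  have "2 * (\<integral>\<^sup>+x. ennreal ((v x) ^ 4) \<partial>lborel) = (\<integral>\<^sup>+c. 2 * (\<integral>\<^sup>+b. \<integral>\<^sup>+a. ennreal (v (?X a b c) ^ 4) \<partial>lborel \<partial>lborel) \<partial>lborel)"
    by (subst nn_integral_vec3, measurable) (subst nn_integral_cmult, measurable)
  also have "\<dots> \<le> (\<integral>\<^sup>+c. X3 * (D 1 c + D 2 c) \<partial>lborel)"
  proof (rule nn_integral_mono)
    fix c
    have "2 * (\<integral>\<^sup>+b. \<integral>\<^sup>+a. ennreal (v (?X a b c) ^ 4) \<partial>lborel \<partial>lborel) \<le> 2 * (P 1 c * P 2 c)"
      by (intro mult_left_mono slice) auto
    also have "\<dots> \<le> (P 1 c)\<^sup>2 + (P 2 c)\<^sup>2" by (rule two_mult_le_squares_ennreal)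
    also have "\<dots> \<le> m c * D 1 c + m c * D 2 c" by (intro add_mono P2)
    also have "\<dots> \<le> X3 * D 1 c + X3 * D 2 c" by (intro add_mono mult_right_mono mX3) auto
    finally show "2 * (\<integral>\<^sup>+b. \<integral>\<^sup>+a. ennreal (v (?X a b c) ^ 4) \<partial>lborel \<partial>lborel) \<le> X3 * (D 1 c + D 2 c)"
      by (simp add: distrib_left)
  qed
  also have "\<dots> = X3 * ((\<integral>\<^sup>+c. D 1 c \<partial>lborel) + (\<integral>\<^sup>+c. D 2 c \<partial>lborel))"
    by (simp add: nn_integral_cmult nn_integral_add)
  also have "(\<integral>\<^sup>+c. D 1 c \<partial>lborel) = (\<integral>\<^sup>+x. ennreal ((v' 1 x)\<^sup>2) \<partial>lborel)"
    unfolding D_def by (rule nn_integral_vec3[symmetric]) measurable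
  also have "(\<integral>\<^sup>+c. D 2 c \<partial>lborel) = (\<integral>\<^sup>+x. ennreal ((v' 2 x)\<^sup>2) \<partial>lborel)"
    unfolding D_def by (rule nn_integral_vec3[symmetric]) measurable
  finally show ?thesis by (simp add: X3_def W_def)
qed

text \<open>Cauchy-Schwarz separates the remaining mixed integral. Then the full gradient replaces
  the individual derivatives, which removes the distinguished role of the third coordinate.\<close>

lemma Ladyzhenskaya:
  fixes v :: "real^3 \<Rightarrow> real"
  assumes v: "\<And>i. C1_dir (ax i) v (v' i)" "cts_cpt v"
  shows "(\<integral>x. (v x) ^ 4 \<partial>lborel) \<le> sqrt (\<integral>x. (v x)\<^sup>2 \<partial>lborel) *
     (sqrt (\<Sum>i\<in>UNIV. \<integral>x. (v' i x)\<^sup>2 \<partial>lborel)) ^ 3"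
proof -
  have v': "cts_cpt (v' i)" for i by (rule cts_cpt_C1_dir[OF v])
  have [measurable]: "v \<in> borel_measurable borel" "v' i \<in> borel_measurable borel" for i
    using C1_dir_continuous[OF v(1)] by measurable
  have I: "integrable lborel (\<lambda>x. (v x) ^ 4)" "integrable lborel (\<lambda>x. (v x)\<^sup>2)"
    "integrable lborel (\<lambda>x. (v' i x)\<^sup>2)" "integrable lborel (\<lambda>x. \<bar>v x * v' 3 x\<bar>)" for i
    using v v' by (auto intro!: cts_cpt_integrable cts_cpt_power cts_cpt_abs cts_cpt_mult_left cts_cpt_continuous)
  define A where "A i = (\<integral>x. (v' i x)\<^sup>2 \<partial>lborel)" for i
  define V where "V = (\<integral>x. (v x)\<^sup>2 \<partial>lborel)"
  have A: "0 \<le> A i" for i unfolding A_def by (rule integral_nonneg_AE) simp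
  have V: "0 \<le> V" unfolding V_def by (rule integral_nonneg_AE) simp
  define S where "S = A 1 + A 2 + A 3"
  have S: "0 \<le> S" "A 3 \<le> S" "A 1 + A 2 \<le> S" using A by (auto simp: S_def)
  have q: "0 \<le> (\<integral>x. \<bar>v x * v' 3 x\<bar> \<partial>lborel)" by (rule integral_nonneg_AE) simp
  have "ennreal (2 * (\<integral>x. (v x) ^ 4 \<partial>lborel)) \<le> ennreal ((\<integral>x. \<bar>v x * v' 3 x\<bar> \<partial>lborel) * (A 1 + A 2))"
    using Ladyzhenskaya_nn[OF v] I A q unfolding A_def
    by (subst (asm) (1 2 3 4) nn_integral_eq_integral) (auto simp: ennreal_mult ennreal_plus[symmetric] simp del: ennreal_plus)
  then have "2 * (\<integral>x. (v x) ^ 4 \<partial>lborel) \<le> (\<integral>x. \<bar>v x * v' 3 x\<bar> \<partial>lborel) * (A 1 + A 2)"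
    using A q by (subst (asm) ennreal_le_iff) auto
  also have "\<dots> \<le> (sqrt V * sqrt (A 3)) * S"
    unfolding V_def using Cauchy_Schwarz_integral[of v lborel "v' 3"] I S A q
    by (intro mult_mono) (auto simp: A_def)
  also have "\<dots> \<le> (sqrt V * sqrt S) * S"
    using S V A by (intro mult_right_mono mult_left_mono) auto
  also have "\<dots> = sqrt V * sqrt S ^ 3" using S by (simp add: power3_eq_cube)
  finally have "2 * (\<integral>x. (v x) ^ 4 \<partial>lborel) \<le> sqrt V * sqrt S ^ 3" .
  moreover have "0 \<le> (\<integral>x. (v x) ^ 4 \<partial>lborel)" by (rule integral_nonneg_AE) simp
  ultimately have "(\<integral>x. (v x) ^ 4 \<partial>lborel) \<le> sqrt V * sqrt S ^ 3" by linarith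
  then show ?thesis by (simp add: V_def S_def A_def sum_3)
qed

section \<open>Cutoffs\<close>

text \<open>The last clause bounds the Euclidean length of the gradient, the form in which
  Cauchy-Schwarz consumes it. One derivative is the right order: the viscous term is integrated by
  parts once against the cutoff and meets only \<open>\<eta>1\<close>.\<close>

definition cutoff :: "real^3 \<Rightarrow> real \<Rightarrow> real \<Rightarrow> (real^3 \<Rightarrow> real) \<Rightarrow> (3 \<Rightarrow> real^3 \<Rightarrow> real) \<Rightarrow> bool" where
  "cutoff x0 \<rho> s \<eta> \<eta>1 \<longleftrightarrow> (\<forall>j. C1_dir (ax j) \<eta> (\<eta>1 j)) \<and> (\<forall>x. 0 \<le> \<eta> x \<and> \<eta> x \<le> 1) \<and>
     (\<forall>x. norm (x - x0) \<le> \<rho> \<longrightarrow> \<eta> x = 1) \<and>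
     (\<forall>x. \<rho> + s < norm (x - x0) \<longrightarrow> \<eta> x = 0 \<and> (\<forall>j. \<eta>1 j x = 0)) \<and>
     (\<forall>x. (\<Sum>j\<in>UNIV. (\<eta>1 j x)\<^sup>2) \<le> (8 / s)\<^sup>2)"

text \<open>The cutoff is a profile of \<open>|x - x0|^2\<close>, which is smooth also at the
  centre. \<open>S\<close> rises from 0 at 0 to 1 at 1 with slope at most 4, and within radius
  \<open>\<rho> + s\<close> the gradient of \<open>t\<close> is at most
  \<open>2 (\<rho> + s) / b\<close>. As \<open>b = s (2 \<rho> + s)\<close> is at least
  \<open>s (\<rho> + s)\<close>, the product is at most \<open>8 / s\<close>.\<close>

lemma cutoff_exists:
  assumes "0 \<le> \<rho>" "0 < s"
  obtains \<eta> \<eta>1 where "cutoff x0 \<rho> s \<eta> \<eta>1"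
proof -
  define b where "b = (\<rho> + s)\<^sup>2 - \<rho>\<^sup>2"
  have b: "0 < b" using assms by (simp add: b_def power2_eq_square algebra_simps add_pos_nonneg)
  define t where "t x = ((\<rho> + s)\<^sup>2 - (x - x0) \<bullet> (x - x0)) / b" for x :: "real^3"
  define S where "S r = 1 - max 0 (1 - max 0 r ^ 2) ^ 2" for r :: real
  define S' where "S' r = 4 * max 0 r * max 0 (1 - max 0 r ^ 2)" for r :: real
  define \<eta> where "\<eta> x = S (t x)" for x
  define \<eta>1 where "\<eta>1 j x = S' (t x) * (- 2 * (x - x0) $ j / b)" for j x
  have D: "(t has_derivative (\<lambda>h. (1 / b) * (0 - ((x - x0) \<bullet> h + h \<bullet> (x - x0))))) (at x)" for x
  proof -
    have "((\<lambda>x. (x - x0) \<bullet> (x - x0)) has_derivative (\<lambda>h. (x - x0) \<bullet> h + h \<bullet> (x - x0))) (at x)"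
      by (auto intro!: derivative_eq_intros)
    from has_derivative_mult_right[OF has_derivative_diff[OF has_derivative_const this], of "1 / b" "(\<rho> + s)\<^sup>2"]
    show ?thesis by (simp add: t_def[abs_def])
  qed
  have "C1_dir (ax j) t (\<lambda>x. - 2 * (x - x0) $ j / b)" for j
    by (rule C1_dirI[OF D]) (use b in \<open>auto simp: inner_axis inner_axis' intro!: continuous_intros\<close>)
  moreover have "(S has_real_derivative S' r) (at r)" for r
  proof -
    have 1: "((\<lambda>x. max 0 x ^ 2) has_real_derivative 2 * max 0 r) (at r)" for r :: real
      using DERIV_pos_part_power[of 0 r] by (simp add: numeral_2_eq_2)
    have "((\<lambda>r. 1 - max 0 r ^ 2) has_real_derivative - (2 * max 0 r)) (at r)"
      using DERIV_diff[OF DERIV_const 1] by simp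
    from DERIV_diff[OF DERIV_const DERIV_chain2[OF 1 this], of 1]
    show ?thesis by (simp add: S_def[abs_def] S'_def mult_ac)
  qed
  moreover have "continuous_on UNIV S'" unfolding S'_def by (intro continuous_intros)
  ultimately have C: "C1_dir (ax j) \<eta> (\<eta>1 j)" for j
    unfolding \<eta>_def[abs_def] \<eta>1_def[abs_def] by (rule C1_dir_compose)
  have S: "0 \<le> S r" "S r \<le> 1" for r
  proof -
    have "max 0 (1 - max 0 r ^ 2) ^ 2 \<le> 1" by (rule power_le_one) auto
    then show "0 \<le> S r" "S r \<le> 1" by (auto simp: S_def)
  qed
  have S'b: "\<bar>S' r\<bar> \<le> 4" for r
  proof (cases "max 0 r \<le> 1")
    case True
    then have "max 0 r * max 0 (1 - max 0 r ^ 2) \<le> 1 * 1" by (intro mult_mono) auto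
    then show ?thesis by (simp add: S'_def abs_mult)
  next
    case False
    then have "1 \<le> (max 0 r)\<^sup>2" by (intro one_le_power) simp
    then have "max 0 (1 - max 0 r ^ 2) = 0" by simp
    then show ?thesis by (simp add: S'_def)
  qed
  have in1: "\<eta> x = 1" if "norm (x - x0) \<le> \<rho>" for x
  proof -
    have "(norm (x - x0))\<^sup>2 \<le> \<rho>\<^sup>2" using that by (intro power_mono) auto
    then have "1 \<le> t x" using b by (simp add: t_def b_def dot_square_norm)
    then have "1 \<le> (max 0 (t x))\<^sup>2" by (intro one_le_power) simp
    then have "max 0 (1 - max 0 (t x) ^ 2) = 0" by simp
    then show ?thesis by (simp add: \<eta>_def S_def)
  qed
  have out: "\<eta> x = 0 \<and> S' (t x) = 0" if "\<rho> + s < norm (x - x0)" for x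
  proof -
    have "(\<rho> + s)\<^sup>2 \<le> (norm (x - x0))\<^sup>2" using that assms by (intro power_mono) auto
    then have "t x \<le> 0" using b by (simp add: t_def dot_square_norm divide_nonpos_pos)
    then show ?thesis by (simp add: \<eta>_def S_def S'_def)
  qed
  have grad: "(\<Sum>j\<in>UNIV. (\<eta>1 j x)\<^sup>2) \<le> (8 / s)\<^sup>2" for x
  proof (cases "\<rho> + s < norm (x - x0)")
    case True
    then show ?thesis using out by (simp add: \<eta>1_def)
  next
    case False
    have "(\<Sum>j\<in>UNIV. (\<eta>1 j x)\<^sup>2) = (S' (t x))\<^sup>2 * (4 / b\<^sup>2 * (norm (x - x0))\<^sup>2)"
      unfolding norm_vec_sq sum_distrib_left
      by (intro sum.cong refl) (simp only: \<eta>1_def power_mult_distrib power_divide vector_minus_component, simp)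
    also have "\<dots> \<le> 4\<^sup>2 * (4 / b\<^sup>2 * (\<rho> + s)\<^sup>2)"
      using False S'b by (intro mult_mono power_mono abs_le_square_iff[THEN iffD1]) auto
    also have "\<dots> = (8 * (\<rho> + s) / b)\<^sup>2"
      by (simp only: power_mult_distrib power_divide) simp
    also have "\<dots> \<le> (8 / s)\<^sup>2"
    proof (rule power_mono)
      have "s * (\<rho> + s) \<le> b" using assms by (simp add: b_def power2_eq_square algebra_simps)
      then show "8 * (\<rho> + s) / b \<le> 8 / s" using b assms by (simp add: field_simps)
    qed (use b assms in auto)
    finally show ?thesis .
  qed
  have "cutoff x0 \<rho> s \<eta> \<eta>1"
    unfolding cutoff_def using C in1 out S grad by (auto simp: \<eta>_def \<eta>1_def)
  then show thesis by (rule that)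
qed

lemma cts_cpt_ball_supp:
  assumes "continuous_on UNIV f" "\<And>x. a < norm (x - c) \<Longrightarrow> f x = 0"
  shows "cts_cpt f"
proof (rule cts_cptI[where r = "a + norm c"])
  show "f x = 0" if "a + norm c < norm x" for x
    using that norm_triangle_sub[of x c] by (intro assms(2)) linarith
qed (rule assms(1))

lemma cutoff_cts_cpt:
  assumes "cutoff x0 \<rho> s \<eta> \<eta>1" shows "cts_cpt \<eta>" "cts_cpt (\<eta>1 j)"
  using assms by (auto simp: cutoff_def C1_dir_def intro!: cts_cpt_ball_supp[where a = "\<rho> + s" and c = x0])

lemma integral_divergence:
  fixes F F' :: "3 \<Rightarrow> real^3 \<Rightarrow> real"
  assumes "\<And>j. C1_dir (ax j) (F j) (F' j)" "\<And>j. cts_cpt (F j)"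
  shows "(\<integral>x. (\<Sum>j\<in>UNIV. F' j x) \<partial>lborel) = 0"
proof -
  have "(\<integral>x. (\<Sum>j\<in>UNIV. F' j x) \<partial>lborel) = (\<Sum>j\<in>UNIV. \<integral>x. F' j x \<partial>lborel)"
    by (rule Bochner_Integration.integral_sum) (intro cts_cpt_integrable cts_cpt_C1_dir[OF assms])
  then show ?thesis using integral_C1_dir_eq_0[OF assms] by simp
qed

section \<open>Testing the equation at a fixed time\<close>

text \<open>\<open>v\<close> is the velocity, \<open>v1 i j\<close> and \<open>v2 i j\<close> are the first and second derivatives of its
  component \<open>i\<close> in direction \<open>j\<close>, \<open>w\<close> is the time derivative of the velocity, \<open>q\<close> the pressure.\<close>

locale slice =
  fixes v :: "3 \<Rightarrow> real^3 \<Rightarrow> real" and v1 v2 :: "3 \<Rightarrow> 3 \<Rightarrow> real^3 \<Rightarrow> real"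
    and w f :: "3 \<Rightarrow> real^3 \<Rightarrow> real" and q :: "real^3 \<Rightarrow> real" and q1 :: "3 \<Rightarrow> real^3 \<Rightarrow> real"
  assumes v: "C1_dir (ax j) (v i) (v1 i j)" and v1: "C1_dir (ax j) (v1 i j) (v2 i j)"
    and q: "C1_dir (ax i) q (q1 i)"
    and w: "continuous_on UNIV (w i)" and f: "continuous_on UNIV (f i)"
    and div_v: "(\<Sum>i\<in>UNIV. v1 i i x) = 0"
    and div_w: "(\<And>i. C1_dir (ax i) \<psi> (\<psi>' i)) \<Longrightarrow> (\<And>i. cts_cpt (\<psi>' i)) \<Longrightarrow> cts_cpt \<psi> \<Longrightarrow>
      (\<integral>x. (\<Sum>i\<in>UNIV. w i x * \<psi>' i x) \<partial>lborel) = 0"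
    and div_f: "(\<And>i. C1_dir (ax i) \<psi> (\<psi>' i)) \<Longrightarrow> (\<And>i. cts_cpt (\<psi>' i)) \<Longrightarrow> cts_cpt \<psi> \<Longrightarrow>
      (\<integral>x. (\<Sum>i\<in>UNIV. f i x * \<psi>' i x) \<partial>lborel) = 0"
    and momentum: "w i x + (\<Sum>j\<in>UNIV. v j x * v1 i j x) = (\<Sum>j\<in>UNIV. v2 i j x) - q1 i x + f i x"
begin

text \<open>The momentum equation without its pressure. It equals minus the pressure gradient by
  \<open>N_eq\<close>, but is written out so that \<open>test_split\<close> can treat its four terms
  separately.\<close>

definition N :: "3 \<Rightarrow> real^3 \<Rightarrow> real" where
  "N i x = w i x + (\<Sum>j\<in>UNIV. v j x * v1 i j x) - (\<Sum>j\<in>UNIV. v2 i j x) - f i x"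

lemmas cont_v = C1_dir_continuous(1)[OF v] and cont_v1 = C1_dir_continuous(2)[OF v]
  and cont_v2 = C1_dir_continuous(2)[OF v1]

lemma cont_N: "continuous_on UNIV (N i)"
  unfolding N_def[abs_def] by (intro continuous_intros w f cont_v cont_v1 cont_v2)

lemma N_eq: "N i x = - q1 i x"
  using momentum[of i x] by (simp add: N_def)

lemma test_div_free:
  assumes "\<And>i j. C1_dir (ax j) (\<phi> i) (\<phi>1 i j)" "\<And>i. cts_cpt (\<phi> i)" "\<And>x. (\<Sum>i\<in>UNIV. \<phi>1 i i x) = 0"
  shows "(\<integral>x. (\<Sum>i\<in>UNIV. N i x * \<phi> i x) \<partial>lborel) = 0"
proof -
  have "(\<integral>x. (\<Sum>i\<in>UNIV. q1 i x * \<phi> i x + q x * \<phi>1 i i x) \<partial>lborel) = 0"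
    by (rule integral_divergence[of "\<lambda>i x. q x * \<phi> i x"])
       (intro C1_dir_mult q assms cts_cpt_mult_left C1_dir_continuous(1)[OF q])+
  moreover have "(\<Sum>i\<in>UNIV. q1 i x * \<phi> i x + q x * \<phi>1 i i x) = - (\<Sum>i\<in>UNIV. N i x * \<phi> i x)" for x
    using assms(3)[of x] by (simp add: N_eq sum.distrib sum_distrib_left[symmetric] sum_negf)
  ultimately show ?thesis by simp
qed

text \<open>As \<open>v\<close> is divergence-free, the convection term is the divergence of the
  tensor \<open>v i * v j\<close>; its derivative moves to the test field and none of
  \<open>v\<close> is left.\<close>

lemma convection_by_parts:
  assumes \<phi>: "\<And>i j. C1_dir (ax j) (\<phi> i) (\<phi>1 i j)" "\<And>i. cts_cpt (\<phi> i)"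
  shows "(\<integral>x. (\<Sum>i\<in>UNIV. (\<Sum>j\<in>UNIV. v j x * v1 i j x) * \<phi> i x) \<partial>lborel) =
      - (\<integral>x. (\<Sum>i\<in>UNIV. \<Sum>j\<in>UNIV. v i x * v j x * \<phi>1 i j x) \<partial>lborel)"
proof -
  have c1: "cts_cpt (\<phi>1 i j)" for i j by (rule cts_cpt_C1_dir[OF \<phi>])
  note ci = cts_cpt_integrable cts_cpt_sum cts_cpt_mult_left continuous_intros cont_v cont_v1 \<phi>(2) c1
  have I: "integrable lborel (\<lambda>x. \<Sum>i\<in>UNIV. (\<Sum>j\<in>UNIV. v j x * v1 i j x) * \<phi> i x)"
    "integrable lborel (\<lambda>x. \<Sum>i\<in>UNIV. \<Sum>j\<in>UNIV. v i x * v j x * \<phi>1 i j x)"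
    by (intro ci)+
  have "(\<integral>x. (\<Sum>j\<in>UNIV. \<Sum>i\<in>UNIV. (v1 i j x * v j x + v i x * v1 j j x) * \<phi> i x + v i x * v j x * \<phi>1 i j x) \<partial>lborel) = 0"
    by (rule integral_divergence[of "\<lambda>j x. \<Sum>i\<in>UNIV. v i x * v j x * \<phi> i x"])
       (intro C1_dir_sum C1_dir_mult v \<phi> ci)+
  moreover have "(\<Sum>j\<in>UNIV. \<Sum>i\<in>UNIV. (v1 i j x * v j x + v i x * v1 j j x) * \<phi> i x + v i x * v j x * \<phi>1 i j x) =
     (\<Sum>i\<in>UNIV. (\<Sum>j\<in>UNIV. v j x * v1 i j x) * \<phi> i x) + (\<Sum>i\<in>UNIV. \<Sum>j\<in>UNIV. v i x * v j x * \<phi>1 i j x)" for x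
  proof -
    have "(\<Sum>j\<in>UNIV. \<Sum>i\<in>UNIV. v i x * v1 j j x * \<phi> i x) = (\<Sum>j\<in>UNIV. v1 j j x) * (\<Sum>i\<in>UNIV. v i x * \<phi> i x)"
      by (simp add: sum_product mult_ac)
    then have "(\<Sum>j\<in>UNIV. \<Sum>i\<in>UNIV. v i x * v1 j j x * \<phi> i x) = 0" by (simp add: div_v)
    moreover have "(\<Sum>j\<in>UNIV. \<Sum>i\<in>UNIV. v1 i j x * v j x * \<phi> i x) = (\<Sum>i\<in>UNIV. (\<Sum>j\<in>UNIV. v j x * v1 i j x) * \<phi> i x)"
      by (subst sum.swap) (simp add: sum_distrib_left mult_ac)
    moreover have "(\<Sum>j\<in>UNIV. \<Sum>i\<in>UNIV. v i x * v j x * \<phi>1 i j x) = (\<Sum>i\<in>UNIV. \<Sum>j\<in>UNIV. v i x * v j x * \<phi>1 i j x)"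
      by (rule sum.swap)
    ultimately show ?thesis by (simp add: sum.distrib distrib_right)
  qed
  ultimately show ?thesis
    using Bochner_Integration.integral_add[OF I] by simp
qed

text \<open>The flux \<open>v1 \<phi> - v \<phi>1\<close> of Green's identity moves both derivatives
  at once.\<close>

lemma viscosity_by_parts:
  assumes \<phi>: "\<And>i j. C1_dir (ax j) (\<phi> i) (\<phi>1 i j)" "\<And>i. cts_cpt (\<phi> i)" "\<And>i j. C1_dir (ax j) (\<phi>1 i j) (\<phi>2 i j)"
  shows "(\<integral>x. (\<Sum>i\<in>UNIV. (\<Sum>j\<in>UNIV. v2 i j x) * \<phi> i x) \<partial>lborel) = (\<integral>x. (\<Sum>i\<in>UNIV. \<Sum>j\<in>UNIV. v i x * \<phi>2 i j x) \<partial>lborel)"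
proof -
  have c1: "cts_cpt (\<phi>1 i j)" for i j by (rule cts_cpt_C1_dir[OF \<phi>(1,2)])
  have c2: "cts_cpt (\<phi>2 i j)" for i j by (rule cts_cpt_C1_dir[OF \<phi>(3) c1])
  note ci = cts_cpt_integrable cts_cpt_sum cts_cpt_diff cts_cpt_mult_left continuous_intros cont_v cont_v1 cont_v2 \<phi>(2) c1 c2
  have I: "integrable lborel (\<lambda>x. \<Sum>i\<in>UNIV. (\<Sum>j\<in>UNIV. v2 i j x) * \<phi> i x)"
    "integrable lborel (\<lambda>x. \<Sum>i\<in>UNIV. \<Sum>j\<in>UNIV. v i x * \<phi>2 i j x)"
    by (intro ci)+
  have "(\<integral>x. (\<Sum>j\<in>UNIV. \<Sum>i\<in>UNIV. (v2 i j x * \<phi> i x + v1 i j x * \<phi>1 i j x) - (v1 i j x * \<phi>1 i j x + v i x * \<phi>2 i j x)) \<partial>lborel) = 0"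
    by (rule integral_divergence[of "\<lambda>j x. \<Sum>i\<in>UNIV. v1 i j x * \<phi> i x - v i x * \<phi>1 i j x"])
       (intro C1_dir_sum C1_dir_mult C1_dir_diff v v1 \<phi> ci)+
  moreover have "(\<Sum>j\<in>UNIV. \<Sum>i\<in>UNIV. (v2 i j x * \<phi> i x + v1 i j x * \<phi>1 i j x) - (v1 i j x * \<phi>1 i j x + v i x * \<phi>2 i j x)) =
     (\<Sum>i\<in>UNIV. (\<Sum>j\<in>UNIV. v2 i j x) * \<phi> i x) - (\<Sum>i\<in>UNIV. \<Sum>j\<in>UNIV. v i x * \<phi>2 i j x)" for x
    by (subst sum.swap) (simp add: sum_subtractf sum_distrib_right)
  ultimately show ?thesis
    using Bochner_Integration.integral_diff[OF I] by simp
qed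

lemma test_split:
  assumes "\<And>i. cts_cpt (\<phi> i)"
  shows "(\<integral>x. (\<Sum>i\<in>UNIV. N i x * \<phi> i x) \<partial>lborel) =
    (\<integral>x. (\<Sum>i\<in>UNIV. w i x * \<phi> i x) \<partial>lborel) + (\<integral>x. (\<Sum>i\<in>UNIV. (\<Sum>j\<in>UNIV. v j x * v1 i j x) * \<phi> i x) \<partial>lborel)
      - (\<integral>x. (\<Sum>i\<in>UNIV. (\<Sum>j\<in>UNIV. v2 i j x) * \<phi> i x) \<partial>lborel) - (\<integral>x. (\<Sum>i\<in>UNIV. f i x * \<phi> i x) \<partial>lborel)"
proof -
  have "(\<integral>x. (\<Sum>i\<in>UNIV. N i x * \<phi> i x) \<partial>lborel) =
    (\<integral>x. (\<Sum>i\<in>UNIV. w i x * \<phi> i x) + (\<Sum>i\<in>UNIV. (\<Sum>j\<in>UNIV. v j x * v1 i j x) * \<phi> i x)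
      - (\<Sum>i\<in>UNIV. (\<Sum>j\<in>UNIV. v2 i j x) * \<phi> i x) - (\<Sum>i\<in>UNIV. f i x * \<phi> i x) \<partial>lborel)"
    by (intro Bochner_Integration.integral_cong refl) (simp add: N_def left_diff_distrib distrib_right sum.distrib sum_subtractf)
  moreover have "integrable lborel (\<lambda>x. \<Sum>i\<in>UNIV. w i x * \<phi> i x)" "integrable lborel (\<lambda>x. \<Sum>i\<in>UNIV. f i x * \<phi> i x)"
      "integrable lborel (\<lambda>x. \<Sum>i\<in>UNIV. (\<Sum>j\<in>UNIV. v j x * v1 i j x) * \<phi> i x)"
      "integrable lborel (\<lambda>x. \<Sum>i\<in>UNIV. (\<Sum>j\<in>UNIV. v2 i j x) * \<phi> i x)"
    by (intro cts_cpt_integrable cts_cpt_sum cts_cpt_mult_left continuous_intros cont_v cont_v1 cont_v2 w f assms)+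
  ultimately show ?thesis
    by (simp only: Bochner_Integration.integral_diff Bochner_Integration.integral_add Bochner_Integration.integrable_add Bochner_Integration.integrable_diff)
qed

text \<open>\<open>w\<close> and \<open>f\<close> are orthogonal to gradients by
  \<open>div_w\<close> and \<open>div_f\<close>. The viscous term becomes \<open>v\<close> against
  the gradient of the Laplacian of \<open>G\<close>, once \<open>G3\<close> has put the indices in
  order, and vanishes because \<open>v\<close> is divergence-free. Only convection survives.\<close>

lemma test_gradient:
  assumes G: "\<And>i. C1_dir (ax i) G (G1 i)" "\<And>i j. C1_dir (ax j) (G1 i) (G2 i j)"
    "\<And>i j l. C1_dir (ax l) (G2 i j) (G3 i j l)" "cts_cpt G" and G3: "\<And>i j. G3 i j j = G3 j j i"
  shows "(\<integral>x. (\<Sum>i\<in>UNIV. N i x * G1 i x) \<partial>lborel) = - (\<integral>x. (\<Sum>i\<in>UNIV. \<Sum>j\<in>UNIV. v i x * v j x * G2 i j x) \<partial>lborel)"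
proof -
  have c1: "cts_cpt (G1 i)" for i by (rule cts_cpt_C1_dir[OF G(1,4)])
  have c2: "cts_cpt (G2 i j)" for i j by (rule cts_cpt_C1_dir[OF G(2) c1])
  have "(\<integral>x. (\<Sum>i\<in>UNIV. v1 i i x * (\<Sum>j\<in>UNIV. G2 j j x) + v i x * (\<Sum>j\<in>UNIV. G3 j j i x)) \<partial>lborel) = 0"
    by (rule integral_divergence[of "\<lambda>i x. v i x * (\<Sum>j\<in>UNIV. G2 j j x)"])
       (intro C1_dir_sum C1_dir_mult v v1 G cts_cpt_mult_left cts_cpt_sum c2 cont_v)+
  moreover have "(\<Sum>i\<in>UNIV. v1 i i x * (\<Sum>j\<in>UNIV. G2 j j x) + v i x * (\<Sum>j\<in>UNIV. G3 j j i x)) = (\<Sum>i\<in>UNIV. \<Sum>j\<in>UNIV. v i x * G3 i j j x)" for x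
  proof -
    have "(\<Sum>i\<in>UNIV. v1 i i x * (\<Sum>j\<in>UNIV. G2 j j x)) = 0"
      by (simp add: sum_distrib_right[symmetric] div_v)
    moreover have "(\<Sum>i\<in>UNIV. v i x * (\<Sum>j\<in>UNIV. G3 j j i x)) = (\<Sum>i\<in>UNIV. \<Sum>j\<in>UNIV. v i x * G3 i j j x)"
      unfolding sum_distrib_left by (intro sum.cong refl arg_cong[where f = "\<lambda>g. v _ x * g x"] G3[symmetric])
    ultimately show ?thesis by (simp add: sum.distrib)
  qed
  ultimately have "(\<integral>x. (\<Sum>i\<in>UNIV. \<Sum>j\<in>UNIV. v i x * G3 i j j x) \<partial>lborel) = 0" by simp
  then show ?thesis
    using test_split[OF c1] div_w[OF G(1) c1 G(4)] div_f[OF G(1) c1 G(4)] convection_by_parts[OF G(2) c1] viscosity_by_parts[OF G(2) c1 G(3)]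
    by simp
qed

text \<open>The three parts of the test field have as divergences \<open>h\<close> mollified at
  scale \<epsilon>, minus \<open>h\<close> mollified at scale \<open>L\<close>, and the Laplacian of
  the kernel convolved with \<open>h\<close>, which is exactly the opposite of the first
  two.\<close>

lemma test_identity:
  assumes "0 < \<epsilon>" "\<epsilon> \<le> L" and \<eta>: "\<And>j. C1_dir (ax j) \<eta> (\<eta>1 j)" "cts_cpt \<eta>"
    and h: "h = (\<lambda>x. \<Sum>j\<in>UNIV. \<eta>1 j x * v j x)"
  shows "(\<integral>x. (\<Sum>i\<in>UNIV. N i x * conv (bump \<epsilon>) (\<lambda>x. \<eta> x * v i x) x) \<partial>lborel) =
    (\<integral>x. (\<Sum>i\<in>UNIV. N i x * conv (bump L) (\<lambda>x. \<eta> x * v i x) x) \<partial>lborel) +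
    (\<integral>x. (\<Sum>i\<in>UNIV. \<Sum>j\<in>UNIV. v i x * v j x * conv (krn2 \<epsilon> L i j) h x) \<partial>lborel)"
proof -
  have L: "0 < L" "0 \<le> L" using assms by auto
  have \<eta>c: "cts_cpt (\<eta>1 j)" for j by (rule cts_cpt_C1_dir[OF \<eta>])
  have hc: "cts_cpt h" unfolding h by (intro cts_cpt_sum cts_cpt_mult_right \<eta>c cont_v)
  let ?g = "\<lambda>i x. \<eta> x * v i x" and ?g1 = "\<lambda>i j x. \<eta>1 j x * v i x + \<eta> x * v1 i j x"
  have g: "C1_dir (ax j) (?g i) (?g1 i j)" for i j by (intro C1_dir_mult \<eta> v)
  have gc: "cts_cpt (?g i)" for i by (intro cts_cpt_mult_right \<eta> cont_v)
  have g1c: "cts_cpt (?g1 i j)" for i j by (rule cts_cpt_C1_dir[OF g gc])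
  let ?\<phi> = "\<lambda>i x. conv (bump \<epsilon>) (?g i) x - conv (bump L) (?g i) x + conv (krn1 \<epsilon> L i) h x"
  let ?\<phi>1 = "\<lambda>i j x. conv (bump \<epsilon>) (?g1 i j) x - conv (bump L) (?g1 i j) x + conv (krn2 \<epsilon> L i j) h x"
  have bc: "cts_cpt (conv (bump s) (?g i))" if "0 < s" for s i by (intro cts_cpt_conv cts_cpt_bump that gc)
  have kc: "cts_cpt (conv (krn1 \<epsilon> L i) h)" for i by (intro cts_cpt_conv cts_cpt_krn1 assms L hc)
  have k0c: "cts_cpt (conv (krn \<epsilon> L) h)" by (intro cts_cpt_conv cts_cpt_krn assms L hc)
  have \<phi>: "(\<integral>x. (\<Sum>i\<in>UNIV. N i x * ?\<phi> i x) \<partial>lborel) = 0"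
  proof (rule test_div_free)
    show "C1_dir (ax j) (?\<phi> i) (?\<phi>1 i j)" for i j
      by (intro C1_dir_add C1_dir_diff C1_dir_conv_right C1_dir_conv C1_dir_krn1 cts_cpt_bump g gc hc assms L)
    show "cts_cpt (?\<phi> i)" for i by (intro cts_cpt_add cts_cpt_diff bc kc assms L)
    fix x
    have s: "(\<Sum>i\<in>UNIV. conv (bump s) (?g1 i i) x) = conv (bump s) h x" if "0 < s" for s
    proof -
      have "(\<Sum>i\<in>UNIV. conv (bump s) (?g1 i i) x) = conv (bump s) (\<lambda>x. \<Sum>i\<in>UNIV. ?g1 i i x) x"
        by (rule conv_sum_right[symmetric]) (use g1c cts_cpt_continuous[OF cts_cpt_bump[OF that]] in auto)
      also have "(\<lambda>x. \<Sum>i\<in>UNIV. ?g1 i i x) = h"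
        by (simp add: h fun_eq_iff sum.distrib sum_distrib_left[symmetric] div_v)
      finally show ?thesis .
    qed
    have "(\<Sum>i\<in>UNIV. conv (krn2 \<epsilon> L i i) h x) = conv (\<lambda>x. \<Sum>i\<in>UNIV. krn2 \<epsilon> L i i x) h x"
      by (rule conv_sum_left[symmetric]) (use hc cts_cpt_continuous[OF cts_cpt_krn2[OF assms(1) L(2)]] in auto)
    also have "\<dots> = conv (bump L) h x - conv (bump \<epsilon>) h x"
      unfolding laplacian_krn[OF assms(1,2)]
      by (rule conv_diff_left) (use assms L hc cts_cpt_continuous[OF cts_cpt_bump] in auto)
    finally show "(\<Sum>i\<in>UNIV. ?\<phi>1 i i x) = 0"
      using s[OF assms(1)] s[OF L(1)] by (simp add: sum.distrib sum_subtractf)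
  qed
  have G: "(\<integral>x. (\<Sum>i\<in>UNIV. N i x * conv (krn1 \<epsilon> L i) h x) \<partial>lborel) = - (\<integral>x. (\<Sum>i\<in>UNIV. \<Sum>j\<in>UNIV. v i x * v j x * conv (krn2 \<epsilon> L i j) h x) \<partial>lborel)"
    by (rule test_gradient[where G = "conv (krn \<epsilon> L) h" and ?G3.0 = "\<lambda>i j l. conv (krn3 \<epsilon> L i j l) h"])
      (intro C1_dir_conv C1_dir_krn C1_dir_krn1 C1_dir_krn2 hc assms k0c | subst krn3_swap(1), rule refl)+
  have I: "integrable lborel (\<lambda>x. \<Sum>i\<in>UNIV. N i x * conv (bump s) (?g i) x)" if "0 < s" for s
    by (intro cts_cpt_integrable cts_cpt_sum cts_cpt_mult_left cont_N bc that)
  have J: "integrable lborel (\<lambda>x. \<Sum>i\<in>UNIV. N i x * conv (krn1 \<epsilon> L i) h x)"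
    by (intro cts_cpt_integrable cts_cpt_sum cts_cpt_mult_left cont_N kc)
  have "(\<integral>x. (\<Sum>i\<in>UNIV. N i x * ?\<phi> i x) \<partial>lborel) =
    (\<integral>x. (\<Sum>i\<in>UNIV. N i x * conv (bump \<epsilon>) (?g i) x) - (\<Sum>i\<in>UNIV. N i x * conv (bump L) (?g i) x) +
       (\<Sum>i\<in>UNIV. N i x * conv (krn1 \<epsilon> L i) h x) \<partial>lborel)"
    by (simp add: distrib_left right_diff_distrib sum.distrib sum_subtractf)
  also have "\<dots> = (\<integral>x. (\<Sum>i\<in>UNIV. N i x * conv (bump \<epsilon>) (?g i) x) \<partial>lborel) - (\<integral>x. (\<Sum>i\<in>UNIV. N i x * conv (bump L) (?g i) x) \<partial>lborel) +
       (\<integral>x. (\<Sum>i\<in>UNIV. N i x * conv (krn1 \<epsilon> L i) h x) \<partial>lborel)"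
    using I[OF assms(1)] I[OF L(1)] J
    by (simp only: Bochner_Integration.integral_diff Bochner_Integration.integral_add Bochner_Integration.integrable_add Bochner_Integration.integrable_diff)
  finally show ?thesis using \<phi> G by linarith
qed

end

section \<open>Inequalities and constants for the estimate at a fixed time\<close>

lemma young_3_4:
  fixes z c k :: real
  assumes "0 \<le> z" "0 \<le> c" "0 < k"
  shows "z ^ 3 * c \<le> k * z ^ 4 + c ^ 4 / k ^ 3"
proof -
  define b where "b = c / k"
  have b: "0 \<le> b" using assms by (simp add: b_def)
  have "z ^ 3 * b \<le> z ^ 4 + b ^ 4"
  proof (cases "b \<le> z")
    case True
    then have "z ^ 3 * b \<le> z ^ 3 * z" using assms by (intro mult_left_mono) auto
    also have "\<dots> = z ^ 4" by (simp add: eval_nat_numeral)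
    finally show ?thesis using b by (simp add: add_increasing2)
  next
    case False
    then have "z ^ 3 * b \<le> b ^ 3 * b" using assms b by (intro mult_right_mono power_mono) auto
    also have "\<dots> = b ^ 4" by (simp add: eval_nat_numeral)
    finally show ?thesis using assms by (simp add: add_increasing)
  qed
  then have "k * (z ^ 3 * b) \<le> k * (z ^ 4 + b ^ 4)" using assms by (intro mult_left_mono) auto
  moreover have "k * (z ^ 3 * b) = z ^ 3 * c" using assms by (simp add: b_def)
  moreover have "k * b ^ 4 = c ^ 4 / k ^ 3" using assms by (simp add: b_def power_divide eval_nat_numeral)
  ultimately show ?thesis by (simp add: distrib_left)
qed

lemma le_1_plus_power4: "0 \<le> (y::real) \<Longrightarrow> y \<le> 1 + y ^ 4"
proof (cases "y \<le> 1")
  case False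
  then have "y ^ 1 \<le> y ^ 4" by (intro power_increasing) auto
  then show ?thesis by simp
qed (simp add: add_increasing2)

definition far_const :: real where "far_const = 1200 / bump_mass * sqrt far_mass"

text \<open>\<open>514 = 512 + 2\<close>: the viscous cross term and the part of \<open>Z\<close>
  without dissipation. \<open>60^4 * 64^3\<close> is Young's inequality with weight
  \<open>1/64\<close> for a term with coefficient \<open>60 = 20 * 3\<close>, and
  \<open>24 = 3 * 8\<close> belongs to the far field.\<close>

definition slice_const :: real where
  "slice_const = 514 + 60 ^ 4 * 64 ^ 3 + 24 * far_const"

lemma far_const_nonneg: "0 \<le> far_const"
  using bump_mass_pos far_mass_nonneg by (simp add: far_const_def)

locale slice_energy = slice +
  fixes M :: real
  assumes M: "0 \<le> M"
    and L2: "integrable lborel (\<lambda>x. \<Sum>i\<in>UNIV. (v i x)\<^sup>2)" "(\<integral>x. (\<Sum>i\<in>UNIV. (v i x)\<^sup>2) \<partial>lborel) \<le> M\<^sup>2"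
begin

definition e :: "real^3 \<Rightarrow> real" where "e x = (\<Sum>i\<in>UNIV. (v i x)\<^sup>2)"
definition D :: "real^3 \<Rightarrow> real" where "D x = (\<Sum>i\<in>UNIV. \<Sum>j\<in>UNIV. (v1 i j x)\<^sup>2)"

lemma e_nonneg: "0 \<le> e x" and D_nonneg: "0 \<le> D x"
  by (auto simp: e_def D_def intro!: sum_nonneg)

lemma cont_e: "continuous_on UNIV e" and cont_D: "continuous_on UNIV D"
  unfolding e_def[abs_def] D_def[abs_def] by (intro continuous_intros cont_v cont_v1)+

lemma meas_e [measurable]: "e \<in> borel_measurable borel" and meas_D [measurable]: "D \<in> borel_measurable borel"
  using cont_e cont_D by measurable

lemma L2_e: "integrable lborel e" "(\<integral>x. e x \<partial>lborel) \<le> M\<^sup>2"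
  using L2 by (simp_all add: e_def[abs_def])

lemma ball_integrable:
  fixes g :: "real^3 \<Rightarrow> real"
  assumes "continuous_on UNIV g" shows "integrable lborel (\<lambda>x. indicator (cball x0 a) x * g x)"
  using borel_integrable_compact[of "cball x0 a" g] continuous_on_subset[OF assms] by simp

lemma cutoff_grad_square_le:
  assumes "cutoff x0 \<rho> d \<eta> \<eta>1"
  shows "(\<Sum>j\<in>UNIV. \<eta>1 j x * v j x)\<^sup>2 \<le> (8 / d)\<^sup>2 * e x"
proof -
  have "(\<Sum>j\<in>UNIV. \<eta>1 j x * v j x)\<^sup>2 \<le> (\<Sum>j\<in>UNIV. (\<eta>1 j x)\<^sup>2) * (\<Sum>j\<in>UNIV. (v j x)\<^sup>2)"
    by (rule Cauchy_Schwarz_ineq_sum)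
  also have "\<dots> \<le> (8 / d)\<^sup>2 * e x"
    unfolding e_def using assms by (intro mult_right_mono) (auto simp: cutoff_def intro: sum_nonneg)
  finally show ?thesis .
qed

lemma cutoff_grad_L2:
  assumes "cutoff x0 \<rho> d \<eta> \<eta>1" "0 < d"
  shows "sqrt (\<integral>x. (\<Sum>j\<in>UNIV. \<eta>1 j x * v j x)\<^sup>2 \<partial>lborel) \<le> 8 / d * M"
proof -
  have "(\<integral>x. (\<Sum>j\<in>UNIV. \<eta>1 j x * v j x)\<^sup>2 \<partial>lborel) \<le> (\<integral>x. (8 / d)\<^sup>2 * e x \<partial>lborel)"
    by (intro integral_mono cutoff_grad_square_le[OF assms(1)] cts_cpt_integrable cts_cpt_power cts_cpt_sum
        cts_cpt_mult_right cutoff_cts_cpt[OF assms(1)] cont_v integrable_mult_right L2_e) simp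
  also have "\<dots> \<le> (8 / d)\<^sup>2 * M\<^sup>2" using L2_e by (simp add: mult_left_mono)
  also have "\<dots> = (8 / d * M)\<^sup>2" by (simp only: power_mult_distrib)
  finally show ?thesis using M assms(2) by (intro real_le_lsqrt) auto
qed

text \<open>\<open>h\<close> lives within radius \<open>\<rho> + d\<close>, so points beyond radius
  \<open>\<rho> + 2 * d\<close> have distance at least \<open>d\<close> from its support. Inside,
  Cauchy-Schwarz pairs \<open>e\<close> in \<open>L^2\<close> with the Hessian, of norm at most
  \<open>2 * s\<close>. Outside, each of the nine second derivatives is at most \<open>C\<close>,
  hence \<open>sqrt (H x) \<le> 3 * C\<close>, and \<open>e\<close> has total integral at most
  \<open>M\<^sup>2\<close>.\<close>

lemma nonlocal_bound:
  assumes \<epsilon>: "0 < \<epsilon>" "\<epsilon> \<le> L" and d: "0 < d" and \<eta>: "cutoff x0 \<rho> d \<eta> \<eta>1"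
    and h: "h = (\<lambda>x. \<Sum>j\<in>UNIV. \<eta>1 j x * v j x)"
    and E4: "E4 = (\<integral>x. indicator (cball x0 (\<rho> + 2 * d)) x * (e x)\<^sup>2 \<partial>lborel)"
  shows "(\<integral>x. (\<Sum>i\<in>UNIV. \<Sum>j\<in>UNIV. v i x * v j x * conv (krn2 \<epsilon> L i j) h x) \<partial>lborel)
    \<le> (2 * sqrt E4 + 3 * far_const / (d * sqrt d) * M\<^sup>2) * (8 / d * M)"
proof -
  let ?B = "cball x0 (\<rho> + 2 * d)"
  let ?Q = "\<lambda>x. \<Sum>i\<in>UNIV. \<Sum>j\<in>UNIV. v i x * v j x * conv (krn2 \<epsilon> L i j) h x"
  define H where "H x = (\<Sum>i\<in>UNIV. \<Sum>j\<in>UNIV. (conv (krn2 \<epsilon> L i j) h x)\<^sup>2)" for x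
  define s where "s = sqrt (\<integral>y. (h y)\<^sup>2 \<partial>lborel)"
  have s: "0 \<le> s" "s \<le> 8 / d * M"
    using cutoff_grad_L2[OF \<eta> d] by (auto simp: s_def h intro: integral_nonneg_AE)
  have L: "0 \<le> L" using \<epsilon> by simp
  have hc: "cts_cpt h" unfolding h by (intro cts_cpt_sum cts_cpt_mult_right cutoff_cts_cpt[OF \<eta>] cont_v)
  have kc: "cts_cpt (conv (krn2 \<epsilon> L i j) h)" for i j by (intro cts_cpt_conv cts_cpt_krn2 \<epsilon> L hc)
  have Hc: "cts_cpt H" unfolding H_def[abs_def] by (intro cts_cpt_sum cts_cpt_power kc) simp
  have H0: "0 \<le> H x" for x by (auto simp: H_def intro!: sum_nonneg)
  define C where "C = far_const / (d * sqrt d) * s"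
  have C: "0 \<le> C" using far_const_nonneg s d by (simp add: C_def)
  have Cfar: "1200 / bump_mass * sqrt (far_mass / d ^ 3) * s = C"
  proof -
    have "sqrt (d ^ 3) = d * sqrt d" using d by (simp add: power3_eq_cube real_sqrt_mult)
    then show ?thesis by (simp add: C_def far_const_def real_sqrt_divide)
  qed
  have far: "sqrt (H x) \<le> 3 * C" if x: "x \<notin> ?B" for x
  proof -
    have "(conv (krn2 \<epsilon> L i j) h x)\<^sup>2 \<le> C\<^sup>2" for i j
    proof -
      have "\<bar>conv (krn2 \<epsilon> L i j) h x\<bar> \<le> C"
        unfolding Cfar[symmetric] s_def
      proof (rule conv_krn2_far[OF \<epsilon> d hc])
        fix y assume "h y \<noteq> 0"
        then have "norm (y - x0) \<le> \<rho> + d" using \<eta> by (auto simp: h cutoff_def not_less[symmetric])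
        moreover have "\<rho> + 2 * d < norm (x - x0)" using x by (simp add: dist_norm norm_minus_commute)
        moreover have "norm (x - x0) \<le> norm (x - y) + norm (y - x0)"
          using norm_triangle_ineq[of "x - y" "y - x0"] by simp
        ultimately show "d \<le> norm (x - y)" by linarith
      qed
      then show ?thesis using power_mono[of "\<bar>conv (krn2 \<epsilon> L i j) h x\<bar>" C 2] by simp
    qed
    then have "H x \<le> (\<Sum>i\<in>(UNIV::3 set). \<Sum>j\<in>(UNIV::3 set). C\<^sup>2)" unfolding H_def by (intro sum_mono)
    also have "\<dots> = (3 * C)\<^sup>2" by (simp add: power_mult_distrib)
    finally show ?thesis using C by (intro real_le_lsqrt) auto
  qed
  have Q: "?Q x \<le> e x * sqrt (H x)" for x
  proof -
    have "?Q x = (\<Sum>p\<in>UNIV \<times> UNIV. (v (fst p) x * v (snd p) x) * conv (krn2 \<epsilon> L (fst p) (snd p)) h x)"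
      by (simp add: sum.cartesian_product case_prod_beta)
    also have "\<dots>\<^sup>2 \<le> (\<Sum>p\<in>UNIV \<times> UNIV. (v (fst p) x * v (snd p) x)\<^sup>2) * (\<Sum>p\<in>UNIV \<times> UNIV. (conv (krn2 \<epsilon> L (fst p) (snd p)) h x)\<^sup>2)"
      by (rule Cauchy_Schwarz_ineq_sum)
    also have "(\<Sum>p\<in>UNIV \<times> UNIV. (v (fst p) x * v (snd p) x)\<^sup>2) = (e x)\<^sup>2"
      unfolding e_def power_mult_distrib power2_eq_square[of "sum _ _"] sum_product
      by (simp add: sum.cartesian_product case_prod_beta)
    also have "(\<Sum>p\<in>UNIV \<times> UNIV. (conv (krn2 \<epsilon> L (fst p) (snd p)) h x)\<^sup>2) = H x"
      by (simp add: H_def sum.cartesian_product case_prod_beta)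
    finally have "\<bar>?Q x\<bar> \<le> sqrt ((e x)\<^sup>2 * H x)" by (rule real_le_rsqrt[of "\<bar>_\<bar>", simplified])
    also have "\<dots> = e x * sqrt (H x)" using e_nonneg by (simp add: real_sqrt_mult)
    finally show ?thesis by linarith
  qed
  have split: "?Q x \<le> \<bar>(indicator ?B x * e x) * sqrt (H x)\<bar> + 3 * C * e x" for x
  proof (cases "x \<in> ?B")
    case True
    then show ?thesis using Q[of x] C e_nonneg[of x] H0[of x] by (simp add: add_increasing2)
  next
    case False
    then have "e x * sqrt (H x) \<le> e x * (3 * C)" by (intro mult_left_mono far e_nonneg)
    then show ?thesis using Q[of x] False by (simp add: mult_ac)
  qed
  have mB: "(\<lambda>x. indicator ?B x * e x) \<in> borel_measurable lborel"
    by (rule borel_measurable_integrable[OF ball_integrable[OF cont_e]])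
  have mH: "(\<lambda>x. sqrt (H x)) \<in> borel_measurable lborel"
    using continuous_on_UNIV_measurable[OF continuous_on_real_sqrt[OF cts_cpt_continuous[OF Hc]]] by simp
  have e2: "(indicator ?B x * e x)\<^sup>2 = indicator ?B x * (e x)\<^sup>2" for x
    by (auto simp: indicator_def)
  have I1: "integrable lborel (\<lambda>x. (indicator ?B x * e x)\<^sup>2)"
    unfolding e2 by (intro ball_integrable continuous_intros cont_e)
  have I2: "integrable lborel (\<lambda>x. (sqrt (H x))\<^sup>2)" using H0 cts_cpt_integrable[OF Hc] by simp
  have IQ: "integrable lborel ?Q"
    by (intro cts_cpt_integrable cts_cpt_sum cts_cpt_mult_left continuous_intros cont_v kc)
  have "integrable lborel (\<lambda>x. (indicator ?B x * e x) * sqrt (H x))"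
    by (rule integrable_mult_squares[OF mB mH I1 I2])
  then have IP: "integrable lborel (\<lambda>x. \<bar>(indicator ?B x * e x) * sqrt (H x)\<bar>)"
    by (rule integrable_abs)
  have "(\<integral>x. ?Q x \<partial>lborel) \<le> (\<integral>x. \<bar>(indicator ?B x * e x) * sqrt (H x)\<bar> + 3 * C * e x \<partial>lborel)"
    using IQ IP L2_e(1) split by (intro integral_mono) auto
  also have "\<dots> = (\<integral>x. \<bar>(indicator ?B x * e x) * sqrt (H x)\<bar> \<partial>lborel) + 3 * C * (\<integral>x. e x \<partial>lborel)"
    using IP L2_e(1) by simp
  also have "\<dots> \<le> sqrt E4 * (2 * s) + 3 * C * M\<^sup>2"
  proof (intro add_mono mult_left_mono L2_e)
    have "(\<integral>x. \<bar>(indicator ?B x * e x) * sqrt (H x)\<bar> \<partial>lborel) \<le> sqrt (\<integral>x. (indicator ?B x * e x)\<^sup>2 \<partial>lborel) * sqrt (\<integral>x. (sqrt (H x))\<^sup>2 \<partial>lborel)"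
      by (rule Cauchy_Schwarz_integral[OF mB mH I1 I2])
    also have "(\<integral>x. (indicator ?B x * e x)\<^sup>2 \<partial>lborel) = E4" unfolding E4 e2 ..
    also have "(\<integral>x. (sqrt (H x))\<^sup>2 \<partial>lborel) = (\<integral>x. H x \<partial>lborel)" using H0 by simp
    also have "sqrt E4 * sqrt (\<integral>x. H x \<partial>lborel) \<le> sqrt E4 * (2 * s)"
    proof (rule mult_left_mono)
      have "(\<integral>x. H x \<partial>lborel) \<le> 4 * (\<integral>x. (h x)\<^sup>2 \<partial>lborel)"
        unfolding H_def by (rule integral_hessian_conv_le[OF \<epsilon> hc])
      also have "\<dots> = (2 * s)\<^sup>2" by (simp add: s_def power_mult_distrib integral_nonneg_AE)
      finally show "sqrt (\<integral>x. H x \<partial>lborel) \<le> 2 * s" using s by (intro real_le_lsqrt) auto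
    qed (auto simp: E4 intro!: integral_nonneg_AE)
    finally show "(\<integral>x. \<bar>(indicator ?B x * e x) * sqrt (H x)\<bar> \<partial>lborel) \<le> sqrt E4 * (2 * s)" .
  qed (use C in auto)
  also have "\<dots> = (2 * sqrt E4 + 3 * far_const / (d * sqrt d) * M\<^sup>2) * s"
    by (simp add: C_def algebra_simps)
  also have "\<dots> \<le> (2 * sqrt E4 + 3 * far_const / (d * sqrt d) * M\<^sup>2) * (8 / d * M)"
    using s far_const_nonneg d by (intro mult_left_mono add_nonneg_nonneg) (auto simp: E4 intro!: integral_nonneg_AE)
  finally show ?thesis .
qed

text \<open>Paired with \<open>\<eta> v\<close>, convection becomes the flux of kinetic energy
  through the gradient of the cutoff, and viscosity splits into dissipation and a cross term. The
  pairing with \<open>N\<close> stays: \<open>\<eta> v\<close> is not divergence-free, so this is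
  where the pressure still hides.\<close>

lemma local_energy_identity:
  assumes \<eta>: "\<And>j. C1_dir (ax j) \<eta> (\<eta>1 j)" "cts_cpt \<eta>"
  shows "(\<integral>x. (\<Sum>i\<in>UNIV. w i x * (\<eta> x * v i x)) \<partial>lborel) + (\<integral>x. \<eta> x * D x \<partial>lborel) =
    (\<integral>x. (\<Sum>i\<in>UNIV. N i x * (\<eta> x * v i x)) \<partial>lborel)
    + (\<integral>x. 1 / 2 * ((\<Sum>j\<in>UNIV. \<eta>1 j x * v j x) * e x) \<partial>lborel)
    - (\<integral>x. (\<Sum>i\<in>UNIV. \<Sum>j\<in>UNIV. v1 i j x * (\<eta>1 j x * v i x)) \<partial>lborel)
    + (\<integral>x. (\<Sum>i\<in>UNIV. f i x * (\<eta> x * v i x)) \<partial>lborel)"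
proof -
  have \<eta>c: "cts_cpt (\<eta>1 j)" for j by (rule cts_cpt_C1_dir[OF \<eta>])
  note ci = cts_cpt_integrable cts_cpt_sum cts_cpt_add cts_cpt_diff cts_cpt_cmult cts_cpt_mult_left[OF _ cts_cpt_mult_right]
     cts_cpt_mult_right cts_cpt_minus continuous_intros cont_v cont_v1 cont_v2 w f \<eta> \<eta>c cont_N cont_e cont_D
  have "(\<integral>x. (\<Sum>j\<in>UNIV. (1 / 2) * ((\<eta>1 j x * v j x + \<eta> x * v1 j j x) * (\<Sum>i\<in>UNIV. v i x * v i x)
       + \<eta> x * v j x * (\<Sum>i\<in>UNIV. v1 i j x * v i x + v i x * v1 i j x))) \<partial>lborel) = 0"
    by (rule integral_divergence[of "\<lambda>j x. (1 / 2) * (\<eta> x * v j x * (\<Sum>i\<in>UNIV. v i x * v i x))"])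
       (intro C1_dir_cmult C1_dir_sum C1_dir_mult v \<eta> cts_cpt_cmult cts_cpt_mult_right continuous_intros cont_v)+
  moreover have "(\<Sum>j\<in>UNIV. (1 / 2) * ((\<eta>1 j x * v j x + \<eta> x * v1 j j x) * (\<Sum>i\<in>UNIV. v i x * v i x)
       + \<eta> x * v j x * (\<Sum>i\<in>UNIV. v1 i j x * v i x + v i x * v1 i j x)))
     = 1 / 2 * ((\<Sum>j\<in>UNIV. \<eta>1 j x * v j x) * e x) + (\<Sum>i\<in>UNIV. (\<Sum>j\<in>UNIV. v j x * v1 i j x) * (\<eta> x * v i x))" for x
  proof -
    have "(\<Sum>j\<in>UNIV. (1 / 2) * ((\<eta>1 j x * v j x + \<eta> x * v1 j j x) * (\<Sum>i\<in>UNIV. v i x * v i x)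
       + \<eta> x * v j x * (\<Sum>i\<in>UNIV. v1 i j x * v i x + v i x * v1 i j x)))
      = 1 / 2 * ((\<Sum>j\<in>UNIV. \<eta>1 j x * v j x) * e x) + 1 / 2 * (\<eta> x * (\<Sum>j\<in>UNIV. v1 j j x) * e x)
        + (\<Sum>j\<in>UNIV. \<Sum>i\<in>UNIV. v j x * v1 i j x * (\<eta> x * v i x))"
    proof -
      have "(1 / 2) * ((\<eta>1 j x * v j x + \<eta> x * v1 j j x) * (\<Sum>i\<in>UNIV. v i x * v i x)
         + \<eta> x * v j x * (\<Sum>i\<in>UNIV. v1 i j x * v i x + v i x * v1 i j x))
        = 1 / 2 * (\<eta>1 j x * v j x * e x) + 1 / 2 * (\<eta> x * v1 j j x * e x) + (\<Sum>i\<in>UNIV. v j x * v1 i j x * (\<eta> x * v i x))" for j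
        by (simp add: e_def sum.distrib sum_distrib_left distrib_right distrib_left power2_eq_square mult_ac sum_divide_distrib[symmetric])
      then show ?thesis by (simp only: sum.distrib sum_distrib_left sum_distrib_right)
    qed
    then show ?thesis by (subst (asm) sum.swap) (simp add: div_v sum_distrib_right)
  qed
  ultimately have conv: "(\<integral>x. 1 / 2 * ((\<Sum>j\<in>UNIV. \<eta>1 j x * v j x) * e x) + (\<Sum>i\<in>UNIV. (\<Sum>j\<in>UNIV. v j x * v1 i j x) * (\<eta> x * v i x)) \<partial>lborel) = 0"
    by simp
  have "(\<integral>x. (\<Sum>j\<in>UNIV. \<Sum>i\<in>UNIV. v2 i j x * (\<eta> x * v i x) + v1 i j x * (\<eta>1 j x * v i x + \<eta> x * v1 i j x)) \<partial>lborel) = 0"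
    by (rule integral_divergence[of "\<lambda>j x. \<Sum>i\<in>UNIV. v1 i j x * (\<eta> x * v i x)"])
       (intro C1_dir_sum C1_dir_mult v v1 \<eta> ci)+
  moreover have "(\<Sum>j\<in>UNIV. \<Sum>i\<in>UNIV. v2 i j x * (\<eta> x * v i x) + v1 i j x * (\<eta>1 j x * v i x + \<eta> x * v1 i j x))
    = (\<Sum>i\<in>UNIV. (\<Sum>j\<in>UNIV. v2 i j x) * (\<eta> x * v i x)) + (\<Sum>i\<in>UNIV. \<Sum>j\<in>UNIV. v1 i j x * (\<eta>1 j x * v i x)) + \<eta> x * D x" for x
    by (subst sum.swap) (simp add: D_def sum.distrib sum_distrib_left sum_distrib_right algebra_simps power2_eq_square)
  ultimately have lap: "(\<integral>x. (\<Sum>i\<in>UNIV. (\<Sum>j\<in>UNIV. v2 i j x) * (\<eta> x * v i x)) + (\<Sum>i\<in>UNIV. \<Sum>j\<in>UNIV. v1 i j x * (\<eta>1 j x * v i x)) + \<eta> x * D x \<partial>lborel) = 0"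
    by simp
  have I: "integrable lborel (\<lambda>x. 1 / 2 * ((\<Sum>j\<in>UNIV. \<eta>1 j x * v j x) * e x))"
    "integrable lborel (\<lambda>x. \<Sum>i\<in>UNIV. (\<Sum>j\<in>UNIV. v j x * v1 i j x) * (\<eta> x * v i x))"
    "integrable lborel (\<lambda>x. \<Sum>i\<in>UNIV. (\<Sum>j\<in>UNIV. v2 i j x) * (\<eta> x * v i x))"
    "integrable lborel (\<lambda>x. \<Sum>i\<in>UNIV. \<Sum>j\<in>UNIV. v1 i j x * (\<eta>1 j x * v i x))"
    "integrable lborel (\<lambda>x. \<eta> x * D x)"
    "integrable lborel (\<lambda>x. \<Sum>i\<in>UNIV. w i x * (\<eta> x * v i x))"
    "integrable lborel (\<lambda>x. \<Sum>i\<in>UNIV. f i x * (\<eta> x * v i x))"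
    by (intro ci)+
  have "(\<integral>x. (\<Sum>i\<in>UNIV. N i x * (\<eta> x * v i x)) \<partial>lborel) =
    (\<integral>x. (\<Sum>i\<in>UNIV. w i x * (\<eta> x * v i x)) + (\<Sum>i\<in>UNIV. (\<Sum>j\<in>UNIV. v j x * v1 i j x) * (\<eta> x * v i x))
      - (\<Sum>i\<in>UNIV. (\<Sum>j\<in>UNIV. v2 i j x) * (\<eta> x * v i x)) - (\<Sum>i\<in>UNIV. f i x * (\<eta> x * v i x)) \<partial>lborel)"
    by (intro Bochner_Integration.integral_cong refl) (simp add: N_def left_diff_distrib distrib_right sum.distrib sum_subtractf)
  then show ?thesis using conv lap I by simp
qed

text \<open>Ladyzhenskaya's inequality for each component of \<open>\<theta> v\<close>. The gradient
  of that product gives \<open>Z\<close>, with \<open>128 = 2 * 8^2\<close>; the 9 is one 3 from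
  squaring a sum of three terms and another from adding three components.\<close>

lemma local_L4_bound:
  assumes \<theta>: "cutoff x0 a d \<theta> \<theta>1" and d: "0 < d"
    and E4: "E4 = (\<integral>x. indicator (cball x0 a) x * (e x)\<^sup>2 \<partial>lborel)"
    and Z: "Z = 128 / d\<^sup>2 * M\<^sup>2 + 2 * (\<integral>x. indicator (cball x0 (a + d)) x * D x \<partial>lborel)"
  shows "E4 \<le> 9 * M * sqrt Z ^ 3"
proof -
  have \<theta>': "C1_dir (ax j) \<theta> (\<theta>1 j)" "cts_cpt \<theta>" "cts_cpt (\<theta>1 j)" for j
    using \<theta> cutoff_cts_cpt[OF \<theta>] by (auto simp: cutoff_def)
  let ?u = "\<lambda>i x. \<theta> x * v i x" and ?u1 = "\<lambda>i j x. \<theta>1 j x * v i x + \<theta> x * v1 i j x"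
  have u: "C1_dir (ax j) (?u i) (?u1 i j)" for i j by (intro C1_dir_mult \<theta>' v)
  have uc: "cts_cpt (?u i)" for i by (intro cts_cpt_mult_right \<theta>' cont_v)
  have u1c: "cts_cpt (?u1 i j)" for i j by (rule cts_cpt_C1_dir[OF u uc])
  have le: "(v i x)\<^sup>2 \<le> e x" for i x unfolding e_def by (rule member_le_sum) auto
  have \<theta>01: "(\<theta> x)\<^sup>2 \<le> 1" "0 \<le> \<theta> x" for x
    using \<theta> by (auto simp: cutoff_def intro!: power_le_one)
  have Dint: "integrable lborel (\<lambda>x. indicator (cball x0 (a + d)) x * D x)"
    by (rule ball_integrable[OF cont_D])
  have L: "(\<integral>x. (?u i x) ^ 4 \<partial>lborel) \<le> M * sqrt Z ^ 3" for i
  proof -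
    have "(\<integral>x. (?u i x)\<^sup>2 \<partial>lborel) \<le> (\<integral>x. e x \<partial>lborel)"
    proof (rule integral_mono[OF _ L2_e(1)])
      show "integrable lborel (\<lambda>x. (?u i x)\<^sup>2)" by (intro cts_cpt_integrable cts_cpt_power uc) simp
      fix x
      have "(?u i x)\<^sup>2 \<le> 1 * e x"
        unfolding power_mult_distrib by (intro mult_mono \<theta>01 le) auto
      then show "(?u i x)\<^sup>2 \<le> e x" by simp
    qed
    also have "\<dots> \<le> M\<^sup>2" by (rule L2_e)
    finally have A: "sqrt (\<integral>x. (?u i x)\<^sup>2 \<partial>lborel) \<le> M" using M by (intro real_le_lsqrt) auto
    have "(\<Sum>j\<in>UNIV. \<integral>x. (?u1 i j x)\<^sup>2 \<partial>lborel) = (\<integral>x. (\<Sum>j\<in>UNIV. (?u1 i j x)\<^sup>2) \<partial>lborel)"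
      by (rule Bochner_Integration.integral_sum[symmetric]) (intro cts_cpt_integrable cts_cpt_power u1c, simp)
    also have "\<dots> \<le> (\<integral>x. 2 * (8 / d)\<^sup>2 * e x + 2 * (indicator (cball x0 (a + d)) x * D x) \<partial>lborel)"
    proof (rule integral_mono)
      show "integrable lborel (\<lambda>x. \<Sum>j\<in>UNIV. (?u1 i j x)\<^sup>2)" by (intro cts_cpt_integrable cts_cpt_sum cts_cpt_power u1c) simp
      show "integrable lborel (\<lambda>x. 2 * (8 / d)\<^sup>2 * e x + 2 * (indicator (cball x0 (a + d)) x * D x))"
        by (intro Bochner_Integration.integrable_add integrable_mult_right L2_e Dint)
      fix x
      have "(\<Sum>j\<in>UNIV. (?u1 i j x)\<^sup>2) \<le> (\<Sum>j\<in>UNIV. 2 * ((\<theta>1 j x)\<^sup>2 * (v i x)\<^sup>2) + 2 * ((\<theta> x)\<^sup>2 * (v1 i j x)\<^sup>2))"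
      proof (rule sum_mono)
        fix j
        show "(?u1 i j x)\<^sup>2 \<le> 2 * ((\<theta>1 j x)\<^sup>2 * (v i x)\<^sup>2) + 2 * ((\<theta> x)\<^sup>2 * (v1 i j x)\<^sup>2)"
          using zero_le_power2[of "\<theta>1 j x * v i x - \<theta> x * v1 i j x"] by (simp add: power2_eq_square algebra_simps)
      qed
      also have "\<dots> = 2 * ((\<Sum>j\<in>UNIV. (\<theta>1 j x)\<^sup>2) * (v i x)\<^sup>2) + 2 * ((\<theta> x)\<^sup>2 * (\<Sum>j\<in>UNIV. (v1 i j x)\<^sup>2))"
        by (simp add: sum.distrib sum_distrib_left sum_distrib_right)
      also have "\<dots> \<le> 2 * ((8 / d)\<^sup>2 * e x) + 2 * (indicator (cball x0 (a + d)) x * D x)"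
      proof (intro add_mono mult_left_mono)
        show "(\<Sum>j\<in>UNIV. (\<theta>1 j x)\<^sup>2) * (v i x)\<^sup>2 \<le> (8 / d)\<^sup>2 * e x"
          using \<theta> le by (intro mult_mono) (auto simp: cutoff_def)
        have "(\<theta> x)\<^sup>2 \<le> indicator (cball x0 (a + d)) x"
        proof (cases "x \<in> cball x0 (a + d)")
          case False
          then have "\<theta> x = 0" using \<theta> by (auto simp: cutoff_def dist_norm norm_minus_commute)
          then show ?thesis by simp
        qed (use \<theta>01 in simp)
        moreover have "(\<Sum>j\<in>UNIV. (v1 i j x)\<^sup>2) \<le> D x"
          unfolding D_def by (rule member_le_sum[of i UNIV "\<lambda>i. \<Sum>j\<in>UNIV. (v1 i j x)\<^sup>2"]) (auto intro: sum_nonneg)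
        ultimately show "(\<theta> x)\<^sup>2 * (\<Sum>j\<in>UNIV. (v1 i j x)\<^sup>2) \<le> indicator (cball x0 (a + d)) x * D x"
          by (intro mult_mono) (auto intro: sum_nonneg)
      qed auto
      finally show "(\<Sum>j\<in>UNIV. (?u1 i j x)\<^sup>2) \<le> 2 * (8 / d)\<^sup>2 * e x + 2 * (indicator (cball x0 (a + d)) x * D x)"
        by (simp only: mult.assoc)
    qed
    also have "\<dots> = 2 * (8 / d)\<^sup>2 * (\<integral>x. e x \<partial>lborel) + 2 * (\<integral>x. indicator (cball x0 (a + d)) x * D x \<partial>lborel)"
      using L2_e Dint by simp
    also have "\<dots> \<le> 2 * (8 / d)\<^sup>2 * M\<^sup>2 + 2 * (\<integral>x. indicator (cball x0 (a + d)) x * D x \<partial>lborel)"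
      using L2_e by (intro add_right_mono mult_left_mono) auto
    also have "\<dots> = Z" by (simp add: Z power_divide)
    finally have B: "sqrt (\<Sum>j\<in>UNIV. \<integral>x. (?u1 i j x)\<^sup>2 \<partial>lborel) \<le> sqrt Z" by (rule real_sqrt_le_mono)
    have "(\<integral>x. (?u i x) ^ 4 \<partial>lborel) \<le> sqrt (\<integral>x. (?u i x)\<^sup>2 \<partial>lborel) * sqrt (\<Sum>j\<in>UNIV. \<integral>x. (?u1 i j x)\<^sup>2 \<partial>lborel) ^ 3"
      by (rule Ladyzhenskaya[OF u uc])
    also have "\<dots> \<le> M * sqrt Z ^ 3"
      using A B M by (intro mult_mono power_mono) (auto intro!: sum_nonneg integral_nonneg_AE)
    finally show ?thesis .
  qed
  have "E4 \<le> (\<integral>x. 3 * (\<Sum>i\<in>UNIV. (?u i x) ^ 4) \<partial>lborel)"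
    unfolding E4
  proof (rule integral_mono)
    show "integrable lborel (\<lambda>x. indicator (cball x0 a) x * (e x)\<^sup>2)"
      by (intro ball_integrable continuous_intros cont_e)
    show "integrable lborel (\<lambda>x. 3 * (\<Sum>i\<in>UNIV. (?u i x) ^ 4))"
      by (intro cts_cpt_integrable cts_cpt_cmult cts_cpt_sum cts_cpt_power uc) simp
    fix x
    show "indicator (cball x0 a) x * (e x)\<^sup>2 \<le> 3 * (\<Sum>i\<in>UNIV. (?u i x) ^ 4)"
    proof (cases "x \<in> cball x0 a")
      case True
      then have "\<theta> x = 1" using \<theta> by (auto simp: cutoff_def dist_norm norm_minus_commute)
      moreover have "(e x)\<^sup>2 \<le> (\<Sum>i\<in>(UNIV::3 set). 1\<^sup>2) * (\<Sum>i\<in>UNIV. ((v i x)\<^sup>2)\<^sup>2)"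
        unfolding e_def using Cauchy_Schwarz_ineq_sum[of "\<lambda>_. 1" "\<lambda>i. (v i x)\<^sup>2" UNIV] by simp
      ultimately show ?thesis using True by (simp flip: power_mult)
    qed (auto intro!: sum_nonneg)
  qed
  also have "\<dots> = 3 * (\<Sum>i\<in>UNIV. \<integral>x. (?u i x) ^ 4 \<partial>lborel)"
    by (subst Bochner_Integration.integral_mult_right_zero, subst Bochner_Integration.integral_sum)
       (intro cts_cpt_integrable cts_cpt_power uc, simp_all)
  also have "\<dots> \<le> 3 * (\<Sum>i\<in>(UNIV::3 set). M * sqrt Z ^ 3)"
    by (intro mult_left_mono sum_mono L) simp
  finally show ?thesis by simp
qed

end

section \<open>The limit of vanishing mollification, the inequality at a fixed time and the far
  flux\<close>

context slice_energy
begin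

lemma tendsto_test_bump:
  assumes "cts_cpt \<eta>"
  shows "((\<lambda>\<epsilon>. \<integral>x. (\<Sum>i\<in>UNIV. N i x * conv (bump \<epsilon>) (\<lambda>x. \<eta> x * v i x) x) \<partial>lborel) \<longlongrightarrow>
    (\<integral>x. (\<Sum>i\<in>UNIV. N i x * (\<eta> x * v i x)) \<partial>lborel)) (at_right 0)"
proof -
  have gc: "cts_cpt (\<lambda>x. \<eta> x * v i x)" for i by (intro cts_cpt_mult_right assms cont_v)
  have "((\<lambda>\<epsilon>. \<Sum>i\<in>UNIV. \<integral>x. N i x * conv (bump \<epsilon>) (\<lambda>x. \<eta> x * v i x) x \<partial>lborel) \<longlongrightarrow>
    (\<Sum>i\<in>UNIV. \<integral>x. N i x * (\<eta> x * v i x) \<partial>lborel)) (at_right 0)"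
    by (intro tendsto_sum tendsto_integral_conv_approx cts_cpt_bump bump_nonneg integral_bump bump_supp gc cont_N)
  also have "(\<Sum>i\<in>UNIV. \<integral>x. N i x * (\<eta> x * v i x) \<partial>lborel) = (\<integral>x. (\<Sum>i\<in>UNIV. N i x * (\<eta> x * v i x)) \<partial>lborel)"
    by (rule Bochner_Integration.integral_sum[symmetric]) (intro cts_cpt_integrable cts_cpt_mult_left cont_N gc)
  finally show ?thesis
  proof (rule Lim_transform_eventually)
    show "\<forall>\<^sub>F \<epsilon> in at_right 0. (\<Sum>i\<in>UNIV. \<integral>x. N i x * conv (bump \<epsilon>) (\<lambda>x. \<eta> x * v i x) x \<partial>lborel) =
      (\<integral>x. (\<Sum>i\<in>UNIV. N i x * conv (bump \<epsilon>) (\<lambda>x. \<eta> x * v i x) x) \<partial>lborel)"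
      using eventually_at_right_less[of "0::real"]
    proof eventually_elim
      case (elim \<epsilon>)
      show ?case
        by (rule Bochner_Integration.integral_sum[symmetric])
          (intro cts_cpt_integrable cts_cpt_mult_left cont_N cts_cpt_conv cts_cpt_bump elim gc)
    qed
  qed
qed

text \<open>The radius grows three times by \<open>d\<close>: for the support of \<eta>, for the gap
  to the far field, and for the cutoff in \<open>local_L4_bound\<close>. The \<open>1/16\<close> is
  \<open>1/32\<close> from the viscous cross term and \<open>1/32\<close> from Young's inequality.
  The terms in \<open>sqrt E4\<close> add up to \<open>20 = 4 + 16\<close>, from the energy flux and
  the near part of the nonlocal term.\<close>

lemma slice_inequality:
  assumes d: "0 < d" and \<eta>: "cutoff x0 \<rho> d \<eta> \<eta>1" and L: "0 < L" and \<rho>: "0 \<le> \<rho>"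
  shows "(\<integral>x. (\<Sum>i\<in>UNIV. w i x * (\<eta> x * v i x)) \<partial>lborel) + (\<integral>x. \<eta> x * D x \<partial>lborel) \<le>
    (\<integral>x. (\<Sum>i\<in>UNIV. N i x * conv (bump L) (\<lambda>x. \<eta> x * v i x) x) \<partial>lborel)
    + (\<integral>x. (\<Sum>i\<in>UNIV. f i x * (\<eta> x * v i x)) \<partial>lborel)
    + 1 / 16 * (\<integral>x. indicator (cball x0 (\<rho> + 3 * d)) x * D x \<partial>lborel)
    + slice_const * (M ^ 2 / d ^ 2 + M ^ 6 / d ^ 4)"
proof -
  obtain \<theta> \<theta>1 where \<theta>: "cutoff x0 (\<rho> + 2 * d) d \<theta> \<theta>1"
    using cutoff_exists[of "\<rho> + 2 * d" d x0] d \<rho> by auto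
  define E4 where "E4 = (\<integral>x. indicator (cball x0 (\<rho> + 2 * d)) x * (e x)\<^sup>2 \<partial>lborel)"
  define D' where "D' = (\<integral>x. indicator (cball x0 (\<rho> + 3 * d)) x * D x \<partial>lborel)"
  have D'0: "0 \<le> D'" unfolding D'_def by (rule integral_nonneg_AE) (simp add: D_nonneg)
  have E40: "0 \<le> E4" unfolding E4_def by (rule integral_nonneg_AE) simp
  define h where "h = (\<lambda>x. \<Sum>j\<in>UNIV. \<eta>1 j x * v j x)"
  have \<eta>': "C1_dir (ax j) \<eta> (\<eta>1 j)" "cts_cpt \<eta>" "cts_cpt (\<eta>1 j)" for j
    using \<eta> cutoff_cts_cpt[OF \<eta>] by (auto simp: cutoff_def)
  have hc: "cts_cpt h" unfolding h_def by (intro cts_cpt_sum cts_cpt_mult_right \<eta>' cont_v)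
  have hM: "sqrt (\<integral>x. (h x)\<^sup>2 \<partial>lborel) \<le> 8 / d * M"
    unfolding h_def by (rule cutoff_grad_L2[OF \<eta> d])
  define FC where "FC = (2 * sqrt E4 + 3 * far_const / (d * sqrt d) * M\<^sup>2) * (8 / d * M)"
  have test: "(\<integral>x. (\<Sum>i\<in>UNIV. N i x * (\<eta> x * v i x)) \<partial>lborel) \<le>
      (\<integral>x. (\<Sum>i\<in>UNIV. N i x * conv (bump L) (\<lambda>x. \<eta> x * v i x) x) \<partial>lborel) + FC"
  proof (rule tendsto_upperbound[OF tendsto_test_bump[OF \<eta>'(2)]])
    show "\<forall>\<^sub>F \<epsilon> in at_right 0. (\<integral>x. (\<Sum>i\<in>UNIV. N i x * conv (bump \<epsilon>) (\<lambda>x. \<eta> x * v i x) x) \<partial>lborel) \<le>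
      (\<integral>x. (\<Sum>i\<in>UNIV. N i x * conv (bump L) (\<lambda>x. \<eta> x * v i x) x) \<partial>lborel) + FC"
      using eventually_at_right_less[of "0::real"] eventually_at_right_real[OF L]
    proof eventually_elim
      case (elim \<epsilon>)
      then have \<epsilon>: "0 < \<epsilon>" "\<epsilon> \<le> L" by auto
      show ?case
        unfolding test_identity[OF \<epsilon> \<eta>'(1,2) h_def] FC_def
        by (intro add_left_mono nonlocal_bound[OF \<epsilon> d \<eta> h_def E4_def])
    qed
  qed simp
  have conv: "(\<integral>x. 1 / 2 * (h x * e x) \<partial>lborel) \<le> 4 / d * M * sqrt E4"
  proof -
    let ?i = "indicator (cball x0 (\<rho> + 2 * d)) :: real^3 \<Rightarrow> real"
    have mB: "(\<lambda>x. ?i x * e x) \<in> borel_measurable lborel"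
      by (rule borel_measurable_integrable[OF ball_integrable[OF cont_e]])
    have mh: "h \<in> borel_measurable lborel" using continuous_on_UNIV_measurable[OF cts_cpt_continuous[OF hc]] by simp
    have hi: "h x * e x = h x * (?i x * e x)" for x
    proof (cases "x \<in> cball x0 (\<rho> + 2 * d)")
      case False
      then have "h x = 0" using \<eta> d by (auto simp: h_def cutoff_def dist_norm norm_minus_commute)
      then show ?thesis by simp
    qed simp
    have e2: "(?i x * e x)\<^sup>2 = ?i x * (e x)\<^sup>2" for x by (auto simp: indicator_def)
    have I: "integrable lborel (\<lambda>x. (?i x * e x)\<^sup>2)"
      unfolding e2 by (intro ball_integrable continuous_intros cont_e)
    have "\<bar>\<integral>x. h x * (?i x * e x) \<partial>lborel\<bar> \<le> sqrt (\<integral>x. (h x)\<^sup>2 \<partial>lborel) * sqrt (\<integral>x. (?i x * e x)\<^sup>2 \<partial>lborel)"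
      by (rule Cauchy_Schwarz_integral_abs[OF mh mB _ I]) (intro cts_cpt_integrable cts_cpt_power hc, simp)
    also have "\<dots> \<le> 8 / d * M * sqrt E4"
      unfolding e2 E4_def[symmetric] using E40 by (intro mult_right_mono hM) simp
    finally show ?thesis unfolding hi by simp
  qed
  have visc: "- (\<integral>x. (\<Sum>i\<in>UNIV. \<Sum>j\<in>UNIV. v1 i j x * (\<eta>1 j x * v i x)) \<partial>lborel) \<le> 1 / 32 * D' + 512 / d\<^sup>2 * M\<^sup>2"
  proof -
    let ?i = "indicator (cball x0 (\<rho> + 3 * d)) :: real^3 \<Rightarrow> real"
    have I: "integrable lborel (\<lambda>x. 1 / 32 * (?i x * D x) + 512 / d\<^sup>2 * e x)"
      by (intro Bochner_Integration.integrable_add integrable_mult_right L2_e ball_integrable cont_D)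
    have pt: "- (\<Sum>i\<in>UNIV. \<Sum>j\<in>UNIV. v1 i j x * (\<eta>1 j x * v i x)) \<le> 1 / 32 * (?i x * D x) + 512 / d\<^sup>2 * e x" for x
    proof (cases "x \<in> cball x0 (\<rho> + 3 * d)")
      case False
      then have "\<eta>1 j x = 0" for j using \<eta> d by (auto simp: cutoff_def dist_norm norm_minus_commute)
      then show ?thesis using D_nonneg e_nonneg by simp
    next
      case True
      have "- (\<Sum>i\<in>UNIV. \<Sum>j\<in>UNIV. v1 i j x * (\<eta>1 j x * v i x)) = (\<Sum>i\<in>UNIV. \<Sum>j\<in>UNIV. - (v1 i j x * (\<eta>1 j x * v i x)))"
        by (simp add: sum_negf)
      also have "\<dots> \<le> (\<Sum>i\<in>UNIV. \<Sum>j\<in>UNIV. 1 / 32 * (v1 i j x)\<^sup>2 + 8 * ((\<eta>1 j x)\<^sup>2 * (v i x)\<^sup>2))"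
      proof (intro sum_mono)
        fix i j
        show "- (v1 i j x * (\<eta>1 j x * v i x)) \<le> 1 / 32 * (v1 i j x)\<^sup>2 + 8 * ((\<eta>1 j x)\<^sup>2 * (v i x)\<^sup>2)"
          using zero_le_power2[of "v1 i j x + 16 * (\<eta>1 j x * v i x)"] by (simp add: power2_eq_square algebra_simps)
      qed
      also have "\<dots> = 1 / 32 * D x + 8 * ((\<Sum>j\<in>UNIV. (\<eta>1 j x)\<^sup>2) * e x)"
        unfolding D_def e_def sum_product by (subst (2) sum.swap) (simp add: sum.distrib sum_distrib_left)
      also have "\<dots> \<le> 1 / 32 * D x + 8 * ((8 / d)\<^sup>2 * e x)"
        using \<eta> e_nonneg by (intro add_left_mono mult_left_mono mult_right_mono) (auto simp: cutoff_def)
      also have "\<dots> = 1 / 32 * (?i x * D x) + 512 / d\<^sup>2 * e x"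
        using True by (simp add: power_divide)
      finally show ?thesis .
    qed
    have "- (\<integral>x. (\<Sum>i\<in>UNIV. \<Sum>j\<in>UNIV. v1 i j x * (\<eta>1 j x * v i x)) \<partial>lborel) = (\<integral>x. - (\<Sum>i\<in>UNIV. \<Sum>j\<in>UNIV. v1 i j x * (\<eta>1 j x * v i x)) \<partial>lborel)"
      by simp
    also have "\<dots> \<le> (\<integral>x. 1 / 32 * (?i x * D x) + 512 / d\<^sup>2 * e x \<partial>lborel)"
      by (rule integral_mono[OF _ I pt])
        (intro cts_cpt_integrable cts_cpt_minus cts_cpt_sum cts_cpt_mult_left cts_cpt_mult_right cont_v cont_v1 \<eta>')
    also have "\<dots> = 1 / 32 * D' + 512 / d\<^sup>2 * (\<integral>x. e x \<partial>lborel)"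
      unfolding D'_def using ball_integrable[OF cont_D] L2_e by simp
    also have "\<dots> \<le> 1 / 32 * D' + 512 / d\<^sup>2 * M\<^sup>2"
      using L2_e by (intro add_left_mono mult_left_mono) auto
    finally show ?thesis .
  qed
  define Z where "Z = 128 / d\<^sup>2 * M\<^sup>2 + 2 * D'"
  have Z: "0 \<le> Z" using D'0 by (simp add: Z_def)
  \<comment> \<open>The fourth root makes the bound read
    \<open>sqrt E4 \<le> 3 * sqrt M * z ^ 3\<close>, and Young's inequality trades
    \<open>z ^ 3\<close> for \<open>z ^ 4 = Z\<close>. Its weight \<open>1/64\<close> leaves
    \<open>2/64 = 1/32\<close> of \<open>D'\<close>.\<close>
  define z where "z = sqrt (sqrt Z)"
  have zz: "sqrt Z = z * z" using Z by (simp add: z_def)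
  have "z ^ 4 = sqrt Z * sqrt Z" by (simp add: zz power4_eq_xxxx mult.assoc)
  then have z: "0 \<le> z" "z ^ 4 = Z" using Z by (simp_all add: z_def)
  have sE4: "sqrt E4 \<le> 3 * sqrt M * z ^ 3"
  proof (rule real_le_lsqrt)
    have "E4 \<le> 9 * M * sqrt Z ^ 3"
      using local_L4_bound[OF \<theta> d E4_def, of Z] by (simp add: Z_def D'_def algebra_simps)
    also have "\<dots> = (3 * sqrt M * z ^ 3)\<^sup>2"
      unfolding zz using M by (simp add: power_mult_distrib power2_eq_square eval_nat_numeral)
    finally show "E4 \<le> (3 * sqrt M * z ^ 3)\<^sup>2" .
  qed (use z M in auto)
  have main: "20 / d * M * sqrt E4 \<le> 1 / 32 * D' + 2 * (M ^ 2 / d ^ 2) + 60 ^ 4 * 64 ^ 3 * (M ^ 6 / d ^ 4)"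
  proof -
    let ?c = "60 * M * sqrt M / d"
    have "20 / d * M * sqrt E4 \<le> 20 / d * M * (3 * sqrt M * z ^ 3)"
      using sE4 M d by (intro mult_left_mono) auto
    also have "\<dots> = z ^ 3 * ?c" by simp
    also have "\<dots> \<le> 1 / 64 * z ^ 4 + ?c ^ 4 / (1 / 64) ^ 3"
      using z M d by (intro young_3_4) auto
    also have "?c ^ 4 = 60 ^ 4 * (M ^ 6 / d ^ 4)"
    proof -
      have "sqrt M ^ 4 = M\<^sup>2" using M by (simp add: power4_eq_xxxx power2_eq_square mult.assoc[symmetric])
      then have "(60 * M * sqrt M) ^ 4 = 60 ^ 4 * (M ^ 4 * M ^ 2)" by (simp only: power_mult_distrib mult.assoc)
      then show ?thesis by (simp add: power_divide flip: power_add)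
    qed
    also have "1 / 64 * z ^ 4 = 1 / 32 * D' + 2 * (M ^ 2 / d ^ 2)" by (simp add: z Z_def)
    finally show ?thesis by (simp add: power_divide)
  qed
  have far: "3 * far_const / (d * sqrt d) * M\<^sup>2 * (8 / d * M) \<le> 24 * far_const * (M ^ 2 / d ^ 2 + M ^ 6 / d ^ 4)"
  proof -
    have sd: "sqrt d ^ 4 = d\<^sup>2" "0 < sqrt d" using d by (auto simp: power4_eq_xxxx power2_eq_square mult.assoc[symmetric])
    \<comment> \<open>The far field has size \<open>M^3 / d^(5/2)\<close>; this step bounds it by
      the sum of the two error terms \<open>M^2 / d^2\<close> and \<open>M^6 / d^4\<close>.\<close>
    have "M / sqrt d \<le> 1 + (M / sqrt d) ^ 4"
      using M d by (intro le_1_plus_power4) auto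
    then have "M\<^sup>2 / d\<^sup>2 * (M / sqrt d) \<le> M\<^sup>2 / d\<^sup>2 * (1 + M ^ 4 / d\<^sup>2)"
      by (intro mult_left_mono) (auto simp: power_divide sd)
    also have "\<dots> = M ^ 2 / d ^ 2 + M ^ (2 + 4) / d ^ (2 + 2)" by (simp only: distrib_left power_add) simp
    finally have "24 * far_const * (M\<^sup>2 / d\<^sup>2 * (M / sqrt d)) \<le> 24 * far_const * (M ^ 2 / d ^ 2 + M ^ 6 / d ^ 4)"
      using far_const_nonneg by (intro mult_left_mono) auto
    moreover have "3 * far_const / (d * sqrt d) * M\<^sup>2 * (8 / d * M) = 24 * far_const * (M\<^sup>2 / d\<^sup>2 * (M / sqrt d))"
      by (simp add: power2_eq_square mult_ac)
    ultimately show ?thesis by simp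
  qed
  have FC: "FC = 16 / d * M * sqrt E4 + 3 * far_const / (d * sqrt d) * M\<^sup>2 * (8 / d * M)"
    by (simp only: FC_def distrib_right) simp
  have "4 / d * M * sqrt E4 + 16 / d * M * sqrt E4 = 20 / d * M * sqrt E4"
    by (simp add: add_divide_distrib[symmetric])
  moreover have "512 / d\<^sup>2 * M\<^sup>2 = 512 * (M ^ 2 / d ^ 2)" by simp
  moreover have "0 \<le> M ^ 2 / d ^ 2" "0 \<le> M ^ 6 / d ^ 4" "0 \<le> 60 ^ 4 * 64 ^ 3 * (M ^ 2 / d ^ 2)" by auto
  moreover have "slice_const * (M ^ 2 / d ^ 2 + M ^ 6 / d ^ 4) =
      514 * (M ^ 2 / d ^ 2) + 514 * (M ^ 6 / d ^ 4) + 60 ^ 4 * 64 ^ 3 * (M ^ 2 / d ^ 2) + 60 ^ 4 * 64 ^ 3 * (M ^ 6 / d ^ 4)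
      + 24 * far_const * (M ^ 2 / d ^ 2 + M ^ 6 / d ^ 4)"
    by (simp only: slice_const_def distrib_left distrib_right)
  moreover have "wI + dI \<le> tI + fI + 1 / 16 * D' + S"
    if "Y4 + Y16 = Y20" "V = 512 * P" "0 \<le> P" "0 \<le> Q" "0 \<le> P'" "S = 514 * P + 514 * Q + P' + Q' + F"
      "wI + dI = nI + cI - vI + fI" "nI \<le> tI + FC" "cI \<le> Y4" "- vI \<le> 1 / 32 * D' + V"
      "Y20 \<le> 1 / 32 * D' + 2 * P + Q'" "X \<le> F" "FC = Y16 + X"
    for wI dI tI fI S Y4 Y16 Y20 V P Q P' Q' F nI cI vI X :: real
    using that by linarith
  ultimately show ?thesis
    using local_energy_identity[OF \<eta>'(1,2)] test conv visc main far FC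
    unfolding D'_def[symmetric] fun_cong[OF h_def, symmetric] by blast
qed

text \<open>For \<open>K\<close> of order \<open>L^-3\<close> and a radius of order \<open>L\<close>
  the right-hand side is of order \<open>L^(-3/2)\<close>: the decay that removes the large-scale
  bump.\<close>

lemma integral_abs_mult_ball:
  fixes g \<psi> :: "real^3 \<Rightarrow> real"
  assumes g: "continuous_on UNIV g" "integrable lborel (\<lambda>x. (g x)\<^sup>2)" "(\<integral>x. (g x)\<^sup>2 \<partial>lborel) \<le> M\<^sup>2" "0 \<le> M"
    and \<psi>: "cts_cpt \<psi>" "\<And>x. \<bar>\<psi> x\<bar> \<le> K" "\<And>x. a < norm (x - c) \<Longrightarrow> \<psi> x = 0" "0 \<le> a"
  shows "\<bar>\<integral>x. g x * \<psi> x \<partial>lborel\<bar> \<le> M * (K * sqrt (measure lborel (cball c a)))"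
proof -
  have K: "0 \<le> K" using \<psi>(2)[of 0] by linarith
  have [measurable]: "g \<in> borel_measurable borel" "\<psi> \<in> borel_measurable borel"
    using g(1) cts_cpt_continuous[OF \<psi>(1)] by measurable
  have fin: "integrable lborel (\<lambda>x. K\<^sup>2 * indicator (cball c a) x)"
    by (intro integrable_mult_right integrable_real_indicator) (auto simp: emeasure_lborel_cball_finite simp flip: infinity_ennreal_def)
  have "(\<integral>x. (\<psi> x)\<^sup>2 \<partial>lborel) \<le> (\<integral>x. K\<^sup>2 * indicator (cball c a) x \<partial>lborel)"
  proof (rule integral_mono[OF _ fin])
    show "integrable lborel (\<lambda>x. (\<psi> x)\<^sup>2)" by (intro cts_cpt_integrable cts_cpt_power \<psi>) simp
    show "(\<psi> x)\<^sup>2 \<le> K\<^sup>2 * indicator (cball c a) x" for x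
    proof (cases "x \<in> cball c a")
      case True
      then show ?thesis using power_mono[OF \<psi>(2)[of x], of 2] by simp
    next
      case False
      then show ?thesis using \<psi>(3)[of x] by (simp add: dist_norm norm_minus_commute)
    qed
  qed
  also have "\<dots> = K\<^sup>2 * measure lborel (cball c a)" by simp
  finally have "sqrt (\<integral>x. (\<psi> x)\<^sup>2 \<partial>lborel) \<le> sqrt (K\<^sup>2 * measure lborel (cball c a))" by (rule real_sqrt_le_mono)
  then have 1: "sqrt (\<integral>x. (\<psi> x)\<^sup>2 \<partial>lborel) \<le> K * sqrt (measure lborel (cball c a))" using K by (simp add: real_sqrt_mult)
  have 2: "sqrt (\<integral>x. (g x)\<^sup>2 \<partial>lborel) \<le> M" using g by (intro real_le_lsqrt) auto
  have "\<bar>\<integral>x. g x * \<psi> x \<partial>lborel\<bar> \<le> sqrt (\<integral>x. (g x)\<^sup>2 \<partial>lborel) * sqrt (\<integral>x. (\<psi> x)\<^sup>2 \<partial>lborel)"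
    by (rule Cauchy_Schwarz_integral_abs[OF _ _ g(2)]) (measurable, intro cts_cpt_integrable cts_cpt_power \<psi>, simp)
  also have "\<dots> \<le> M * (K * sqrt (measure lborel (cball c a)))"
    using 1 2 g(4) by (intro mult_mono) (auto intro!: integral_nonneg_AE)
  finally show ?thesis .
qed

lemma v_square: "integrable lborel (\<lambda>x. (v i x)\<^sup>2)" "(\<integral>x. (v i x)\<^sup>2 \<partial>lborel) \<le> M\<^sup>2"
proof -
  have le: "(v i x)\<^sup>2 \<le> e x" for x unfolding e_def by (rule member_le_sum) auto
  show I: "integrable lborel (\<lambda>x. (v i x)\<^sup>2)"
    by (rule Bochner_Integration.integrable_bound[OF L2_e(1)])
       (use le e_nonneg continuous_on_UNIV_measurable[OF cont_v] in auto)
  show "(\<integral>x. (v i x)\<^sup>2 \<partial>lborel) \<le> M\<^sup>2"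
    using integral_mono[OF I L2_e(1) le] L2_e(2) by linarith
qed

lemmas v_mult_ball = integral_abs_mult_ball[OF cont_v v_square M]

text \<open>With all derivatives on \<open>\<phi>\<close>, only \<open>M\<close> and the bound
  \<open>K\<close> enter: \<open>3 * K * M\<^sup>2\<close> from the nine products
  \<open>v i * v j\<close>, and nine viscous terms. The pairings with \<open>w\<close> and
  \<open>f\<close>, which \<open>M\<close> does not control at a fixed time, are kept.\<close>

lemma test_flux_bound:
  assumes \<phi>: "\<And>i j. C1_dir (ax j) (\<phi> i) (\<phi>1 i j)" "\<And>i. cts_cpt (\<phi> i)" "\<And>i j. C1_dir (ax j) (\<phi>1 i j) (\<phi>2 i j)"
    and K: "\<And>i j x. \<bar>\<phi>1 i j x\<bar> \<le> K" "\<And>i j x. \<bar>\<phi>2 i j x\<bar> \<le> K"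
    and a: "\<And>i j x. a < norm (x - c) \<Longrightarrow> \<phi>2 i j x = 0" "0 \<le> a"
  shows "(\<integral>x. (\<Sum>i\<in>UNIV. N i x * \<phi> i x) \<partial>lborel) \<le>
    (\<integral>x. (\<Sum>i\<in>UNIV. w i x * \<phi> i x) \<partial>lborel) - (\<integral>x. (\<Sum>i\<in>UNIV. f i x * \<phi> i x) \<partial>lborel)
    + 3 * K * M\<^sup>2 + 9 * (M * (K * sqrt (measure lborel (cball c a))))"
proof -
  have K0: "0 \<le> K" using K(1)[of 1 1 0] by linarith
  have c1: "cts_cpt (\<phi>1 i j)" for i j by (rule cts_cpt_C1_dir[OF \<phi>(1,2)])
  have c2: "cts_cpt (\<phi>2 i j)" for i j by (rule cts_cpt_C1_dir[OF \<phi>(3) c1])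
  have "- (\<integral>x. (\<Sum>i\<in>UNIV. \<Sum>j\<in>UNIV. v i x * v j x * \<phi>1 i j x) \<partial>lborel) = (\<integral>x. - (\<Sum>i\<in>UNIV. \<Sum>j\<in>UNIV. v i x * v j x * \<phi>1 i j x) \<partial>lborel)"
    by simp
  also have "\<dots> \<le> (\<integral>x. 3 * K * e x \<partial>lborel)"
  proof (rule integral_mono)
    show "integrable lborel (\<lambda>x. - (\<Sum>i\<in>UNIV. \<Sum>j\<in>UNIV. v i x * v j x * \<phi>1 i j x))"
      by (intro cts_cpt_integrable cts_cpt_minus cts_cpt_sum cts_cpt_mult_left continuous_intros cont_v c1)
    show "integrable lborel (\<lambda>x. 3 * K * e x)" by (intro integrable_mult_right L2_e)
    fix x
    have "- (\<Sum>i\<in>UNIV. \<Sum>j\<in>UNIV. v i x * v j x * \<phi>1 i j x) = (\<Sum>i\<in>UNIV. \<Sum>j\<in>UNIV. - (v i x * v j x * \<phi>1 i j x))"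
      by (simp add: sum_negf)
    also have "\<dots> \<le> (\<Sum>i\<in>UNIV. \<Sum>j\<in>UNIV. K / 2 * ((v i x)\<^sup>2 + (v j x)\<^sup>2))"
    proof (intro sum_mono)
      fix i j
      have "\<bar>v i x * v j x * \<phi>1 i j x\<bar> \<le> \<bar>v i x * v j x\<bar> * K"
        using K(1) by (simp add: abs_mult mult_left_mono)
      moreover have "\<bar>v i x * v j x\<bar> * K \<le> ((v i x)\<^sup>2 + (v j x)\<^sup>2) / 2 * K"
        using sum_squares_bound[of "\<bar>v i x\<bar>" "\<bar>v j x\<bar>"] K0 by (intro mult_right_mono) (auto simp: abs_mult)
      ultimately show "- (v i x * v j x * \<phi>1 i j x) \<le> K / 2 * ((v i x)\<^sup>2 + (v j x)\<^sup>2)" by (simp add: mult.commute)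
    qed
    also have "\<dots> = 3 * K * e x"
    proof -
      have "(\<Sum>i\<in>UNIV. \<Sum>j\<in>UNIV. (v i x)\<^sup>2 + (v j x)\<^sup>2) = 6 * e x"
        by (simp add: e_def sum.distrib sum_distrib_left)
      then show ?thesis by (simp only: sum_distrib_left[symmetric])
    qed
    finally show "- (\<Sum>i\<in>UNIV. \<Sum>j\<in>UNIV. v i x * v j x * \<phi>1 i j x) \<le> 3 * K * e x" .
  qed
  also have "\<dots> \<le> 3 * K * M\<^sup>2" using L2_e K0 by (simp add: mult_left_mono)
  finally have 1: "- (\<integral>x. (\<Sum>i\<in>UNIV. \<Sum>j\<in>UNIV. v i x * v j x * \<phi>1 i j x) \<partial>lborel) \<le> 3 * K * M\<^sup>2" .
  have "(\<integral>x. (\<Sum>i\<in>UNIV. \<Sum>j\<in>UNIV. v i x * \<phi>2 i j x) \<partial>lborel) = (\<Sum>i\<in>UNIV. \<Sum>j\<in>UNIV. \<integral>x. v i x * \<phi>2 i j x \<partial>lborel)"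
  proof -
    have "integrable lborel (\<lambda>x. v i x * \<phi>2 i j x)" for i j by (intro cts_cpt_integrable cts_cpt_mult_left cont_v c2)
    then show ?thesis by simp
  qed
  moreover have "- (\<integral>x. v i x * \<phi>2 i j x \<partial>lborel) \<le> M * (K * sqrt (measure lborel (cball c a)))" for i j
    using v_mult_ball[where i = i and c = c, OF c2[of i j] K(2) a] by linarith
  then have "(\<Sum>i\<in>UNIV. \<Sum>j\<in>UNIV. - (\<integral>x. v i x * \<phi>2 i j x \<partial>lborel)) \<le> (\<Sum>i\<in>(UNIV::3 set). \<Sum>j\<in>(UNIV::3 set). M * (K * sqrt (measure lborel (cball c a))))"
    by (intro sum_mono)
  ultimately have 2: "- (\<integral>x. (\<Sum>i\<in>UNIV. \<Sum>j\<in>UNIV. v i x * \<phi>2 i j x) \<partial>lborel) \<le> 9 * (M * (K * sqrt (measure lborel (cball c a))))"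
    by (simp add: sum_negf)
  show ?thesis
    using 1 2 test_split[of \<phi>, OF \<phi>(2)] convection_by_parts[of \<phi>, OF \<phi>(1,2)] viscosity_by_parts[of \<phi>, OF \<phi>] by linarith
qed

end

section \<open>Almost smooth solutions\<close>

lemma C1_dir_component:
  fixes g :: "real^3 \<Rightarrow> real^3"
  assumes "\<And>x. g differentiable (at x)" "continuous_on UNIV (pd j g)"
  shows "C1_dir (ax j) (\<lambda>x. g x $ i) (\<lambda>x. pd j g x $ i)"
proof (rule C1_dirI)
  show "((\<lambda>x. g x $ i) has_derivative (\<lambda>h. frechet_derivative g (at x) h $ i)) (at x)" for x
    using assms(1)[of x] by (auto simp: frechet_derivative_works intro: bounded_linear.has_derivative[OF bounded_linear_vec_nth])
  show "continuous_on UNIV (\<lambda>x. pd j g x $ i)"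
    by (intro continuous_intros assms(2))
qed (simp add: pd_def)

lemma C1_dir_scalar:
  fixes g :: "real^3 \<Rightarrow> real"
  assumes "\<And>x. g differentiable (at x)" "continuous_on UNIV (pd j g)"
  shows "C1_dir (ax j) g (pd j g)"
  by (rule C1_dirI[where D = "\<lambda>x. frechet_derivative g (at x)"])
     (use assms in \<open>auto simp: pd_def frechet_derivative_works[symmetric]\<close>)

section \<open>The components of a solution and their regularity\<close>

locale nse =
  fixes u :: "real \<Rightarrow> real^3 \<Rightarrow> real^3" and p :: "real \<Rightarrow> real^3 \<Rightarrow> real"
    and u0 :: "real^3 \<Rightarrow> real^3" and f :: "real \<Rightarrow> real^3 \<Rightarrow> real^3" and T :: real
  assumes sol: "finite_energy_almost_smooth_solution u p u0 f T"
    and div_f0: "t \<in> {0..T} \<Longrightarrow> div3 (f t) x = 0"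
begin

definition U :: "real \<Rightarrow> 3 \<Rightarrow> real^3 \<Rightarrow> real" where "U t i x = u t x $ i"
definition U1 :: "real \<Rightarrow> 3 \<Rightarrow> 3 \<Rightarrow> real^3 \<Rightarrow> real" where "U1 t i j x = pd j (u t) x $ i"
definition U2 :: "real \<Rightarrow> 3 \<Rightarrow> 3 \<Rightarrow> real^3 \<Rightarrow> real" where "U2 t i j x = pd j (pd j (u t)) x $ i"
definition W :: "real \<Rightarrow> 3 \<Rightarrow> real^3 \<Rightarrow> real" where "W t i x = dt_on {0..T} u t x $ i"
definition F :: "real \<Rightarrow> 3 \<Rightarrow> real^3 \<Rightarrow> real" where "F t i x = f t x $ i"
definition P1 :: "real \<Rightarrow> 3 \<Rightarrow> real^3 \<Rightarrow> real" where "P1 t i x = pd i (p t) x"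

lemma T_pos: "0 < T"
  using sol by (simp add: finite_energy_almost_smooth_solution_def)

lemma u_space:
  "t \<in> {0..T} \<Longrightarrow> pds js (u t) differentiable (at x)"
  "continuous_on ({0..T} \<times> UNIV) (\<lambda>(t, x). pds js (u t) x)"
  using sol unfolding finite_energy_almost_smooth_solution_def space_derivs_cont_def by blast+

lemma p_space:
  "t \<in> {0..T} \<Longrightarrow> pds js (p t) differentiable (at x)"
  "continuous_on ({0..T} \<times> UNIV) (\<lambda>(t, x). pds js (p t) x)"
  using sol unfolding finite_energy_almost_smooth_solution_def space_derivs_cont_def by blast+

lemma u_time:
  "t \<in> {0..T} \<Longrightarrow> (\<lambda>s. u s x) differentiable (at t within {0..T})"
  "continuous_on ({0..T} \<times> UNIV) (\<lambda>(t, x). dt_on {0..T} u t x)"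
proof -
  have "(\<forall>t\<in>{0..T}. \<forall>x. (\<lambda>s. pds [] (u s) x) differentiable (at t within {0..T})) \<and>
     continuous_on ({0..T} \<times> UNIV) (\<lambda>(t, x). dt_on {0..T} (\<lambda>s. pds [] (u s)) t x)"
    using sol unfolding finite_energy_almost_smooth_solution_def time_space_derivs_cont_def by blast
  then show "t \<in> {0..T} \<Longrightarrow> (\<lambda>s. u s x) differentiable (at t within {0..T})"
    "continuous_on ({0..T} \<times> UNIV) (\<lambda>(t, x). dt_on {0..T} u t x)"
    by (simp_all add: pds_def)
qed

lemma cont_U: "continuous_on ({0..T} \<times> UNIV) (\<lambda>(t, x). U t i x)"
  using continuous_on_component[OF u_space(2)[of "[]"], of i] by (simp add: pds_def U_def case_prod_beta)

lemma cont_U1: "continuous_on ({0..T} \<times> UNIV) (\<lambda>(t, x). U1 t i j x)"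
  using continuous_on_component[OF u_space(2)[of "[j]"], of i] by (simp add: pds_def U1_def case_prod_beta)

lemma cont_W: "continuous_on ({0..T} \<times> UNIV) (\<lambda>(t, x). W t i x)"
  using continuous_on_component[OF u_time(2), of i] by (simp add: W_def case_prod_beta)

lemma cont_f: "continuous_on ({0..T} \<times> UNIV) (\<lambda>(t, x). f t x)"
proof -
  have "Ck_on 0 ({0..T} \<times> UNIV) (\<lambda>(t, x). f t x)"
    using sol unfolding finite_energy_almost_smooth_solution_def smooth_on_def by blast
  then show ?thesis by simp
qed

lemma cont_F: "continuous_on ({0..T} \<times> UNIV) (\<lambda>(t, x). F t i x)"
  using continuous_on_component[OF cont_f, of i] by (simp add: F_def case_prod_beta)

lemma DERIV_U:
  assumes "t \<in> {0..T}"
  shows "((\<lambda>s. U s i x) has_real_derivative W t i x) (at t within {0..T})"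
proof -
  have "((\<lambda>s. u s x) has_vector_derivative dt_on {0..T} u t x) (at t within {0..T})"
    using u_time(1)[OF assms] unfolding dt_on_def by (simp add: vector_derivative_works)
  then have "((\<lambda>s. u s x $ i) has_vector_derivative dt_on {0..T} u t x $ i) (at t within {0..T})"
    by (rule bounded_linear.has_vector_derivative[OF bounded_linear_vec_nth])
  then show ?thesis by (simp add: U_def W_def has_real_derivative_iff_has_vector_derivative)
qed

lemma C1_U: "t \<in> {0..T} \<Longrightarrow> C1_dir (ax j) (U t i) (U1 t i j)"
  unfolding U_def[abs_def] U1_def[abs_def]
  by (rule C1_dir_component)
     (use u_space(1)[of t "[]"] continuous_on_section[OF u_space(2)[of "[j]"]] in \<open>auto simp: pds_def\<close>)

lemma C1_U1: "t \<in> {0..T} \<Longrightarrow> C1_dir (ax j) (U1 t i j) (U2 t i j)"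
  unfolding U1_def[abs_def] U2_def[abs_def]
  by (rule C1_dir_component)
     (use u_space(1)[of t "[j]"] continuous_on_section[OF u_space(2)[of "[j, j]"]] in \<open>auto simp: pds_def\<close>)

lemma C1_p: "t \<in> {0..T} \<Longrightarrow> C1_dir (ax i) (p t) (P1 t i)"
  unfolding P1_def[abs_def]
  by (rule C1_dir_scalar)
     (use p_space(1)[of t "[]"] continuous_on_section[OF p_space(2)[of "[i]"]] in \<open>auto simp: pds_def\<close>)

lemma div_U: "t \<in> {0..T} \<Longrightarrow> (\<Sum>i\<in>UNIV. U1 t i i x) = 0"
  using sol unfolding finite_energy_almost_smooth_solution_def U1_def div3_def by blast

text \<open>Smoothness of the force is given jointly in time and space, within the closed slab. The
  section at time \<open>t\<close> lies in the slab, so composition with the map from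
  \<open>x\<close> to \<open>(t, x)\<close> yields full derivatives in space, also at the boundary
  times.\<close>

lemma C1_F:
  assumes t: "t \<in> {0..T}"
  shows "C1_dir (ax j) (F t i) (\<lambda>x. pd j (f t) x $ i)"
proof -
  let ?S = "{0..T} \<times> (UNIV :: (real^3) set)"
  have "Ck_on (Suc 0) ?S (\<lambda>(t, x). f t x)"
    using sol unfolding finite_energy_almost_smooth_solution_def smooth_on_def by blast
  then obtain g' where g': "\<And>z. z \<in> ?S \<Longrightarrow> ((\<lambda>(t, x). f t x) has_derivative g' z) (at z within ?S)"
    and c: "\<And>v. continuous_on ?S (\<lambda>z. g' z v)"
    by auto
  have D: "(f t has_derivative (\<lambda>h. g' (t, x) (0, h))) (at x)" for x
  proof -
    have "((\<lambda>x. (t, x)) has_derivative (\<lambda>h. (0, h))) (at x)"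
      by (auto intro!: derivative_eq_intros)
    moreover have "((\<lambda>(t, x). f t x) has_derivative g' (t, x)) (at (t, x) within range (Pair t))"
      by (rule has_derivative_subset[OF g']) (use t in auto)
    ultimately have "((\<lambda>x. (\<lambda>(t, x). f t x) (t, x)) has_derivative (\<lambda>h. g' (t, x) (0, h))) (at x within UNIV)"
      by (rule has_derivative_in_compose)
    then show ?thesis by simp
  qed
  then have pd: "pd j (f t) x = g' (t, x) (0, axis j 1)" for j x
    unfolding pd_def using frechet_derivative_at by metis
  have "continuous_on UNIV (\<lambda>x. g' (t, x) (0, axis j 1))"
    by (rule continuous_on_compose2[OF c]) (use t in \<open>auto intro!: continuous_intros\<close>)
  then have "continuous_on UNIV (pd j (f t))" by (simp add: pd[abs_def])
  moreover have "f t differentiable (at x)" for x using D by (auto simp: differentiable_def)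
  ultimately show ?thesis unfolding F_def[abs_def] by (intro C1_dir_component)
qed

lemma weak_div_free:
  assumes g: "\<And>i. C1_dir (ax i) (g i) (g1 i)" "\<And>x. (\<Sum>i\<in>UNIV. g1 i x) = 0"
    and \<psi>: "\<And>i. C1_dir (ax i) \<psi> (\<psi>' i)" "cts_cpt \<psi>"
  shows "(\<integral>x. (\<Sum>i\<in>UNIV. g i x * \<psi>' i x) \<partial>lborel) = 0"
proof -
  have "(\<integral>x. (\<Sum>i\<in>UNIV. g1 i x * \<psi> x + g i x * \<psi>' i x) \<partial>lborel) = 0"
    by (rule integral_divergence[of "\<lambda>i x. g i x * \<psi> x"])
       (intro C1_dir_mult g \<psi> cts_cpt_mult_left C1_dir_continuous(1)[OF g(1)])+
  then show ?thesis by (simp add: sum.distrib sum_distrib_right[symmetric] g(2))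
qed

text \<open>The pairing of \<open>u\<close> with a gradient vanishes at all times; hence so does its
  time derivative, taken under the integral, and this is the pairing of \<open>W\<close>. No
  exchange of the time derivative with the divergence occurs. At 0 and \<open>T\<close> derivatives
  are one-sided, and their uniqueness rests on \<open>0 < T\<close>.\<close>

lemma weak_div_W:
  assumes \<psi>: "\<And>i. C1_dir (ax i) \<psi> (\<psi>' i)" "cts_cpt \<psi>" and t: "t \<in> {0..T}"
  shows "(\<integral>x. (\<Sum>i\<in>UNIV. W t i x * \<psi>' i x) \<partial>lborel) = 0"
proof -
  have \<psi>c: "cts_cpt (\<psi>' i)" for i by (rule cts_cpt_C1_dir[OF \<psi>])
  have "cts_cpt (\<lambda>x. \<Sum>i\<in>UNIV. \<bar>\<psi>' i x\<bar>)" by (intro cts_cpt_sum cts_cpt_abs \<psi>c)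
  then obtain r where r: "\<And>x. r < norm x \<Longrightarrow> (\<Sum>i\<in>UNIV. \<bar>\<psi>' i x\<bar>) = 0" by (auto simp: cts_cpt_def)
  have r': "\<psi>' i x = 0" if "r < norm x" for i x
    using r[OF that] sum_nonneg_eq_0_iff[of UNIV "\<lambda>i. \<bar>\<psi>' i x\<bar>"] by simp
  have "((\<lambda>s. \<integral>x. (\<Sum>i\<in>UNIV. U s i x * \<psi>' i x) \<partial>lborel) has_real_derivative
      (\<integral>x. (\<Sum>i\<in>UNIV. W t i x * \<psi>' i x) \<partial>lborel)) (at t within {0..T})"
  proof (rule has_derivative_integral_supp[where r = r])
    show "((\<lambda>s. \<Sum>i\<in>UNIV. U s i x * \<psi>' i x) has_real_derivative (\<Sum>i\<in>UNIV. W s i x * \<psi>' i x)) (at s within {0..T})"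
      if "s \<in> {0..T}" for s x
      by (intro DERIV_sum DERIV_cmult_right DERIV_U that)
    show "continuous_on ({0..T} \<times> UNIV) (\<lambda>(s, x). \<Sum>i\<in>UNIV. W s i x * \<psi>' i x)"
      unfolding case_prod_beta
      by (intro continuous_intros cont_W[unfolded case_prod_beta] continuous_on_compose2[OF cts_cpt_continuous[OF \<psi>c]]) auto
    show "continuous_on UNIV (\<lambda>x. \<Sum>i\<in>UNIV. U s i x * \<psi>' i x)" if "s \<in> {0..T}" for s
      by (intro continuous_intros cts_cpt_continuous[OF \<psi>c] C1_dir_continuous(1)[OF C1_U[OF that]])
  qed (use r' t in auto)
  moreover have "((\<lambda>s. \<integral>x. (\<Sum>i\<in>UNIV. U s i x * \<psi>' i x) \<partial>lborel) has_real_derivative 0) (at t within {0..T})"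
  proof (rule has_field_derivative_transform_within[OF DERIV_const zero_less_one t])
    show "0 = (\<integral>x. (\<Sum>i\<in>UNIV. U s i x * \<psi>' i x) \<partial>lborel)" if "s \<in> {0..T}" for s
      by (rule weak_div_free[symmetric]) (use C1_U[OF that] div_U[OF that] \<psi> in auto)
  qed
  ultimately show ?thesis
    using vector_derivative_unique_within_closed_interval[of 0 T t] T_pos t
    by (simp add: has_real_derivative_iff_has_vector_derivative)
qed

lemma slice_at:
  assumes t: "t \<in> {0..T}"
  shows "slice (U t) (U1 t) (U2 t) (W t) (F t) (p t) (P1 t)"
proof
  show "(\<integral>x. (\<Sum>i\<in>UNIV. F t i x * \<psi>' i x) \<partial>lborel) = 0"
    if "\<And>i. C1_dir (ax i) \<psi> (\<psi>' i)" "cts_cpt \<psi>" for \<psi> \<psi>'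
    by (rule weak_div_free[OF C1_F[OF t] _ that]) (use div_f0[OF t] in \<open>simp add: div3_def\<close>)
  show "(\<integral>x. (\<Sum>i\<in>UNIV. W t i x * \<psi>' i x) \<partial>lborel) = 0"
    if "\<And>i. C1_dir (ax i) \<psi> (\<psi>' i)" "cts_cpt \<psi>" for \<psi> \<psi>'
    by (rule weak_div_W[OF that t])
  show "W t i x + (\<Sum>j\<in>UNIV. U t j x * U1 t i j x) = (\<Sum>j\<in>UNIV. U2 t i j x) - P1 t i x + F t i x" for i x
  proof -
    have "dt_on {0..T} u t x + convect (u t) (u t) x = laplacian (u t) x - grad (p t) x + f t x"
      using sol t unfolding finite_energy_almost_smooth_solution_def by blast
    from arg_cong[OF this, of "\<lambda>v. v $ i"] show ?thesis
      by (simp add: W_def U_def U1_def U2_def P1_def F_def convect_def laplacian_def grad_def)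
  qed
qed (use C1_U[OF t] C1_U1[OF t] C1_p[OF t] div_U[OF t] C1_dir_continuous(1)[OF C1_F[OF t]]
    continuous_on_section[OF cont_W t] in auto)

end

section \<open>Integration in time\<close>

lemma continuous_on_time_mult:
  assumes "continuous_on UNIV \<phi>" "continuous_on (S \<times> UNIV) (\<lambda>(t, x). g t x)"
  shows "continuous_on (S \<times> UNIV) (\<lambda>(t, x). \<phi> x * g t x :: real)"
  using assms(2) unfolding case_prod_beta
  by (intro continuous_intros continuous_on_compose2[OF assms(1)]) auto

lemma continuous_on_time_integral:
  fixes g :: "real \<Rightarrow> 'a::euclidean_space \<Rightarrow> real"
  assumes "cts_cpt \<phi>" "continuous_on (S \<times> UNIV) (\<lambda>(t, x). g t x)"
  shows "continuous_on S (\<lambda>t. \<integral>x. \<phi> x * g t x \<partial>lborel)"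
proof -
  obtain r where r: "\<And>x. r < norm x \<Longrightarrow> \<phi> x = 0" using assms(1) by (auto simp: cts_cpt_def)
  show ?thesis
    by (rule continuous_on_integral_supp[OF continuous_on_time_mult[OF cts_cpt_continuous[OF assms(1)] assms(2)], of r]) (use r in auto)
qed

lemma uniform_L1_bound:
  fixes g :: "real \<Rightarrow> 'a::euclidean_space \<Rightarrow> real"
  assumes "cts_cpt \<phi>" "continuous_on (S \<times> UNIV) (\<lambda>(t, x). g t x)" "compact S"
  obtains A where "0 \<le> A" "\<And>t. t \<in> S \<Longrightarrow> (\<integral>x. \<bar>\<phi> x * g t x\<bar> \<partial>lborel) \<le> A"
proof -
  have "continuous_on (S \<times> UNIV) (\<lambda>(t, x). \<bar>g t x\<bar>)"
    using assms(2) unfolding case_prod_beta by (intro continuous_intros)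
  then have "continuous_on S (\<lambda>t. \<integral>x. \<bar>\<phi> x\<bar> * \<bar>g t x\<bar> \<partial>lborel)"
    by (intro continuous_on_time_integral cts_cpt_abs assms)
  then have "bounded ((\<lambda>t. \<integral>x. \<bar>\<phi> x\<bar> * \<bar>g t x\<bar> \<partial>lborel) ` S)"
    using assms(3) by (intro compact_imp_bounded compact_continuous_image)
  then obtain A where "\<And>t. t \<in> S \<Longrightarrow> \<bar>\<integral>x. \<bar>\<phi> x\<bar> * \<bar>g t x\<bar> \<partial>lborel\<bar> \<le> A"
    by (auto simp: bounded_iff)
  then show thesis
    by (intro that[of "max 0 A"]) (auto simp: abs_mult le_max_iff_disj dest: abs_le_D1)
qed

lemma continuous_on_time_conv:
  fixes g :: "real \<Rightarrow> 'a::euclidean_space \<Rightarrow> real"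
  assumes "continuous_on UNIV b" "cts_cpt \<phi>" "continuous_on (S \<times> UNIV) (\<lambda>(t, x). g t x)"
  shows "continuous_on (S \<times> UNIV) (\<lambda>(t, x). conv b (\<lambda>y. \<phi> y * g t y) x)"
proof -
  obtain r where r: "\<And>x. r < norm x \<Longrightarrow> \<phi> x = 0" using assms(2) by (auto simp: cts_cpt_def)
  note c = cts_cpt_continuous[OF assms(2)]
  have "continuous_on (S \<times> UNIV) (\<lambda>z. \<integral>y. b (snd z - y) * (\<phi> y * g (fst z) y) \<partial>lborel)"
  proof (rule continuous_on_integral_supp[where r = r])
    have g: "continuous_on ((S \<times> UNIV) \<times> UNIV) (\<lambda>w. (\<lambda>(t, x). g t x) (fst (fst w), snd w))"
      by (rule continuous_on_compose2[OF assms(3)]) (auto intro!: continuous_intros)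
    show "continuous_on ((S \<times> UNIV) \<times> UNIV) (\<lambda>(z, y). b (snd z - y) * (\<phi> y * g (fst z) y))"
      unfolding case_prod_beta using g
      by (intro continuous_intros continuous_on_compose2[OF assms(1)] continuous_on_compose2[OF c]) auto
  qed (use r in auto)
  then show ?thesis by (simp add: conv_def case_prod_beta)
qed

lemma DERIV_time_conv:
  fixes g g' :: "real \<Rightarrow> 'a::euclidean_space \<Rightarrow> real"
  assumes b: "continuous_on UNIV b" and \<phi>: "cts_cpt \<phi>"
    and g: "\<And>s x. s \<in> S \<Longrightarrow> ((\<lambda>s. g s x) has_real_derivative g' s x) (at s within S)"
    "continuous_on (S \<times> UNIV) (\<lambda>(t, x). g t x)" "continuous_on (S \<times> UNIV) (\<lambda>(t, x). g' t x)"
    and S: "convex S" "t \<in> S"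
  shows "((\<lambda>s. conv b (\<lambda>y. \<phi> y * g s y) x) has_real_derivative conv b (\<lambda>y. \<phi> y * g' t y) x) (at t within S)"
proof -
  obtain r where r: "\<And>x. r < norm x \<Longrightarrow> \<phi> x = 0" using \<phi> by (auto simp: cts_cpt_def)
  note c = cts_cpt_continuous[OF \<phi>]
  show ?thesis
    unfolding conv_def
  proof (rule has_derivative_integral_supp[where r = r])
    show "((\<lambda>s. b (x - y) * (\<phi> y * g s y)) has_real_derivative b (x - y) * (\<phi> y * g' s y)) (at s within S)"
      if "s \<in> S" for s y by (intro DERIV_cmult g that)
    show "continuous_on (S \<times> UNIV) (\<lambda>(s, y). b (x - y) * (\<phi> y * g' s y))"
      using g(3) unfolding case_prod_beta
      by (intro continuous_intros continuous_on_compose2[OF b] continuous_on_compose2[OF c]) auto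
    show "continuous_on UNIV (\<lambda>y. b (x - y) * (\<phi> y * g s y))" if "s \<in> S" for s
      by (intro continuous_intros c continuous_on_compose2[OF b] continuous_on_section[OF g(2) that]) auto
  qed (use r S in auto)
qed

lemma conv_supp_ball:
  assumes "\<And>z. L < norm z \<Longrightarrow> b z = 0" "\<And>y. a < norm (y - c) \<Longrightarrow> g y = 0" "L + a < norm (x - c)"
  shows "conv b g x = 0"
proof -
  have *: "b (x - y) * g y = 0" for y
  proof -
    have "L < norm (x - y) \<or> a < norm (y - c)"
      using assms(3) norm_triangle_ineq[of "x - y" "y - c"] by auto
    then show ?thesis using assms(1,2) by auto
  qed
  show ?thesis by (simp only: conv_def * Bochner_Integration.integral_zero)
qed

section \<open>Norms with values in \<open>ennreal\<close>, and integrals over time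
  intervals\<close>

lemma ennreal_square_le: "a\<^sup>2 \<le> b\<^sup>2 \<Longrightarrow> a \<le> (b::ennreal)"
proof (rule ccontr)
  assume h: "a\<^sup>2 \<le> b\<^sup>2" "\<not> a \<le> b"
  then have "b < a" by simp
  then obtain y where y: "b = ennreal y" "0 \<le> y" by (cases b) auto
  show False
  proof (cases a)
    case (real x)
    then have "ennreal (x\<^sup>2) \<le> ennreal (y\<^sup>2)" using h y by (simp add: ennreal_power)
    then have "x\<^sup>2 \<le> y\<^sup>2" by (subst (asm) ennreal_le_iff) auto
    then have "x \<le> y" using y(2) by (rule power2_le_imp_le)
    then show ?thesis using h y real by (simp add: ennreal_leI)
  next
    case top
    then show ?thesis using h y by (simp add: power2_eq_square ennreal_mult_top top_unique flip: ennreal_mult)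
  qed
qed

lemma epowr_half_square: "(epowr c (1/2))\<^sup>2 = c"
proof (cases c)
  case (real r)
  have "(ennreal (r powr (1/2)))\<^sup>2 = ennreal ((r powr (1/2))\<^sup>2)" by (simp add: ennreal_power)
  also have "(r powr (1/2))\<^sup>2 = r" using real by (simp add: powr_half_sqrt)
  finally show ?thesis using real by (simp add: epowr_def)
qed (simp add: epowr_def power2_eq_square ennreal_mult_top)

lemma L2x_square: "(L2x A g)\<^sup>2 = (\<integral>\<^sup>+x\<in>A. ennreal ((norm (g x))\<^sup>2) \<partial>lborel)"
  by (simp add: L2x_def epowr_half_square)

lemma L2x_le_iff: "0 \<le> K \<Longrightarrow> L2x A g \<le> ennreal K \<longleftrightarrow> (\<integral>\<^sup>+x\<in>A. ennreal ((norm (g x))\<^sup>2) \<partial>lborel) \<le> ennreal (K\<^sup>2)"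
  unfolding L2x_square[symmetric] using ennreal_square_le[of "L2x A g" "ennreal K"]
  by (auto simp: ennreal_power[symmetric] intro!: power_mono)

lemma L2x_mono: "A \<subseteq> B \<Longrightarrow> L2x A g \<le> L2x B g"
  by (rule ennreal_square_le) (auto simp: L2x_square indicator_def intro!: nn_integral_mono)

lemma abs_integral_le_nn_integral:
  fixes h :: "real \<Rightarrow> real"
  assumes "continuous_on {a..b} h"
  shows "ennreal \<bar>integral {a..b} h\<bar> \<le> (\<integral>\<^sup>+t\<in>{a..b}. ennreal \<bar>h t\<bar> \<partial>lborel)"
proof -
  have I: "set_integrable lborel {a..b} h"
    using borel_integrable_compact[OF compact_Icc assms] by (simp add: set_integrable_def)
  then have "ennreal \<bar>integral {a..b} h\<bar> = ennreal \<bar>\<integral>t. indicator {a..b} t * h t \<partial>lborel\<bar>"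
    using set_borel_integral_eq_integral(2)[OF I] by (simp add: set_lebesgue_integral_def)
  also have "\<dots> \<le> (\<integral>\<^sup>+t. ennreal \<bar>indicator {a..b} t * h t\<bar> \<partial>lborel)"
    using integral_norm_bound_ennreal[of lborel "\<lambda>t. indicator {a..b} t * h t"] I by (simp add: set_integrable_def)
  also have "\<dots> = (\<integral>\<^sup>+t\<in>{a..b}. ennreal \<bar>h t\<bar> \<partial>lborel)"
    by (rule nn_integral_cong) (simp add: indicator_def)
  finally show ?thesis .
qed

lemma nn_integral_eq_HK:
  fixes h :: "real \<Rightarrow> real"
  assumes "continuous_on {a..b} h" "\<And>t. t \<in> {a..b} \<Longrightarrow> 0 \<le> h t"
  shows "(\<integral>\<^sup>+t\<in>{a..b}. ennreal (h t) \<partial>lborel) = ennreal (integral {a..b} h)"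
proof -
  have I: "set_integrable lborel {a..b} h"
    using borel_integrable_compact[OF compact_Icc assms(1)] by (simp add: set_integrable_def)
  have "(\<integral>\<^sup>+t\<in>{a..b}. ennreal (h t) \<partial>lborel) = (\<integral>\<^sup>+t. ennreal (indicator {a..b} t * h t) \<partial>lborel)"
    by (rule nn_integral_cong) (simp add: indicator_def)
  also have "\<dots> = ennreal (\<integral>t. indicator {a..b} t * h t \<partial>lborel)"
    using I assms(2) by (intro nn_integral_eq_integral) (auto simp: set_integrable_def indicator_def)
  also have "\<dots> = ennreal (integral {a..b} h)"
    using set_borel_integral_eq_integral(2)[OF I] by (simp add: set_lebesgue_integral_def)
  finally show ?thesis .
qed

text \<open>Continuity is known only on the slab, so the field is extended by zero in time. The
  extension is jointly measurable, which makes its integral over space measurable in time.\<close>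

lemma borel_measurable_L2x_time:
  fixes g :: "real \<Rightarrow> real^3 \<Rightarrow> 'b::euclidean_space"
  assumes "continuous_on ({0..T} \<times> UNIV) (\<lambda>(t, x). g t x)" "closed A"
  shows "(\<lambda>t. L2x A (g t) * indicator {0..T} t) \<in> borel_measurable borel"
    and "(\<lambda>t. L2x A (g t)) \<in> borel_measurable (restrict_space lborel {0..T})"
proof -
  have "(\<lambda>z. indicator ({0..T} \<times> UNIV) z *\<^sub>R (\<lambda>(t, x). g t x) z) \<in> borel_measurable borel"
    by (rule borel_measurable_continuous_on_indicator[OF _ assms(1)]) (auto intro!: borel_closed closed_Times)
  then have m [measurable]: "(\<lambda>(t, x). indicator {0..T} t *\<^sub>R g t x) \<in> borel_measurable (lborel \<Otimes>\<^sub>M lborel)"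
    by (simp add: lborel_prod case_prod_beta' indicator_times)
  have [measurable]: "A \<in> sets borel" using assms(2) by (rule borel_closed)
  have "(\<lambda>t. \<integral>\<^sup>+x. ennreal ((norm (indicator {0..T} t *\<^sub>R g t x))\<^sup>2) * indicator A x \<partial>lborel) \<in> borel_measurable lborel"
    by measurable
  then have 1: "(\<lambda>t. epowr (\<integral>\<^sup>+x. ennreal ((norm (indicator {0..T} t *\<^sub>R g t x))\<^sup>2) * indicator A x \<partial>lborel) (1/2)) \<in> borel_measurable borel"
    unfolding epowr_def by measurable
  have eq: "epowr (\<integral>\<^sup>+x. ennreal ((norm (indicator {0..T} t *\<^sub>R g t x))\<^sup>2) * indicator A x \<partial>lborel) (1/2) = L2x A (g t) * indicator {0..T} t" for t
    by (cases "t \<in> {0..T}") (simp_all add: L2x_def epowr_def)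
  show "(\<lambda>t. L2x A (g t) * indicator {0..T} t) \<in> borel_measurable borel"
    using 1 unfolding eq .
  then show "(\<lambda>t. L2x A (g t)) \<in> borel_measurable (restrict_space lborel {0..T})"
    by (subst borel_measurable_restrict_space_iff_ennreal) simp_all
qed

lemma finite_family_bound:
  fixes h :: "'i::finite \<Rightarrow> 'a \<Rightarrow> real"
  assumes "\<And>i. \<exists>A. 0 \<le> A \<and> (\<forall>t\<in>S. h i t \<le> A)"
  obtains A where "0 \<le> A" "\<And>i t. t \<in> S \<Longrightarrow> h i t \<le> A"
proof -
  obtain A where A: "\<And>i. 0 \<le> A i" "\<And>i t. t \<in> S \<Longrightarrow> h i t \<le> A i"
    using assms by metis
  show thesis
  proof (rule that[of "\<Sum>i\<in>UNIV. A i"])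
    show "h i t \<le> (\<Sum>i\<in>UNIV. A i)" if "t \<in> S" for i t
      using A(2)[OF that, of i] member_le_sum[of i UNIV A] A(1) by force
  qed (use A in \<open>auto intro: sum_nonneg\<close>)
qed

section \<open>Localised energy, dissipation and work of the force\<close>

context nse
begin

definition D :: "real \<Rightarrow> real^3 \<Rightarrow> real" where "D t x = (\<Sum>i\<in>UNIV. \<Sum>j\<in>UNIV. (U1 t i j x)\<^sup>2)"

text \<open>No factor 1/2 is included. A continuous weight in place of the indicator of a ball lets
  the later arguments integrate by parts.\<close>

definition E_loc :: "(real^3 \<Rightarrow> real) \<Rightarrow> real \<Rightarrow> real" where
  "E_loc \<phi> t = (\<integral>x. \<phi> x * (\<Sum>i\<in>UNIV. (U t i x)\<^sup>2) \<partial>lborel)"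

definition D_loc :: "(real^3 \<Rightarrow> real) \<Rightarrow> real \<Rightarrow> real" where
  "D_loc \<phi> t = (\<integral>x. \<phi> x * D t x \<partial>lborel)"

definition F_loc :: "(real^3 \<Rightarrow> real) \<Rightarrow> real \<Rightarrow> real" where
  "F_loc \<phi> t = (\<integral>x. (\<Sum>i\<in>UNIV. F t i x * (\<phi> x * U t i x)) \<partial>lborel)"

lemmas conts = cont_U[unfolded case_prod_beta] cont_U1[unfolded case_prod_beta] cont_W[unfolded case_prod_beta] cont_F[unfolded case_prod_beta]

lemma continuous_E_loc: "cts_cpt \<phi> \<Longrightarrow> continuous_on {0..T} (E_loc \<phi>)"
  unfolding E_loc_def[abs_def]
  by (rule continuous_on_time_integral, assumption) (unfold case_prod_beta, intro continuous_intros conts)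

lemma continuous_D_loc: "cts_cpt \<phi> \<Longrightarrow> continuous_on {0..T} (D_loc \<phi>)"
  unfolding D_loc_def[abs_def] D_def
  by (rule continuous_on_time_integral, assumption) (unfold case_prod_beta, intro continuous_intros conts)

lemma continuous_F_loc: "cts_cpt \<phi> \<Longrightarrow> continuous_on {0..T} (F_loc \<phi>)"
proof -
  assume \<phi>: "cts_cpt \<phi>"
  have "continuous_on {0..T} (\<lambda>t. \<integral>x. \<phi> x * (\<Sum>i\<in>UNIV. F t i x * U t i x) \<partial>lborel)"
    by (rule continuous_on_time_integral[OF \<phi>]) (unfold case_prod_beta, intro continuous_intros conts)
  then show ?thesis by (simp add: F_loc_def[abs_def] sum_distrib_left mult_ac)
qed

lemma forcing_norm_finite: "L1tL2x {0..T} UNIV f < \<infinity>"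
proof -
  have "energy u0 f T < \<infinity>"
    using sol unfolding finite_energy_almost_smooth_solution_def by blast
  then show ?thesis
    unfolding energy_def by (auto simp: less_top[symmetric] power2_eq_square ennreal_divide_eq_top_iff ennreal_mult_eq_top_iff)
qed

text \<open>The force is controlled in \<open>L^1\<close> in time and may have an infinite
  \<open>L^2\<close> norm at exceptional times. The pairing is therefore estimated in
  \<open>ennreal\<close> at each time, with a bound of the test field that is uniform in time, and
  becomes a real estimate only after integration.\<close>

lemma forcing_far:
  fixes V :: "real \<Rightarrow> 3 \<Rightarrow> real^3 \<Rightarrow> real"
  assumes V: "\<And>i. continuous_on ({0..T} \<times> UNIV) (\<lambda>(t, x). V t i x)" "\<And>t i x. t \<in> {0..T} \<Longrightarrow> \<bar>V t i x\<bar> \<le> K"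
      "\<And>t i x. t \<in> {0..T} \<Longrightarrow> a < norm (x - c) \<Longrightarrow> V t i x = 0"
    and h: "continuous_on {0..T} h" "\<And>t. t \<in> {0..T} \<Longrightarrow> h t = (\<integral>x. (\<Sum>i\<in>UNIV. F t i x * V t i x) \<partial>lborel)"
    and \<tau>: "\<tau> \<in> {0..T}"
  shows "\<bar>integral {0..\<tau>} h\<bar> \<le> 3 * (K * sqrt (measure lborel (cball c a))) * enn2real (L1tL2x {0..T} UNIV f)"
proof -
  define B where "B = K * sqrt (measure lborel (cball c a))"
  have K: "0 \<le> K" using V(2)[of 0 0 0] T_pos by fastforce
  then have B: "0 \<le> B" by (simp add: B_def)
  have pt: "ennreal \<bar>h t\<bar> \<le> ennreal (3 * B) * L2x UNIV (f t)" if t: "t \<in> {0..T}" for t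
  proof -
    have cV: "continuous_on UNIV (V t i)" and cF: "continuous_on UNIV (F t i)" for i
      using continuous_on_section[OF V(1) t] continuous_on_section[OF cont_F t] by auto
    have sc: "cts_cpt (V t i)" for i by (rule cts_cpt_ball_supp[OF cV V(3)[OF t]])
    have I: "integrable lborel (\<lambda>x. F t i x * V t i x)" for i
      by (intro cts_cpt_integrable cts_cpt_mult_left cF sc)
    have [measurable]: "V t i \<in> borel_measurable borel" "F t i \<in> borel_measurable borel" for i
      using cV cF by measurable
    have i: "ennreal \<bar>\<integral>x. F t i x * V t i x \<partial>lborel\<bar> \<le> ennreal B * L2x UNIV (f t)" for i
    proof (rule ennreal_square_le)
      have "(ennreal \<bar>\<integral>x. F t i x * V t i x \<partial>lborel\<bar>)\<^sup>2 \<le> (\<integral>\<^sup>+x. ennreal \<bar>F t i x * V t i x\<bar> \<partial>lborel)\<^sup>2"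
        using integral_norm_bound_ennreal[OF I[of i]] by (intro power_mono) auto
      also have "\<dots> = (\<integral>\<^sup>+x. ennreal \<bar>F t i x\<bar> * ennreal \<bar>V t i x\<bar> \<partial>lborel)\<^sup>2"
        by (simp add: abs_mult ennreal_mult)
      also have "\<dots> \<le> (\<integral>\<^sup>+x. ennreal \<bar>F t i x\<bar> ^ 2 \<partial>lborel) * (\<integral>\<^sup>+x. ennreal \<bar>V t i x\<bar> ^ 2 \<partial>lborel)"
        by (rule Cauchy_Schwarz_nn_integral) auto
      also have "\<dots> \<le> (L2x UNIV (f t))\<^sup>2 * (\<integral>\<^sup>+x. ennreal (K\<^sup>2) * indicator (cball c a) x \<partial>lborel)"
      proof (rule mult_mono)
        show "(\<integral>\<^sup>+x. ennreal \<bar>F t i x\<bar> ^ 2 \<partial>lborel) \<le> (L2x UNIV (f t))\<^sup>2"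
          unfolding L2x_square
        proof (rule nn_integral_mono)
          fix x
          have "\<bar>F t i x\<bar>\<^sup>2 \<le> (norm (f t x))\<^sup>2" unfolding F_def by (intro power_mono component_le_norm_cart) simp
          then show "ennreal \<bar>F t i x\<bar> ^ 2 \<le> ennreal ((norm (f t x))\<^sup>2) * indicator UNIV x"
            by (simp add: ennreal_power ennreal_leI)
        qed
        show "(\<integral>\<^sup>+x. ennreal \<bar>V t i x\<bar> ^ 2 \<partial>lborel) \<le> (\<integral>\<^sup>+x. ennreal (K\<^sup>2) * indicator (cball c a) x \<partial>lborel)"
        proof (rule nn_integral_mono)
          fix x
          show "ennreal \<bar>V t i x\<bar> ^ 2 \<le> ennreal (K\<^sup>2) * indicator (cball c a) x"
          proof (cases "x \<in> cball c a")
            case True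
            then show ?thesis using power_mono[OF V(2)[OF t, of i x], of 2] by (simp add: ennreal_power ennreal_leI)
          next
            case False
            then show ?thesis using V(3)[OF t, of x i] by (simp add: dist_norm norm_minus_commute)
          qed
        qed
      qed auto
      also have "(\<integral>\<^sup>+x. ennreal (K\<^sup>2) * indicator (cball c a) x \<partial>lborel) = ennreal (K\<^sup>2) * ennreal (measure lborel (cball c a))"
        using emeasure_lborel_cball_finite[of c a]
        by (subst nn_integral_cmult_indicator) (auto simp: emeasure_eq_ennreal_measure top.not_eq_extremum)
      also have "\<dots> = (ennreal B)\<^sup>2"
        using K by (simp add: B_def ennreal_mult[symmetric] ennreal_power power_mult_distrib)
      finally show "(ennreal \<bar>\<integral>x. F t i x * V t i x \<partial>lborel\<bar>)\<^sup>2 \<le> (ennreal B * L2x UNIV (f t))\<^sup>2"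
        by (simp add: power_mult_distrib mult.commute)
    qed
    have "\<bar>h t\<bar> \<le> (\<Sum>i\<in>UNIV. \<bar>\<integral>x. F t i x * V t i x \<partial>lborel\<bar>)"
      unfolding h(2)[OF t] using I by simp
    then have "ennreal \<bar>h t\<bar> \<le> ennreal (\<Sum>i\<in>UNIV. \<bar>\<integral>x. F t i x * V t i x \<partial>lborel\<bar>)" by (rule ennreal_leI)
    also have "\<dots> = (\<Sum>i\<in>UNIV. ennreal \<bar>\<integral>x. F t i x * V t i x \<partial>lborel\<bar>)" by simp
    also have "\<dots> \<le> (\<Sum>i\<in>(UNIV::3 set). ennreal B * L2x UNIV (f t))" by (intro sum_mono i)
    also have "\<dots> = ennreal (3 * B) * L2x UNIV (f t)" using B by (simp add: ennreal_mult mult.assoc)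
    finally show ?thesis .
  qed
  have "ennreal \<bar>integral {0..\<tau>} h\<bar> \<le> (\<integral>\<^sup>+t\<in>{0..\<tau>}. ennreal \<bar>h t\<bar> \<partial>lborel)"
    using \<tau> by (intro abs_integral_le_nn_integral continuous_on_subset[OF h(1)]) auto
  also have "\<dots> \<le> (\<integral>\<^sup>+t. ennreal (3 * B) * (L2x UNIV (f t) * indicator {0..T} t) \<partial>lborel)"
    using \<tau> pt by (intro nn_integral_mono) (auto simp: indicator_def)
  also have "\<dots> = ennreal (3 * B) * L1tL2x {0..T} UNIV f"
    unfolding L1tL2x_def using borel_measurable_L2x_time(1)[OF cont_f closed_UNIV]
    by (intro nn_integral_cmult) simp
  also have "\<dots> = ennreal (3 * B * enn2real (L1tL2x {0..T} UNIV f))"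
    using forcing_norm_finite B by (simp add: ennreal_mult)
  finally have "\<bar>integral {0..\<tau>} h\<bar> \<le> 3 * B * enn2real (L1tL2x {0..T} UNIV f)"
    by (subst (asm) ennreal_le_iff) (use B in auto)
  then show ?thesis by (simp only: B_def)
qed

end

text \<open>The bound is required at every time: the estimates at a fixed time are applied to each
  slice, and the values at 0 and \<tau> occur as boundary terms.\<close>

locale nse_energy = nse +
  fixes M :: real
  assumes M0: "0 \<le> M"
    and bound: "t \<in> {0..T} \<Longrightarrow> (\<integral>\<^sup>+x. ennreal ((norm (u t x))\<^sup>2) \<partial>lborel) \<le> ennreal (M\<^sup>2)"
begin

lemma slice_energy_at:
  assumes t: "t \<in> {0..T}"
  shows "slice_energy (U t) (U1 t) (U2 t) (W t) (F t) (p t) (P1 t) M"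
proof -
  interpret slice "U t" "U1 t" "U2 t" "W t" "F t" "p t" "P1 t" by (rule slice_at[OF t])
  have eq: "(\<Sum>i\<in>UNIV. (U t i x)\<^sup>2) = (norm (u t x))\<^sup>2" for x
    by (simp add: U_def norm_vec_sq)
  have [measurable]: "(\<lambda>x. (norm (u t x))\<^sup>2) \<in> borel_measurable borel"
    unfolding eq[symmetric] by (intro borel_measurable_continuous_onI continuous_intros cont_v)
  have "integrable lborel (\<lambda>x. (norm (u t x))\<^sup>2)"
    by (rule integrableI_bounded) (use bound[OF t] in \<open>auto intro: le_less_trans\<close>)
  moreover have "(\<integral>x. (norm (u t x))\<^sup>2 \<partial>lborel) \<le> M\<^sup>2"
    using bound[OF t] nn_integral_eq_integral[OF calculation] by simp
  ultimately show ?thesis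
    by unfold_locales (simp_all add: eq M0)
qed

text \<open>The contribution of the large-scale bump \<open>\<rho>\<^sub>L * (\<eta> u)\<close>, integrated in time, vanishes as
  \<open>L \<rightarrow> \<infinity>\<close>; only there is the time derivative moved onto the test field.\<close>

lemma energy_step:
  assumes d: "0 < d" and \<rho>: "0 \<le> \<rho>" and \<eta>: "cutoff x0 \<rho> d \<eta> \<eta>1" and \<theta>: "cutoff x0 (\<rho> + 3 * d) d' \<theta> \<theta>1"
    and \<tau>: "\<tau> \<in> {0..T}"
  shows "1 / 2 * E_loc \<eta> \<tau> + integral {0..\<tau>} (D_loc \<eta>) \<le>
    1 / 2 * E_loc \<eta> 0 + integral {0..\<tau>} (F_loc \<eta>) + 1 / 16 * integral {0..\<tau>} (D_loc \<theta>)
    + \<tau> * (slice_const * (M ^ 2 / d ^ 2 + M ^ 6 / d ^ 4))"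
proof -
  define a where "a = \<rho> + d"
  define C where "C = slice_const * (M ^ 2 / d ^ 2 + M ^ 6 / d ^ 4)"
  have a: "0 \<le> a" using d \<rho> by (simp add: a_def)
  have \<eta>': "C1_dir (ax j) \<eta> (\<eta>1 j)" "cts_cpt \<eta>" "cts_cpt (\<eta>1 j)" "a < norm (x - x0) \<Longrightarrow> \<eta> x = 0" "a < norm (x - x0) \<Longrightarrow> \<eta>1 j x = 0" for j x
    using \<eta> cutoff_cts_cpt[OF \<eta>] by (auto simp: cutoff_def a_def)
  have \<theta>': "cts_cpt \<theta>" using cutoff_cts_cpt[OF \<theta>] by auto
  let ?I = "{0..T}"
  \<comment> \<open>These bounds are uniform in time but otherwise depend on the solution and on
    \<eta>. That is harmless, since they enter only quantities that vanish as \<open>L\<close> tends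
    to infinity.\<close>
  obtain A1 where A1: "0 \<le> A1" "\<And>t i. t \<in> ?I \<Longrightarrow> (\<integral>x. \<bar>\<eta> x * U t i x\<bar> \<partial>lborel) \<le> A1"
  proof -
    have "\<exists>A. 0 \<le> A \<and> (\<forall>t\<in>?I. (\<integral>x. \<bar>\<eta> x * U t i x\<bar> \<partial>lborel) \<le> A)" for i
      by (rule uniform_L1_bound[OF \<eta>'(2) cont_U compact_Icc]) blast
    then obtain A where "0 \<le> A" "\<And>i t. t \<in> ?I \<Longrightarrow> (\<integral>x. \<bar>\<eta> x * U t i x\<bar> \<partial>lborel) \<le> A"
      using finite_family_bound[of ?I "\<lambda>i t. \<integral>x. \<bar>\<eta> x * U t i x\<bar> \<partial>lborel"] by blast
    then show thesis by (rule that)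
  qed
  obtain A2 where A2: "0 \<le> A2" "\<And>t i. t \<in> ?I \<Longrightarrow> (\<integral>x. \<bar>\<eta> x * W t i x\<bar> \<partial>lborel) \<le> A2"
  proof -
    have "\<exists>A. 0 \<le> A \<and> (\<forall>t\<in>?I. (\<integral>x. \<bar>\<eta> x * W t i x\<bar> \<partial>lborel) \<le> A)" for i
      by (rule uniform_L1_bound[OF \<eta>'(2) cont_W compact_Icc]) blast
    then obtain A where "0 \<le> A" "\<And>i t. t \<in> ?I \<Longrightarrow> (\<integral>x. \<bar>\<eta> x * W t i x\<bar> \<partial>lborel) \<le> A"
      using finite_family_bound[of ?I "\<lambda>i t. \<integral>x. \<bar>\<eta> x * W t i x\<bar> \<partial>lborel"] by blast
    then show thesis by (rule that)
  qed
  let ?g1 = "\<lambda>t i j x. \<eta>1 j x * U t i x + \<eta> x * U1 t i j x"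
  obtain A3 where A3: "0 \<le> A3" "\<And>t i j. t \<in> ?I \<Longrightarrow> (\<integral>x. \<bar>?g1 t i j x\<bar> \<partial>lborel) \<le> A3"
  proof -
    have bnd: "\<exists>A. 0 \<le> A \<and> (\<forall>t\<in>?I. (\<integral>x. \<bar>?g1 t i j x\<bar> \<partial>lborel) \<le> A)" for i j
    proof -
      obtain B1 where B1: "0 \<le> B1" "\<And>t. t \<in> ?I \<Longrightarrow> (\<integral>x. \<bar>\<eta>1 j x * U t i x\<bar> \<partial>lborel) \<le> B1"
        using uniform_L1_bound[OF \<eta>'(3) cont_U compact_Icc] by metis
      obtain B2 where B2: "0 \<le> B2" "\<And>t. t \<in> ?I \<Longrightarrow> (\<integral>x. \<bar>\<eta> x * U1 t i j x\<bar> \<partial>lborel) \<le> B2"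
        using uniform_L1_bound[OF \<eta>'(2) cont_U1 compact_Icc] by metis
      have "(\<integral>x. \<bar>?g1 t i j x\<bar> \<partial>lborel) \<le> B1 + B2" if t: "t \<in> ?I" for t
      proof -
        have c: "cts_cpt (\<lambda>x. \<eta>1 j x * U t i x)" "cts_cpt (\<lambda>x. \<eta> x * U1 t i j x)"
          by (intro cts_cpt_mult_right \<eta>' continuous_on_section[OF cont_U t] continuous_on_section[OF cont_U1 t])+
        have "(\<integral>x. \<bar>?g1 t i j x\<bar> \<partial>lborel) \<le> (\<integral>x. \<bar>\<eta>1 j x * U t i x\<bar> + \<bar>\<eta> x * U1 t i j x\<bar> \<partial>lborel)"
          by (intro integral_mono cts_cpt_integrable cts_cpt_abs cts_cpt_add c) auto
        also have "\<dots> = (\<integral>x. \<bar>\<eta>1 j x * U t i x\<bar> \<partial>lborel) + (\<integral>x. \<bar>\<eta> x * U1 t i j x\<bar> \<partial>lborel)"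
          by (intro Bochner_Integration.integral_add cts_cpt_integrable cts_cpt_abs c)
        finally show ?thesis using B1(2)[OF t] B2(2)[OF t] by linarith
      qed
      then show ?thesis using B1(1) B2(1) by (intro exI[of _ "B1 + B2"]) auto
    qed
    then obtain A where "0 \<le> A" "\<And>q t. t \<in> ?I \<Longrightarrow> (\<integral>x. \<bar>?g1 t (fst q) (snd q) x\<bar> \<partial>lborel) \<le> A"
      using finite_family_bound[of ?I "\<lambda>q t. \<integral>x. \<bar>?g1 t (fst q) (snd q) x\<bar> \<partial>lborel"] by blast
    then show thesis by (intro that[of A]) force+
  qed
  define A where "A = A1 + A2 + A3"
  have A: "0 \<le> A" "A1 \<le> A" "A2 \<le> A" "A3 \<le> A" using A1(1) A2(1) A3(1) by (auto simp: A_def)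
  \<comment> \<open>A common bound for the field mollified at scale \<open>L\<close>, its time
    derivative and its first two space derivatives. The 6 is that of \<open>bump_d_le\<close>, whose
    factor \<open>L^-4\<close> is at most \<open>L^-3\<close> for \<open>L \<ge> 1\<close>.\<close>
  define K where "K L = 6 * A / (bump_mass * L ^ 3)" for L
  define B where "B L = K L * sqrt (measure lborel (cball x0 (L + a)))" for L
  define Fn where "Fn = enn2real (L1tL2x {0..T} UNIV f)"
  \<comment> \<open>In this order: \<open>u\<close> against the mollified field at the times \<tau>
    and 0, \<open>u\<close> against its time derivative, the force, and the convective and viscous
    fluxes.\<close>
  define err where "err L = 6 * (M * B L) + T * (3 * (M * B L)) + 3 * B L * Fn + T * (3 * K L * M\<^sup>2 + 9 * (M * B L))" for L
  have Fn: "0 \<le> Fn" by (simp add: Fn_def)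
  let ?lhs = "1 / 2 * E_loc \<eta> \<tau> + integral {0..\<tau>} (D_loc \<eta>)"
  let ?rhs = "1 / 2 * E_loc \<eta> 0 + integral {0..\<tau>} (F_loc \<eta>) + 1 / 16 * integral {0..\<tau>} (D_loc \<theta>) + \<tau> * C"
  have sub: "{0..\<tau>} \<subseteq> ?I" using \<tau> by auto
  have main: "?lhs - ?rhs \<le> err L" if L: "1 \<le> L" for L
  proof -
    have L0: "0 < L" using L by simp
    have K0: "0 \<le> K L" using A bump_mass_pos L0 by (simp add: K_def)
    have B0: "0 \<le> B L" using K0 by (simp add: B_def)
    have bm: "bump_mass > 0" by (rule bump_mass_pos)
    have Kb: "1 / (L ^ 3 * bump_mass) * Y \<le> K L" "6 / (L ^ 4 * bump_mass) * Y \<le> K L" if "Y \<le> A" "0 \<le> Y" for Y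
    proof -
      have "1 / (L ^ 3 * bump_mass) * Y \<le> 6 / (L ^ 3 * bump_mass) * A"
        using that L0 bm by (intro mult_mono divide_right_mono) auto
      then show "1 / (L ^ 3 * bump_mass) * Y \<le> K L" by (simp add: K_def mult.commute)
      have "L ^ 3 \<le> L ^ 4" using L by (intro power_increasing) auto
      then have "6 / (L ^ 4 * bump_mass) * Y \<le> 6 / (L ^ 3 * bump_mass) * A"
        using that L0 bm by (intro mult_mono divide_left_mono mult_right_mono) auto
      then show "6 / (L ^ 4 * bump_mass) * Y \<le> K L" by (simp add: K_def mult.commute)
    qed
    note cb = cts_cpt_continuous[OF cts_cpt_bump[OF L0]] and cbd = cts_cpt_continuous[OF cts_cpt_bump_d[OF L0]]
    let ?V = "\<lambda>t i. conv (bump L) (\<lambda>y. \<eta> y * U t i y)"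
    let ?V1 = "\<lambda>t i j. conv (bump_d j L) (\<lambda>y. \<eta> y * U t i y)"
    let ?V2 = "\<lambda>t i j. conv (bump_d j L) (?g1 t i j)"
    let ?Vt = "\<lambda>t i. conv (bump L) (\<lambda>y. \<eta> y * W t i y)"
    have gU: "cts_cpt (\<lambda>y. \<eta> y * U t i y)" "cts_cpt (\<lambda>y. \<eta> y * W t i y)" if t: "t \<in> ?I" for t i
      by (intro cts_cpt_mult_right \<eta>' continuous_on_section[OF cont_U t] continuous_on_section[OF cont_W t])+
    have dU: "C1_dir (ax j) (\<lambda>y. \<eta> y * U t i y) (?g1 t i j)" if t: "t \<in> ?I" for t i j
      by (intro C1_dir_mult \<eta>' C1_U t)
    have gU1: "cts_cpt (?g1 t i j)" if t: "t \<in> ?I" for t i j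
      by (rule cts_cpt_C1_dir[OF dU[OF t] gU(1)[OF t]])
    have nn: "0 \<le> (\<integral>x. \<bar>g x\<bar> \<partial>lborel)" for g :: "real^3 \<Rightarrow> real" by (rule integral_nonneg_AE) simp
    have bV: "\<bar>?V t i x\<bar> \<le> K L" "\<bar>?Vt t i x\<bar> \<le> K L" "\<bar>?V1 t i j x\<bar> \<le> K L" "\<bar>?V2 t i j x\<bar> \<le> K L" if t: "t \<in> ?I" for t i j x
      by (rule order_trans[OF conv_bound[OF cb gU(1)[OF t] bump_le[OF L0]] Kb(1)[OF order_trans[OF A1(2)[OF t] A(2)] nn]]
          order_trans[OF conv_bound[OF cb gU(2)[OF t] bump_le[OF L0]] Kb(1)[OF order_trans[OF A2(2)[OF t] A(3)] nn]]
          order_trans[OF conv_bound[OF cbd gU(1)[OF t] bump_d_le[OF L0]] Kb(2)[OF order_trans[OF A1(2)[OF t] A(2)] nn]]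
          order_trans[OF conv_bound[OF cbd gU1[OF t] bump_d_le[OF L0]] Kb(2)[OF order_trans[OF A3(2)[OF t] A(4)] nn]])+
    have bdsupp: "bump_d j L z = 0" if "L < norm z" for j z
      using pos_part_radial_eq_0[OF L0 that] by (simp add: bump_d_def)
    have sV: "?V t i x = 0" "?Vt t i x = 0" "?V2 t i j x = 0" if "L + a < norm (x - x0)" for t i j x
      by (rule conv_supp_ball[where L = L and a = a and c = x0]; use bump_supp[OF L0] bdsupp \<eta>' that in simp)+
    have cV: "continuous_on (?I \<times> UNIV) (\<lambda>(t, x). ?V t i x)" "continuous_on (?I \<times> UNIV) (\<lambda>(t, x). ?Vt t i x)" for i
      by (intro continuous_on_time_conv cb \<eta>' cont_U cont_W)+
    have scV: "cts_cpt (?V t i)" "cts_cpt (?Vt t i)" if t: "t \<in> ?I" for t i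
      by (intro cts_cpt_conv cts_cpt_bump L0 gU t)+
    define Jw where "Jw t = (\<integral>x. (\<Sum>i\<in>UNIV. W t i x * ?V t i x) \<partial>lborel)" for t
    define Jf where "Jf t = (\<integral>x. (\<Sum>i\<in>UNIV. F t i x * ?V t i x) \<partial>lborel)" for t
    define R where "R t = (\<integral>x. (\<Sum>i\<in>UNIV. U t i x * ?Vt t i x) \<partial>lborel)" for t
    define P where "P t = (\<integral>x. (\<Sum>i\<in>UNIV. U t i x * ?V t i x) \<partial>lborel)" for t
    define Aw where "Aw t = (\<integral>x. (\<Sum>i\<in>UNIV. W t i x * (\<eta> x * U t i x)) \<partial>lborel)" for t
    have contJ: "continuous_on ?I (\<lambda>t. \<integral>x. (\<Sum>i\<in>UNIV. G t i x * Y t i x) \<partial>lborel)"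
      if "\<And>i. continuous_on (?I \<times> UNIV) (\<lambda>(t, x). G t i x)" "\<And>i. continuous_on (?I \<times> UNIV) (\<lambda>(t, x). Y t i x)"
        "\<And>t i x. L + a < norm (x - x0) \<Longrightarrow> Y t i x = 0" for G Y :: "real \<Rightarrow> 3 \<Rightarrow> real^3 \<Rightarrow> real"
    proof (rule continuous_on_integral_supp[where r = "L + a + norm x0"])
      show "continuous_on (?I \<times> UNIV) (\<lambda>(t, x). \<Sum>i\<in>UNIV. G t i x * Y t i x)"
        using that(1,2) unfolding case_prod_beta by (intro continuous_intros)
      show "(\<Sum>i\<in>UNIV. G t i x * Y t i x) = 0" if "L + a + norm x0 < norm x" for t x
      proof -
        have "L + a < norm (x - x0)" using that norm_triangle_sub[of x x0] by linarith
        then show ?thesis by (simp add: \<open>\<And>t i x. L + a < norm (x - x0) \<Longrightarrow> Y t i x = 0\<close>)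
      qed
    qed
    have cJw: "continuous_on ?I Jw" unfolding Jw_def[abs_def] by (intro contJ cont_W cV sV)
    have cJf: "continuous_on ?I Jf" unfolding Jf_def[abs_def] by (intro contJ cont_F cV sV)
    have cR: "continuous_on ?I R" unfolding R_def[abs_def] by (intro contJ cont_U cV sV)
    have cAw: "continuous_on ?I Aw"
      unfolding Aw_def[abs_def]
    proof (intro contJ cont_W)
      show "continuous_on (?I \<times> UNIV) (\<lambda>(t, x). \<eta> x * U t i x)" for i
        by (intro continuous_on_time_mult cts_cpt_continuous[OF \<eta>'(2)] cont_U)
      show "\<eta> x * U t i x = 0" if "L + a < norm (x - x0)" for t i x
        using that L0 by (simp add: \<eta>'(4))
    qed
    have pointwise: "Aw t + D_loc \<eta> t \<le> Jw t - Jf t + (3 * K L * M\<^sup>2 + 9 * (M * B L)) + F_loc \<eta> t + 1 / 16 * D_loc \<theta> t + C"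
      if t: "t \<in> ?I" for t
    proof -
      interpret S: slice_energy "U t" "U1 t" "U2 t" "W t" "F t" "p t" "P1 t" M by (rule slice_energy_at[OF t])
      have D: "S.D = D t" by (simp add: fun_eq_iff S.D_def D_def)
      have "(\<integral>x. indicator (cball x0 (\<rho> + 3 * d)) x * D t x \<partial>lborel) \<le> D_loc \<theta> t"
        unfolding D_loc_def D[symmetric]
      proof (intro integral_mono S.ball_integrable S.cont_D cts_cpt_integrable cts_cpt_mult_right \<theta>')
        fix x
        show "indicator (cball x0 (\<rho> + 3 * d)) x * S.D x \<le> \<theta> x * S.D x"
          using \<theta> by (intro mult_right_mono S.D_nonneg) (auto simp: indicator_def cutoff_def dist_norm norm_minus_commute)
      qed
      moreover have "(\<integral>x. (\<Sum>i\<in>UNIV. S.N i x * ?V t i x) \<partial>lborel) \<le> Jw t - Jf t + 3 * K L * M\<^sup>2 + 9 * (M * (K L * sqrt (measure lborel (cball x0 (L + a)))))"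
        unfolding Jw_def Jf_def
      proof (rule S.test_flux_bound[where ?\<phi>1.0 = "?V1 t" and ?\<phi>2.0 = "?V2 t"])
        show "C1_dir (ax j) (?V t i) (?V1 t i j)" for i j
          by (rule C1_dir_conv[OF C1_dir_bump[OF L0] gU(1)[OF t]])
        show "C1_dir (ax j) (?V1 t i j) (?V2 t i j)" for i j
          by (rule C1_dir_conv_right[OF cts_cpt_bump_d[OF L0] dU[OF t] gU(1)[OF t]])
      qed (use bV[OF t] sV scV[OF t] L0 a in auto)
      ultimately show ?thesis
        using S.slice_inequality[OF d \<eta> L0 \<rho>]
        unfolding Aw_def D_loc_def[of \<eta>] F_loc_def D C_def B_def by linarith
    qed
    have int: "h integrable_on {0..\<tau>}" if "continuous_on ?I h" for h :: "real \<Rightarrow> real"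
      by (rule integrable_continuous_real[OF continuous_on_subset[OF that sub]])
    note ints = int[OF cJw] int[OF cJf] int[OF cR] int[OF cAw] int[OF continuous_D_loc[OF \<eta>'(2)]]
      int[OF continuous_D_loc[OF \<theta>']] int[OF continuous_F_loc[OF \<eta>'(2)]]
    have "integral {0..\<tau>} (\<lambda>t. Aw t + D_loc \<eta> t) \<le> integral {0..\<tau>} (\<lambda>t. Jw t - Jf t + F_loc \<eta> t + 1 / 16 * D_loc \<theta> t
        + ((3 * K L * M\<^sup>2 + 9 * (M * B L)) + C))"
    proof (rule integral_le)
      show "(\<lambda>t. Aw t + D_loc \<eta> t) integrable_on {0..\<tau>}" by (intro integrable_add ints)
      show "(\<lambda>t. Jw t - Jf t + F_loc \<eta> t + 1 / 16 * D_loc \<theta> t + ((3 * K L * M\<^sup>2 + 9 * (M * B L)) + C)) integrable_on {0..\<tau>}"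
        by (intro int continuous_intros cJw cJf continuous_D_loc continuous_F_loc \<eta>' \<theta>')
      show "Aw t + D_loc \<eta> t \<le> Jw t - Jf t + F_loc \<eta> t + 1 / 16 * D_loc \<theta> t + ((3 * K L * M\<^sup>2 + 9 * (M * B L)) + C)"
        if "t \<in> {0..\<tau>}" for t using pointwise[of t] that sub by auto
    qed
    also have "integral {0..\<tau>} (\<lambda>t. Aw t + D_loc \<eta> t) = integral {0..\<tau>} Aw + integral {0..\<tau>} (D_loc \<eta>)"
      by (intro Henstock_Kurzweil_Integration.integral_add ints)
    also have "integral {0..\<tau>} (\<lambda>t. Jw t - Jf t + F_loc \<eta> t + 1 / 16 * D_loc \<theta> t + ((3 * K L * M\<^sup>2 + 9 * (M * B L)) + C))
      = integral {0..\<tau>} Jw - integral {0..\<tau>} Jf + integral {0..\<tau>} (F_loc \<eta>) + 1 / 16 * integral {0..\<tau>} (D_loc \<theta>)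
        + \<tau> * ((3 * K L * M\<^sup>2 + 9 * (M * B L)) + C)"
    proof (rule integral_unique)
      have "((\<lambda>t. (3 * K L * M\<^sup>2 + 9 * (M * B L)) + C) has_integral \<tau> * ((3 * K L * M\<^sup>2 + 9 * (M * B L)) + C)) {0..\<tau>}"
        using has_integral_const_real[of "(3 * K L * M\<^sup>2 + 9 * (M * B L)) + C" 0 \<tau>] \<tau> by simp
      then show "((\<lambda>t. Jw t - Jf t + F_loc \<eta> t + 1 / 16 * D_loc \<theta> t + ((3 * K L * M\<^sup>2 + 9 * (M * B L)) + C)) has_integral
         integral {0..\<tau>} Jw - integral {0..\<tau>} Jf + integral {0..\<tau>} (F_loc \<eta>) + 1 / 16 * integral {0..\<tau>} (D_loc \<theta>)
        + \<tau> * ((3 * K L * M\<^sup>2 + 9 * (M * B L)) + C)) {0..\<tau>}"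
        by (intro has_integral_add has_integral_diff has_integral_mult_right integrable_integral ints)
    qed
    finally have I1: "integral {0..\<tau>} Aw + integral {0..\<tau>} (D_loc \<eta>) \<le>
        integral {0..\<tau>} Jw - integral {0..\<tau>} Jf + integral {0..\<tau>} (F_loc \<eta>) + 1 / 16 * integral {0..\<tau>} (D_loc \<theta>)
        + \<tau> * ((3 * K L * M\<^sup>2 + 9 * (M * B L)) + C)" .
    have I2: "integral {0..\<tau>} Aw = 1 / 2 * E_loc \<eta> \<tau> - 1 / 2 * E_loc \<eta> 0"
    proof (rule integral_unique, rule fundamental_theorem_of_calculus)
      fix t assume t: "t \<in> {0..\<tau>}"
      obtain r where r: "\<And>x. r < norm x \<Longrightarrow> \<eta> x = 0" using \<eta>'(2) by (auto simp: cts_cpt_def)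
      have "((\<lambda>t. \<integral>x. \<eta> x * (\<Sum>i\<in>UNIV. (U t i x)\<^sup>2) \<partial>lborel) has_real_derivative
          (\<integral>x. 2 * (\<eta> x * (\<Sum>i\<in>UNIV. U t i x * W t i x)) \<partial>lborel)) (at t within ?I)"
      proof (rule has_derivative_integral_supp[where r = r])
        show "((\<lambda>s. \<eta> x * (\<Sum>i\<in>UNIV. (U s i x)\<^sup>2)) has_real_derivative 2 * (\<eta> x * (\<Sum>i\<in>UNIV. U s i x * W s i x))) (at s within ?I)"
          if "s \<in> ?I" for s x
        proof -
          have "((\<lambda>s. \<Sum>i\<in>UNIV. (U s i x)\<^sup>2) has_real_derivative (\<Sum>i\<in>UNIV. 2 * (W s i x * U s i x))) (at s within ?I)"
          proof (rule DERIV_sum)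
            show "((\<lambda>s. (U s i x)\<^sup>2) has_real_derivative 2 * (W s i x * U s i x)) (at s within ?I)" for i
              using DERIV_power[OF DERIV_U[OF that, of i x], of 2] by simp
          qed
          from DERIV_cmult[OF this, of "\<eta> x"]
          show ?thesis by (simp add: sum_distrib_left mult_ac)
        qed
        show "continuous_on (?I \<times> UNIV) (\<lambda>(s, x). 2 * (\<eta> x * (\<Sum>i\<in>UNIV. U s i x * W s i x)))"
          unfolding case_prod_beta
          by (intro continuous_intros conts continuous_on_compose2[OF cts_cpt_continuous[OF \<eta>'(2)]]) auto
        show "continuous_on UNIV (\<lambda>x. \<eta> x * (\<Sum>i\<in>UNIV. (U s i x)\<^sup>2))" if "s \<in> ?I" for s
          by (intro continuous_intros cts_cpt_continuous[OF \<eta>'(2)] continuous_on_section[OF cont_U that])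
      qed (use r t sub in auto)
      from DERIV_cmult[OF this, of "1 / 2"]
      moreover have "1 / 2 * (\<integral>x. 2 * (\<eta> x * (\<Sum>i\<in>UNIV. U t i x * W t i x)) \<partial>lborel) = Aw t"
        by (subst Bochner_Integration.integral_mult_right_zero) (simp add: Aw_def sum_distrib_left mult_ac)
      ultimately have "((\<lambda>t. 1 / 2 * E_loc \<eta> t) has_real_derivative Aw t) (at t within ?I)"
        by (simp only: E_loc_def)
      then show "((\<lambda>t. 1 / 2 * E_loc \<eta> t) has_vector_derivative Aw t) (at t within {0..\<tau>})"
        by (simp add: has_real_derivative_iff_has_vector_derivative has_vector_derivative_within_subset[OF _ sub])
    qed (use \<tau> in auto)
    \<comment> \<open>\<open>W\<close> has no \<open>L^2\<close> bound over all of space. The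
      product rule exchanges its pairing \<open>Jw\<close> for the boundary values of
      \<open>P\<close> and for \<open>R\<close>, in which \<open>u\<close> itself is paired and
      \<open>M\<close> applies.\<close>
    have I3: "integral {0..\<tau>} Jw + integral {0..\<tau>} R = P \<tau> - P 0"
    proof -
      have "((\<lambda>t. Jw t + R t) has_integral P \<tau> - P 0) {0..\<tau>}"
      proof (rule fundamental_theorem_of_calculus)
        fix t assume t: "t \<in> {0..\<tau>}"
        have "(P has_real_derivative (\<integral>x. (\<Sum>i\<in>UNIV. W t i x * ?V t i x + ?Vt t i x * U t i x) \<partial>lborel)) (at t within ?I)"
          unfolding P_def[abs_def]
        proof (rule has_derivative_integral_supp[where r = "L + a + norm x0"])
          show "((\<lambda>s. \<Sum>i\<in>UNIV. U s i x * ?V s i x) has_real_derivative (\<Sum>i\<in>UNIV. W s i x * ?V s i x + ?Vt s i x * U s i x)) (at s within ?I)"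
            if "s \<in> ?I" for s x
            by (intro DERIV_sum DERIV_mult DERIV_U DERIV_time_conv cb \<eta>'(2) cont_U cont_W convex_real_interval that)
          show "continuous_on (?I \<times> UNIV) (\<lambda>(s, x). \<Sum>i\<in>UNIV. W s i x * ?V s i x + ?Vt s i x * U s i x)"
            using cV unfolding case_prod_beta by (intro continuous_intros conts)
          show "continuous_on UNIV (\<lambda>x. \<Sum>i\<in>UNIV. U s i x * ?V s i x)" if "s \<in> ?I" for s
            by (intro continuous_intros continuous_on_section[OF cont_U that] cts_cpt_continuous[OF scV(1)[OF that]])
          fix s :: real and x :: "real^3" assume "L + a + norm x0 < norm x"
          then have "L + a < norm (x - x0)" using norm_triangle_sub[of x x0] by linarith
          then show "(\<Sum>i\<in>UNIV. U s i x * ?V s i x) = 0" "(\<Sum>i\<in>UNIV. W s i x * ?V s i x + ?Vt s i x * U s i x) = 0"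
            by (simp_all add: sV)
        qed (use t sub in auto)
        also have "(\<integral>x. (\<Sum>i\<in>UNIV. W t i x * ?V t i x + ?Vt t i x * U t i x) \<partial>lborel) = Jw t + R t"
        proof -
          have tI: "t \<in> ?I" using t sub by auto
          have "integrable lborel (\<lambda>x. \<Sum>i\<in>UNIV. W t i x * ?V t i x)" "integrable lborel (\<lambda>x. \<Sum>i\<in>UNIV. U t i x * ?Vt t i x)"
            by (intro cts_cpt_integrable cts_cpt_sum cts_cpt_mult_left scV tI continuous_on_section[OF cont_W tI] continuous_on_section[OF cont_U tI])+
          from Bochner_Integration.integral_add[OF this] show ?thesis
            by (simp add: Jw_def R_def sum.distrib mult.commute)
        qed
        finally show "(P has_vector_derivative Jw t + R t) (at t within {0..\<tau>})"
          by (simp add: has_real_derivative_iff_has_vector_derivative has_vector_derivative_within_subset[OF _ sub])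
      qed (use \<tau> in auto)
      then show ?thesis
        using Henstock_Kurzweil_Integration.integral_add[OF ints(1) ints(3)] by (metis integral_unique)
    qed
    have sum3: "\<bar>\<integral>x. (\<Sum>i\<in>UNIV. U t i x * Y i x) \<partial>lborel\<bar> \<le> 3 * (M * B L)"
      if t: "t \<in> ?I" and Y: "\<And>i. cts_cpt (Y i)" "\<And>i x. \<bar>Y i x\<bar> \<le> K L" "\<And>i x. L + a < norm (x - x0) \<Longrightarrow> Y i x = 0" for t Y
    proof -
      interpret S: slice_energy "U t" "U1 t" "U2 t" "W t" "F t" "p t" "P1 t" M by (rule slice_energy_at[OF t])
      have "(\<integral>x. (\<Sum>i\<in>UNIV. U t i x * Y i x) \<partial>lborel) = (\<Sum>i\<in>UNIV. \<integral>x. U t i x * Y i x \<partial>lborel)"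
        by (rule Bochner_Integration.integral_sum) (intro cts_cpt_integrable cts_cpt_mult_left S.cont_v Y)
      also have "\<bar>\<dots>\<bar> \<le> (\<Sum>i\<in>UNIV. \<bar>\<integral>x. U t i x * Y i x \<partial>lborel\<bar>)" by (rule sum_abs)
      also have "\<dots> \<le> (\<Sum>i\<in>(UNIV::3 set). M * B L)"
        unfolding B_def by (intro sum_mono S.v_mult_ball Y) (use L0 a in auto)
      finally show ?thesis by simp
    qed
    have bP: "\<bar>P t\<bar> \<le> 3 * (M * B L)" if t: "t \<in> ?I" for t
      unfolding P_def by (rule sum3[OF t]) (use scV[OF t] bV[OF t] sV in auto)
    have bR: "\<bar>R t\<bar> \<le> 3 * (M * B L)" if t: "t \<in> ?I" for t
      unfolding R_def by (rule sum3[OF t]) (use scV[OF t] bV[OF t] sV in auto)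
    have "norm (integral {0..\<tau>} R) \<le> 3 * (M * B L) * (\<tau> - 0)"
      by (rule integral_bound) (use \<tau> sub bR continuous_on_subset[OF cR sub] in auto)
    then have I4: "\<bar>integral {0..\<tau>} R\<bar> \<le> \<tau> * (3 * (M * B L))" by (simp add: mult.commute)
    have I5: "\<bar>integral {0..\<tau>} Jf\<bar> \<le> 3 * B L * Fn"
      unfolding B_def Fn_def
      by (rule forcing_far[where V = "?V"]) (use cV bV sV cJf \<tau> in \<open>auto simp: Jf_def\<close>)
    have I6: "\<tau> * (3 * K L * M\<^sup>2 + 9 * (M * B L)) \<le> T * (3 * K L * M\<^sup>2 + 9 * (M * B L))"
      "\<tau> * (3 * (M * B L)) \<le> T * (3 * (M * B L))"
      using \<tau> K0 B0 M0 by (auto intro!: mult_right_mono)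
    have "0 \<in> ?I" using T_pos by simp
    have "\<tau> * ((3 * K L * M\<^sup>2 + 9 * (M * B L)) + C) = \<tau> * (3 * K L * M\<^sup>2 + 9 * (M * B L)) + \<tau> * C"
      by (rule distrib_left)
    then show ?thesis
      unfolding err_def using I1 I2 I3 I4 I5 I6 bP[OF \<tau>] bP[OF \<open>0 \<in> ?I\<close>] by linarith
  qed
  have Kto: "(K \<longlongrightarrow> 0) at_top"
  proof -
    have "((\<lambda>L::real. 1 / L ^ 3) \<longlongrightarrow> 0) at_top" by real_asymp
    from tendsto_mult_right_zero[OF this, of "6 * A / bump_mass"] show ?thesis
      by (simp add: K_def[abs_def])
  qed
  \<comment> \<open>\<open>K\<close> decays like \<open>L^-3\<close>, while the square root of the
    volume grows only like \<open>L^(3/2)\<close>.\<close>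
  have Bto: "(B \<longlongrightarrow> 0) at_top"
  proof -
    have V: "0 < unit_ball_vol 3" by simp
    have "((\<lambda>L. 1 / L ^ 3 * sqrt (unit_ball_vol 3 * (L + a) ^ 3)) \<longlongrightarrow> 0) at_top"
      using V by real_asymp
    from tendsto_mult_right_zero[OF this, of "6 * A / bump_mass"]
    have "((\<lambda>L. 6 * A / (bump_mass * L ^ 3) * sqrt (unit_ball_vol 3 * (L + a) ^ 3)) \<longlongrightarrow> 0) at_top"
      by simp
    moreover have "\<forall>\<^sub>F L in at_top. 6 * A / (bump_mass * L ^ 3) * sqrt (unit_ball_vol 3 * (L + a) ^ 3) = B L"
      using eventually_ge_at_top[of 0]
    proof eventually_elim
      case (elim L)
      then show ?case using a by (simp add: B_def K_def content_cball)
    qed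
    ultimately show ?thesis by (rule Lim_transform_eventually)
  qed
  have "(err \<longlongrightarrow> 6 * (M * 0) + T * (3 * (M * 0)) + 3 * 0 * Fn + T * (3 * 0 * M\<^sup>2 + 9 * (M * 0))) at_top"
    unfolding err_def by (intro tendsto_intros Kto Bto)
  then have "(err \<longlongrightarrow> 0) at_top" by simp
  then have "?lhs - ?rhs \<le> 0"
  proof (rule tendsto_lowerbound)
    show "\<forall>\<^sub>F L in at_top. ?lhs - ?rhs \<le> err L"
      using eventually_ge_at_top[of 1] by eventually_elim (rule main)
  qed simp
  then show ?thesis by (simp add: C_def)
qed

end

section \<open>The local estimate\<close>

text \<open>Unrolling \<open>n\<close> steps leaves \<open>Dm / 8^n\<close>, so the a priori bound
  disappears in the limit. The coefficients 2 and 3 reproduce themselves: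
  \<open>2 / 8 + 1 \<le> 2\<close> and \<open>3 / 8 * 81 / 16 + 1 \<le> 3\<close>.\<close>

lemma iteration_bound:
  fixes D c :: "nat \<Rightarrow> real"
  assumes D: "\<And>k. D k \<le> D (Suc k) / 8 + b + c k" and c: "\<And>k. c (Suc k) \<le> 81 / 16 * c k" "\<And>k. 0 \<le> c k"
    and b: "0 \<le> b" and Dm: "\<And>k. D k \<le> Dm"
  shows "D k \<le> 2 * b + 3 * c k"
proof -
  have "D k \<le> Dm * (1 / 8) ^ n + 2 * b + 3 * c k" for n k
  proof (induction n arbitrary: k)
    case 0
    then show ?case using Dm[of k] b c(2)[of k] by simp
  next
    case (Suc n)
    have "Dm * (1 / 8) ^ Suc n = Dm * (1 / 8) ^ n / 8" by simp
    then show ?case using D[of k] c(1)[of k] c(2)[of k] b Suc[of "Suc k"] by linarith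
  qed
  moreover have "(\<lambda>n. Dm * (1 / 8) ^ n + 2 * b + 3 * c k) \<longlonglongrightarrow> Dm * 0 + 2 * b + 3 * c k"
    by (intro tendsto_intros LIMSEQ_power_zero) simp
  ultimately show ?thesis
    using LIMSEQ_le_const[of "\<lambda>n. Dm * (1 / 8) ^ n + 2 * b + 3 * c k"] by simp
qed

text \<open>In \<open>local_bounds\<close> the data enter as \<open>3 * b\<close>, at most
  \<open>6 * (a0\<^sup>2 + \<Phi>\<^sup>2)\<close>. The error enters as
  \<open>12 * (T * C 0)\<close>, and the first width \<open>r / 10\<close> contributes up to
  \<open>10^4\<close>, whence 120000.\<close>

definition loc_const :: real where "loc_const = 6 + 120000 * slice_const"

lemma slice_const_nonneg: "0 \<le> slice_const"
  using far_const_nonneg by (simp add: slice_const_def)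

context nse_energy
begin

lemma D_nonneg: "0 \<le> D t x"
  by (auto simp: D_def intro!: sum_nonneg)

lemma norm_grad_sq: "(norm (grad (u t) x))\<^sup>2 = D t x"
proof -
  have "(norm (grad (u t) x))\<^sup>2 = (\<Sum>j\<in>UNIV. (norm (pd j (u t) x))\<^sup>2)"
    by (simp add: norm_vec_def L2_set_def grad_def sum_nonneg)
  also have "\<dots> = (\<Sum>j\<in>UNIV. \<Sum>i\<in>UNIV. (U1 t i j x)\<^sup>2)" by (simp add: norm_vec_sq U1_def)
  also have "\<dots> = D t x" unfolding D_def by (rule sum.swap)
  finally show ?thesis .
qed

lemma integrable_loc:
  assumes "cts_cpt \<phi>" "t \<in> {0..T}"
  shows "integrable lborel (\<lambda>x. \<phi> x * (\<Sum>i\<in>UNIV. (U t i x)\<^sup>2))" "integrable lborel (\<lambda>x. \<phi> x * D t x)"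
    "integrable lborel (\<lambda>x. \<phi> x * (\<Sum>i\<in>UNIV. (F t i x)\<^sup>2))"
  unfolding D_def
  by (intro cts_cpt_integrable cts_cpt_mult_right assms(1) continuous_intros continuous_on_section[OF cont_U assms(2)]
      continuous_on_section[OF cont_U1 assms(2)] continuous_on_section[OF cont_F assms(2)])+

lemma loc_nonneg:
  assumes "\<And>x. 0 \<le> \<phi> x"
  shows "0 \<le> E_loc \<phi> t" "0 \<le> D_loc \<phi> t" "0 \<le> (\<integral>x. \<phi> x * (\<Sum>i\<in>UNIV. (F t i x)\<^sup>2) \<partial>lborel)"
  unfolding E_loc_def D_loc_def
  by (auto intro!: integral_nonneg_AE AE_I2 mult_nonneg_nonneg sum_nonneg assms D_nonneg)

text \<open>The weight is divided evenly between the two factors of Cauchy-Schwarz, so that force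
  and velocity are both seen only on the support of \<phi>.\<close>

lemma F_loc_le:
  assumes \<phi>: "cts_cpt \<phi>" "\<And>x. 0 \<le> \<phi> x" and t: "t \<in> {0..T}"
  shows "F_loc \<phi> t \<le> sqrt (\<integral>x. \<phi> x * (\<Sum>i\<in>UNIV. (F t i x)\<^sup>2) \<partial>lborel) * sqrt (E_loc \<phi> t)"
proof -
  let ?f = "\<lambda>x. sqrt (\<phi> x * (\<Sum>i\<in>UNIV. (F t i x)\<^sup>2))" and ?g = "\<lambda>x. sqrt (\<phi> x * (\<Sum>i\<in>UNIV. (U t i x)\<^sup>2))"
  have c: "continuous_on UNIV \<phi>" "\<And>i. continuous_on UNIV (F t i)" "\<And>i. continuous_on UNIV (U t i)"
    using cts_cpt_continuous[OF \<phi>(1)] continuous_on_section[OF cont_F t] continuous_on_section[OF cont_U t] by auto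
  have m: "?f \<in> borel_measurable lborel" "?g \<in> borel_measurable lborel"
    using c by (simp_all add: borel_measurable_continuous_onI continuous_intros)
  have sq: "(?f x)\<^sup>2 = \<phi> x * (\<Sum>i\<in>UNIV. (F t i x)\<^sup>2)" "(?g x)\<^sup>2 = \<phi> x * (\<Sum>i\<in>UNIV. (U t i x)\<^sup>2)" for x
    using \<phi>(2) by (simp_all add: sum_nonneg)
  have I: "integrable lborel (\<lambda>x. (?f x)\<^sup>2)" "integrable lborel (\<lambda>x. (?g x)\<^sup>2)"
    unfolding sq by (intro integrable_loc[OF \<phi>(1) t])+
  have pt: "(\<Sum>i\<in>UNIV. F t i x * (\<phi> x * U t i x)) \<le> \<bar>?f x * ?g x\<bar>" for x
  proof -
    have "(\<Sum>i\<in>UNIV. F t i x * U t i x)\<^sup>2 \<le> (\<Sum>i\<in>UNIV. (F t i x)\<^sup>2) * (\<Sum>i\<in>UNIV. (U t i x)\<^sup>2)"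
      by (rule Cauchy_Schwarz_ineq_sum)
    then have "(\<Sum>i\<in>UNIV. F t i x * U t i x) \<le> sqrt ((\<Sum>i\<in>UNIV. (F t i x)\<^sup>2) * (\<Sum>i\<in>UNIV. (U t i x)\<^sup>2))"
      by (rule real_le_rsqrt)
    then have "\<phi> x * (\<Sum>i\<in>UNIV. F t i x * U t i x) \<le> \<phi> x * sqrt ((\<Sum>i\<in>UNIV. (F t i x)\<^sup>2) * (\<Sum>i\<in>UNIV. (U t i x)\<^sup>2))"
      by (intro mult_left_mono \<phi>)
    also have "\<dots> = ?f x * ?g x"
    proof -
      have "\<phi> x = sqrt (\<phi> x) * sqrt (\<phi> x)" using \<phi>(2) by simp
      then show ?thesis by (simp only: real_sqrt_mult) (simp add: mult_ac)
    qed
    finally show ?thesis by (simp add: sum_distrib_left mult_ac)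
  qed
  have "F_loc \<phi> t \<le> (\<integral>x. \<bar>?f x * ?g x\<bar> \<partial>lborel)"
    unfolding F_loc_def
    by (intro integral_mono integrable_abs integrable_mult_squares m I pt cts_cpt_integrable cts_cpt_sum cts_cpt_mult_left cts_cpt_mult_right \<phi> c)
  also have "\<dots> \<le> sqrt (\<integral>x. (?f x)\<^sup>2 \<partial>lborel) * sqrt (\<integral>x. (?g x)\<^sup>2 \<partial>lborel)"
    by (rule Cauchy_Schwarz_integral[OF m I])
  finally show ?thesis unfolding sq E_loc_def .
qed

text \<open>The force is integrable in time only with exponent one, so the local energy is replaced
  by a bound \<open>S\<close> for all times before integrating.\<close>

lemma integral_F_loc_le:
  assumes \<phi>: "cts_cpt \<phi>" "\<And>x. 0 \<le> \<phi> x" "\<And>x. \<phi> x \<le> 1" "\<And>x. x \<notin> cball x0 R \<Longrightarrow> \<phi> x = 0"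
    and \<tau>: "\<tau> \<in> {0..T}" and \<Phi>: "L1tL2x {0..T} (cball x0 R) f \<le> ennreal \<Phi>" "0 \<le> \<Phi>"
    and S: "\<And>t. t \<in> {0..T} \<Longrightarrow> E_loc \<phi> t \<le> S"
  shows "integral {0..\<tau>} (F_loc \<phi>) \<le> \<Phi> * sqrt S"
proof -
  define k where "k t = sqrt (\<integral>x. \<phi> x * (\<Sum>i\<in>UNIV. (F t i x)\<^sup>2) \<partial>lborel)" for t
  have sub: "{0..\<tau>} \<subseteq> {0..T}" using \<tau> by auto
  have ck: "continuous_on {0..T} k"
    unfolding k_def[abs_def]
    by (intro continuous_on_real_sqrt continuous_on_time_integral \<phi>) (unfold case_prod_beta, intro continuous_intros conts)
  have k0: "0 \<le> k t" for t unfolding k_def using loc_nonneg(3)[OF \<phi>(2)] by simp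
  have kL: "ennreal (k t) \<le> L2x (cball x0 R) (f t)" if t: "t \<in> {0..T}" for t
  proof (rule ennreal_square_le)
    have "(ennreal (k t))\<^sup>2 = ennreal (\<integral>x. \<phi> x * (\<Sum>i\<in>UNIV. (F t i x)\<^sup>2) \<partial>lborel)"
      using loc_nonneg(3)[OF \<phi>(2)] k0[of t] by (simp add: ennreal_power) (simp add: k_def)
    also have "\<dots> = (\<integral>\<^sup>+x. ennreal (\<phi> x * (\<Sum>i\<in>UNIV. (F t i x)\<^sup>2)) \<partial>lborel)"
      by (intro nn_integral_eq_integral[symmetric] integrable_loc \<phi> t AE_I2 mult_nonneg_nonneg sum_nonneg) auto
    also have "\<dots> \<le> (L2x (cball x0 R) (f t))\<^sup>2"
      unfolding L2x_square
    proof (rule nn_integral_mono)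
      fix x
      have "\<phi> x * (\<Sum>i\<in>UNIV. (F t i x)\<^sup>2) \<le> 1 * (norm (f t x))\<^sup>2"
        unfolding norm_vec_sq F_def by (intro mult_mono \<phi> sum_nonneg) auto
      then show "ennreal (\<phi> x * (\<Sum>i\<in>UNIV. (F t i x)\<^sup>2)) \<le> ennreal ((norm (f t x))\<^sup>2) * indicator (cball x0 R) x"
        using \<phi>(4)[of x] by (cases "x \<in> cball x0 R") (auto intro!: ennreal_leI)
    qed
    finally show "(ennreal (k t))\<^sup>2 \<le> (L2x (cball x0 R) (f t))\<^sup>2" .
  qed
  have "ennreal (integral {0..\<tau>} k) = (\<integral>\<^sup>+t\<in>{0..\<tau>}. ennreal (k t) \<partial>lborel)"
    by (rule nn_integral_eq_HK[symmetric]) (use continuous_on_subset[OF ck sub] k0 in auto)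
  also have "\<dots> \<le> L1tL2x {0..T} (cball x0 R) f"
    unfolding L1tL2x_def using kL sub by (intro nn_integral_mono) (auto simp: indicator_def)
  also have "\<dots> \<le> ennreal \<Phi>" by (rule \<Phi>)
  finally have k\<Phi>: "integral {0..\<tau>} k \<le> \<Phi>" using \<Phi>(2) by (subst (asm) ennreal_le_iff) auto
  have "integral {0..\<tau>} (F_loc \<phi>) \<le> integral {0..\<tau>} (\<lambda>t. k t * sqrt S)"
  proof (rule integral_le)
    show "F_loc \<phi> t \<le> k t * sqrt S" if "t \<in> {0..\<tau>}" for t
    proof -
      have "t \<in> {0..T}" using that sub by auto
      then have "F_loc \<phi> t \<le> k t * sqrt (E_loc \<phi> t)" unfolding k_def by (intro F_loc_le \<phi>)
      also have "\<dots> \<le> k t * sqrt S" using S[OF \<open>t \<in> {0..T}\<close>] k0 by (intro mult_left_mono) auto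
      finally show ?thesis .
    qed
  qed (use sub in \<open>auto intro!: integrable_continuous_real continuous_intros continuous_on_subset[OF ck] continuous_on_subset[OF continuous_F_loc[OF \<phi>(1)]]\<close>)
  also have "\<dots> = integral {0..\<tau>} k * sqrt S" by simp
  also have "\<dots> \<le> \<Phi> * sqrt S"
  proof (rule mult_right_mono[OF k\<Phi>])
    have "0 \<le> E_loc \<phi> 0" by (rule loc_nonneg(1)[OF \<phi>(2)])
    also have "\<dots> \<le> S" using T_pos by (intro S) auto
    finally show "0 \<le> sqrt S" by simp
  qed
  finally show ?thesis .
qed

lemma E_loc_0_le:
  assumes \<phi>: "cts_cpt \<phi>" "\<And>x. 0 \<le> \<phi> x" "\<And>x. \<phi> x \<le> 1" "\<And>x. x \<notin> cball x0 R \<Longrightarrow> \<phi> x = 0"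
    and a0: "L2x (cball x0 R) u0 \<le> ennreal a0" "0 \<le> a0"
  shows "E_loc \<phi> 0 \<le> a0\<^sup>2"
proof -
  have u0: "u 0 = u0" using sol unfolding finite_energy_almost_smooth_solution_def by blast
  have 0: "0 \<in> {0..T}" using T_pos by simp
  have "ennreal (E_loc \<phi> 0) = (\<integral>\<^sup>+x. ennreal (\<phi> x * (\<Sum>i\<in>UNIV. (U 0 i x)\<^sup>2)) \<partial>lborel)"
    unfolding E_loc_def by (intro nn_integral_eq_integral[symmetric] integrable_loc \<phi> 0 AE_I2 mult_nonneg_nonneg sum_nonneg) auto
  also have "\<dots> \<le> (\<integral>\<^sup>+x\<in>cball x0 R. ennreal ((norm (u0 x))\<^sup>2) \<partial>lborel)"
  proof (rule nn_integral_mono)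
    fix x
    have "\<phi> x * (\<Sum>i\<in>UNIV. (U 0 i x)\<^sup>2) \<le> 1 * (norm (u0 x))\<^sup>2"
      unfolding norm_vec_sq U_def u0 by (intro mult_mono \<phi> sum_nonneg) auto
    then show "ennreal (\<phi> x * (\<Sum>i\<in>UNIV. (U 0 i x)\<^sup>2)) \<le> ennreal ((norm (u0 x))\<^sup>2) * indicator (cball x0 R) x"
      using \<phi>(4)[of x] by (cases "x \<in> cball x0 R") (auto intro!: ennreal_leI)
  qed
  also have "\<dots> \<le> ennreal (a0\<^sup>2)" using a0 by (simp add: L2x_le_iff)
  finally show ?thesis by (subst (asm) ennreal_le_iff) auto
qed

text \<open>The energy inequality is used at two times. At the maximum \<tau> of the local energy it
  bounds \<open>S\<close>, after Young's inequality has split the force term and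
  \<open>S / 4\<close> has been absorbed. At \<open>T\<close> it bounds the dissipation, with
  \<open>S / 4\<close> replaced by the bound just found; the two shares \<open>1/16\<close> of the
  outer dissipation add up to \<open>1/8\<close>.\<close>

lemma local_recursion:
  assumes d: "0 < d" and \<rho>: "0 \<le> \<rho>" and \<eta>: "cutoff x0 \<rho> d \<eta> \<eta>1" and \<theta>: "cutoff x0 (\<rho> + 3 * d) d' \<theta> \<theta>1"
    and R: "\<rho> + d \<le> R"
    and a0: "L2x (cball x0 R) u0 \<le> ennreal a0" "0 \<le> a0"
    and \<Phi>: "L1tL2x {0..T} (cball x0 R) f \<le> ennreal \<Phi>" "0 \<le> \<Phi>"
    and C: "C = slice_const * (M ^ 2 / d ^ 2 + M ^ 6 / d ^ 4)"
  shows "t \<in> {0..T} \<Longrightarrow> E_loc \<eta> t \<le> 2 * a0\<^sup>2 + 4 * \<Phi>\<^sup>2 + integral {0..T} (D_loc \<theta>) / 4 + 4 * T * C"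
    and "integral {0..T} (D_loc \<eta>) \<le> integral {0..T} (D_loc \<theta>) / 8 + (a0\<^sup>2 + 2 * \<Phi>\<^sup>2) + 2 * T * C"
proof -
  have \<eta>': "cts_cpt \<eta>" "\<And>x. 0 \<le> \<eta> x" "\<And>x. \<eta> x \<le> 1" "\<And>x. x \<notin> cball x0 R \<Longrightarrow> \<eta> x = 0"
    using \<eta> cutoff_cts_cpt[OF \<eta>] R by (auto simp: cutoff_def dist_norm norm_minus_commute)
  have \<theta>': "cts_cpt \<theta>" "\<And>x. 0 \<le> \<theta> x"
    using \<theta> cutoff_cts_cpt[OF \<theta>] by (auto simp: cutoff_def)
  have C0: "0 \<le> C" using slice_const_nonneg by (simp add: C)
  obtain \<tau> where \<tau>: "\<tau> \<in> {0..T}" "\<And>t. t \<in> {0..T} \<Longrightarrow> E_loc \<eta> t \<le> E_loc \<eta> \<tau>"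
    using continuous_attains_sup[OF _ _ continuous_E_loc[OF \<eta>'(1)]] T_pos by auto
  define S where "S = E_loc \<eta> \<tau>"
  have S0: "0 \<le> S" unfolding S_def by (rule loc_nonneg(1)[OF \<eta>'(2)])
  have "0 \<le> (sqrt S / 2 - \<Phi>)\<^sup>2" by simp
  then have young: "\<Phi> * sqrt S \<le> S / 4 + \<Phi>\<^sup>2" using S0 by (simp add: power2_diff power_divide mult.commute)
  have Fb: "integral {0..s} (F_loc \<eta>) \<le> S / 4 + \<Phi>\<^sup>2" if "s \<in> {0..T}" for s
    using integral_F_loc_le[OF \<eta>' that \<Phi>, of S] \<tau>(2) young by (simp add: S_def)
  have E0: "E_loc \<eta> 0 \<le> a0\<^sup>2" by (rule E_loc_0_le[OF \<eta>' a0])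
  have int: "D_loc \<phi> integrable_on {0..s}" if "cts_cpt \<phi>" "s \<in> {0..T}" for \<phi> s
    using that by (intro integrable_continuous_real continuous_on_subset[OF continuous_D_loc]) auto
  have T: "T \<in> {0..T}" using T_pos by simp
  have "integral {0..\<tau>} (D_loc \<theta>) \<le> integral {0..T} (D_loc \<theta>)"
    using \<tau>(1) T \<theta>' loc_nonneg(2)[OF \<theta>'(2)] by (intro integral_subset_le int) auto
  moreover have "0 \<le> integral {0..\<tau>} (D_loc \<eta>)"
    by (rule Henstock_Kurzweil_Integration.integral_nonneg[OF int[OF \<eta>'(1) \<tau>(1)]]) (rule loc_nonneg(2)[OF \<eta>'(2)])
  moreover have "\<tau> * C \<le> T * C" using \<tau>(1) C0 by (intro mult_right_mono) auto
  ultimately have S: "S \<le> 2 * a0\<^sup>2 + 4 * \<Phi>\<^sup>2 + integral {0..T} (D_loc \<theta>) / 4 + 4 * T * C"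
    using energy_step[OF d \<rho> \<eta> \<theta> \<tau>(1)] Fb[OF \<tau>(1)] E0 unfolding C[symmetric] S_def[symmetric] by linarith
  show "E_loc \<eta> t \<le> 2 * a0\<^sup>2 + 4 * \<Phi>\<^sup>2 + integral {0..T} (D_loc \<theta>) / 4 + 4 * T * C" if "t \<in> {0..T}" for t
    using \<tau>(2)[OF that] S by (simp add: S_def)
  have "0 \<le> E_loc \<eta> T" by (rule loc_nonneg(1)[OF \<eta>'(2)])
  then show "integral {0..T} (D_loc \<eta>) \<le> integral {0..T} (D_loc \<theta>) / 8 + (a0\<^sup>2 + 2 * \<Phi>\<^sup>2) + 2 * T * C"
    using energy_step[OF d \<rho> \<eta> \<theta> T] Fb[OF T] E0 S unfolding C[symmetric] by linarith
qed

text \<open>The recursion is run through shells of geometrically shrinking width between the radii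
  \<open>R - r\<close> and \<open>R\<close>. Its first entry \<open>Q 0\<close> gives the
  dissipation; the energy is then read off from one more step, with \<open>Q 1\<close>
  inserted.\<close>

lemma local_bounds:
  assumes r: "0 < r" "r < R"
    and a0: "L2x (cball x0 R) u0 \<le> ennreal a0" "0 \<le> a0"
    and \<Phi>: "L1tL2x {0..T} (cball x0 R) f \<le> ennreal \<Phi>" "0 \<le> \<Phi>"
    and X: "X = loc_const * (a0\<^sup>2 + \<Phi>\<^sup>2 + T * (M\<^sup>2 / r\<^sup>2 + M ^ 6 / r ^ 4))"
  shows "t \<in> {0..T} \<Longrightarrow> (\<integral>\<^sup>+x\<in>cball x0 (R - r). ennreal ((norm (u t x))\<^sup>2) \<partial>lborel) \<le> ennreal X"
    and "(\<integral>\<^sup>+t\<in>{0..T}. (L2x (cball x0 (R - r)) (grad (u t)))\<^sup>2 \<partial>lborel) \<le> ennreal X"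
proof -
  \<comment> \<open>The ratio \<open>2/3\<close> keeps the growth \<open>(3/2)\<^sup>4 = 81/16\<close> of the error terms below the factor \<open>8\<close> gained per step.\<close>
  define d where "d k = r / 10 * (2 / 3) ^ k" for k :: nat
  \<comment> \<open>\<open>9 * d k\<close> is three times the sum of all widths from
    \<open>k\<close> on. So the radius grows by \<open>3 * d k\<close> in each step, starts at
    \<open>R - r\<close>, and all supports stay within radius \<open>R\<close>.\<close>
  define \<rho> where "\<rho> k = R - r / 10 - 9 * d k" for k
  have d: "0 < d k" "d k \<le> r / 10" "d (Suc k) = 2 / 3 * d k" for k
    using r power_le_one[of "2 / 3 :: real" k] by (auto simp: d_def mult_left_le)
  have \<rho>: "0 \<le> \<rho> k" "\<rho> (Suc k) = \<rho> k + 3 * d k" "\<rho> k + d k \<le> R" for k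
    using r d[of k] by (auto simp: \<rho>_def)
  have \<rho>0: "\<rho> 0 = R - r" by (simp add: \<rho>_def d_def)
  have "\<exists>\<eta> \<eta>1. cutoff x0 (\<rho> k) (d k) \<eta> \<eta>1" for k
    using cutoff_exists[OF \<rho>(1) d(1)] by metis
  then obtain \<eta> \<eta>1 where \<eta>: "\<And>k. cutoff x0 (\<rho> k) (d k) (\<eta> k) (\<eta>1 k)" by metis
  define C where "C k = slice_const * (M ^ 2 / d k ^ 2 + M ^ 6 / d k ^ 4)" for k
  define Q where "Q k = integral {0..T} (D_loc (\<eta> k))" for k
  define b where "b = a0\<^sup>2 + 2 * \<Phi>\<^sup>2"
  note step = local_recursion[OF d(1) \<rho>(1) \<eta> \<eta>[of "Suc _", unfolded \<rho>(2)] \<rho>(3) a0 \<Phi> C_def]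
  \<comment> \<open>This wider cutoff dominates every \<open>\<eta> k\<close>; its dissipation,
    finite by continuity in time, is the common bound \<open>Dm\<close> of the iteration.\<close>
  obtain \<theta> \<theta>1 where \<theta>: "cutoff x0 R 1 \<theta> \<theta>1" using cutoff_exists[of R 1 x0] r by auto
  have \<eta>': "cts_cpt (\<eta> k)" "0 \<le> \<eta> k x" "\<eta> k x \<le> 1" "\<rho> k + d k < norm (x - x0) \<Longrightarrow> \<eta> k x = 0" "norm (x - x0) \<le> \<rho> k \<Longrightarrow> \<eta> k x = 1" for k x
    using \<eta>[of k] cutoff_cts_cpt[OF \<eta>[of k]] by (auto simp: cutoff_def)
  have \<theta>': "cts_cpt \<theta>" "norm (x - x0) \<le> R \<Longrightarrow> \<theta> x = 1" "0 \<le> \<theta> x" for x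
    using \<theta> cutoff_cts_cpt[OF \<theta>] by (auto simp: cutoff_def)
  have C0: "0 \<le> C k" for k using slice_const_nonneg by (simp add: C_def)
  have CS: "C (Suc k) \<le> 81 / 16 * C k" for k
  proof -
    have "M ^ 2 / d (Suc k) ^ 2 + M ^ 6 / d (Suc k) ^ 4 = 9 / 4 * (M ^ 2 / d k ^ 2) + 81 / 16 * (M ^ 6 / d k ^ 4)"
      unfolding d(3) by (simp add: power_mult_distrib power_divide)
    also have "\<dots> \<le> 81 / 16 * (M ^ 2 / d k ^ 2) + 81 / 16 * (M ^ 6 / d k ^ 4)"
      by (intro add_right_mono mult_right_mono) auto
    finally have "slice_const * (M ^ 2 / d (Suc k) ^ 2 + M ^ 6 / d (Suc k) ^ 4) \<le> slice_const * (81 / 16 * (M ^ 2 / d k ^ 2) + 81 / 16 * (M ^ 6 / d k ^ 4))"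
      using slice_const_nonneg by (rule mult_left_mono)
    then show ?thesis by (simp add: C_def algebra_simps)
  qed
  have Q: "Q k \<le> 2 * b + 3 * (2 * T * C k)" for k
  proof (rule iteration_bound[where c = "\<lambda>k. 2 * T * C k" and Dm = "integral {0..T} (D_loc \<theta>)"])
    show "Q k \<le> Q (Suc k) / 8 + b + 2 * T * C k" for k
      unfolding Q_def b_def by (rule step(2))
    show "2 * T * C (Suc k) \<le> 81 / 16 * (2 * T * C k)" for k
      using mult_left_mono[OF CS[of k], of "2 * T"] T_pos by simp
    show "0 \<le> 2 * T * C k" for k using T_pos C0 by simp
    show "0 \<le> b" by (simp add: b_def)
    show "Q k \<le> integral {0..T} (D_loc \<theta>)" for k
      unfolding Q_def
    proof (rule integral_le)
      fix t assume t: "t \<in> {0..T}"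
      show "D_loc (\<eta> k) t \<le> D_loc \<theta> t"
        unfolding D_loc_def
      proof (intro integral_mono integrable_loc \<eta>' \<theta>' t mult_right_mono D_nonneg)
        show "\<eta> k x \<le> \<theta> x" for x
          using \<eta>'(3)[of k x] \<eta>'(4)[of k x] \<theta>'(2,3)[of x] \<rho>(3)[of k] by (cases "norm (x - x0) \<le> R") auto
      qed
    qed (intro integrable_continuous_real continuous_D_loc \<eta>' \<theta>')+
  qed
  have C0eq: "T * C 0 = slice_const * (T * (100 * (M ^ 2 / r ^ 2) + 10000 * (M ^ 6 / r ^ 4)))"
  proof -
    have "d 0 = r / 10" by (simp add: d_def)
    moreover have "M ^ 2 / (r / 10) ^ 2 = 100 * (M ^ 2 / r ^ 2)" "M ^ 6 / (r / 10) ^ 4 = 10000 * (M ^ 6 / r ^ 4)"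
      by (simp_all add: power_divide)
    ultimately show ?thesis by (simp only: C_def mult.left_commute)
  qed
  have Cle: "12 * (T * C 0) \<le> 120000 * slice_const * (T * (M\<^sup>2 / r\<^sup>2 + M ^ 6 / r ^ 4))"
  proof -
    have "100 * (M ^ 2 / r ^ 2) + 10000 * (M ^ 6 / r ^ 4) \<le> 10000 * (M\<^sup>2 / r\<^sup>2 + M ^ 6 / r ^ 4)"
      unfolding distrib_left by (intro add_mono mult_right_mono) auto
    then have "slice_const * (T * (100 * (M ^ 2 / r ^ 2) + 10000 * (M ^ 6 / r ^ 4))) \<le> slice_const * (T * (10000 * (M\<^sup>2 / r\<^sup>2 + M ^ 6 / r ^ 4)))"
      using slice_const_nonneg T_pos by (intro mult_left_mono) auto
    then show ?thesis unfolding C0eq by (simp add: algebra_simps)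
  qed
  \<comment> \<open>Room for both estimates: with \<open>y = T * C 0\<close> the dissipation needs
    \<open>2 b + 6 y\<close>, and the energy \<open>5/2 b\<close> plus
    \<open>4 + 3/2 * 81/16\<close> times \<open>y\<close>, where this last coefficient is below
    12.\<close>
  have bX: "3 * b + 12 * (T * C 0) \<le> X"
  proof -
    define Y where "Y = T * (M\<^sup>2 / r\<^sup>2 + M ^ 6 / r ^ 4)"
    have "0 \<le> slice_const * (a0\<^sup>2 + \<Phi>\<^sup>2)" "0 \<le> Y" "0 \<le> a0\<^sup>2"
      using slice_const_nonneg T_pos by (auto simp: Y_def)
    moreover have "X = 6 * (a0\<^sup>2 + \<Phi>\<^sup>2) + 6 * Y + 120000 * (slice_const * (a0\<^sup>2 + \<Phi>\<^sup>2)) + 120000 * slice_const * Y"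
      unfolding X loc_const_def Y_def[symmetric] by (simp only: distrib_right distrib_left mult.assoc)
    moreover have "a0\<^sup>2 + 2 * \<Phi>\<^sup>2 \<le> 2 * (a0\<^sup>2 + \<Phi>\<^sup>2)" by simp
    moreover have "x \<le> z" if "0 \<le> s" "0 \<le> y" "z = 6 * g + 6 * y + 120000 * s + w" "h \<le> 2 * g" "c \<le> w" "x = 3 * h + c"
      for x z s y g w h c :: real
      using that by linarith
    ultimately show ?thesis using Cle unfolding b_def Y_def[symmetric] by blast
  qed
  have TC: "0 \<le> T * C 0" "T * C 1 \<le> 81 / 16 * (T * C 0)" using C0 T_pos CS[of 0] by (auto simp: mult_left_mono)
  have b0: "0 \<le> b" by (simp add: b_def)
  have Q0: "Q 0 \<le> X"
  proof -
    have "q \<le> x" if "q \<le> 2 * b + 6 * y" "3 * b + 12 * y \<le> x" "0 \<le> y" for q x y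
      using that b0 by linarith
    moreover have "Q 0 \<le> 2 * b + 6 * (T * C 0)" using Q[of 0] by simp
    ultimately show ?thesis using bX TC(1) by blast
  qed
  have E0: "E_loc (\<eta> 0) t \<le> X" if "t \<in> {0..T}" for t
  proof -
    have "q \<le> x" if "q \<le> 2 * b + q1 / 4 + 4 * y" "q1 \<le> 2 * b + 6 * y1" "3 * b + 12 * y \<le> x" "0 \<le> y" "y1 \<le> 81 / 16 * y" for q q1 x y y1
      using that b0 by linarith
    moreover have "E_loc (\<eta> 0) t \<le> 2 * b + Q (Suc 0) / 4 + 4 * (T * C 0)"
      using step(1)[OF that, of 0] by (simp add: Q_def b_def mult.assoc)
    moreover have "Q (Suc 0) \<le> 2 * b + 6 * (T * C 1)" using Q[of 1] by simp
    ultimately show ?thesis using TC bX by blast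
  qed
  show "(\<integral>\<^sup>+x\<in>cball x0 (R - r). ennreal ((norm (u t x))\<^sup>2) \<partial>lborel) \<le> ennreal X" if t: "t \<in> {0..T}" for t
  proof -
    have "(\<integral>\<^sup>+x\<in>cball x0 (R - r). ennreal ((norm (u t x))\<^sup>2) \<partial>lborel) \<le> (\<integral>\<^sup>+x. ennreal (\<eta> 0 x * (\<Sum>i\<in>UNIV. (U t i x)\<^sup>2)) \<partial>lborel)"
    proof (rule nn_integral_mono)
      fix x
      show "ennreal ((norm (u t x))\<^sup>2) * indicator (cball x0 (R - r)) x \<le> ennreal (\<eta> 0 x * (\<Sum>i\<in>UNIV. (U t i x)\<^sup>2))"
        using \<eta>'(5)[of x 0] by (cases "x \<in> cball x0 (R - r)") (auto simp: \<rho>0 dist_norm norm_minus_commute U_def norm_vec_sq)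
    qed
    also have "\<dots> = ennreal (E_loc (\<eta> 0) t)"
      unfolding E_loc_def by (intro nn_integral_eq_integral integrable_loc \<eta>' t AE_I2 mult_nonneg_nonneg sum_nonneg) auto
    also have "\<dots> \<le> ennreal X" using E0[OF t] by (rule ennreal_leI)
    finally show ?thesis .
  qed
  have "(\<integral>\<^sup>+t\<in>{0..T}. (L2x (cball x0 (R - r)) (grad (u t)))\<^sup>2 \<partial>lborel) \<le> (\<integral>\<^sup>+t\<in>{0..T}. ennreal (D_loc (\<eta> 0) t) \<partial>lborel)"
  proof (rule nn_integral_mono)
    fix t
    have "(L2x (cball x0 (R - r)) (grad (u t)))\<^sup>2 \<le> ennreal (D_loc (\<eta> 0) t)" if t: "t \<in> {0..T}"
    proof -
      have "(L2x (cball x0 (R - r)) (grad (u t)))\<^sup>2 \<le> (\<integral>\<^sup>+x. ennreal (\<eta> 0 x * D t x) \<partial>lborel)"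
        unfolding L2x_square norm_grad_sq
      proof (rule nn_integral_mono)
        fix x
        show "ennreal (D t x) * indicator (cball x0 (R - r)) x \<le> ennreal (\<eta> 0 x * D t x)"
          using \<eta>'(5)[of x 0] by (cases "x \<in> cball x0 (R - r)") (auto simp: \<rho>0 dist_norm norm_minus_commute)
      qed
      also have "\<dots> = ennreal (D_loc (\<eta> 0) t)"
        unfolding D_loc_def by (intro nn_integral_eq_integral integrable_loc \<eta>' t AE_I2 mult_nonneg_nonneg D_nonneg)
      finally show ?thesis .
    qed
    then show "(L2x (cball x0 (R - r)) (grad (u t)))\<^sup>2 * indicator {0..T} t \<le> ennreal (D_loc (\<eta> 0) t) * indicator {0..T} t"
      by (auto simp: indicator_def)
  qed
  also have "\<dots> = ennreal (Q 0)"
    unfolding Q_def by (intro nn_integral_eq_HK continuous_D_loc \<eta>' loc_nonneg)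
  also have "\<dots> \<le> ennreal X" using Q0 by (rule ennreal_leI)
  finally show "(\<integral>\<^sup>+t\<in>{0..T}. (L2x (cball x0 (R - r)) (grad (u t)))\<^sup>2 \<partial>lborel) \<le> ennreal X" .
qed

end

section \<open>From local to global and back\<close>

text \<open>Fatou's lemma, used both for limits in time and for growing balls.\<close>

lemma nn_integral_le_of_tendsto:
  assumes [measurable]: "\<And>n. h n \<in> borel_measurable N" and "\<And>x. (\<lambda>n. h n x) \<longlonglongrightarrow> (g x :: ennreal)"
    and "\<And>n. (\<integral>\<^sup>+x. h n x \<partial>N) \<le> c"
  shows "(\<integral>\<^sup>+x. g x \<partial>N) \<le> c"
proof -
  have "(\<integral>\<^sup>+x. g x \<partial>N) = (\<integral>\<^sup>+x. liminf (\<lambda>n. h n x) \<partial>N)"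
    by (intro nn_integral_cong lim_imp_Liminf[symmetric] assms(2)) simp
  also have "\<dots> \<le> liminf (\<lambda>n. \<integral>\<^sup>+x. h n x \<partial>N)" by (rule nn_integral_liminf) measurable
  also have "\<dots> \<le> c"
    using Liminf_mono[of "\<lambda>n. \<integral>\<^sup>+x. h n x \<partial>N" "\<lambda>_. c" sequentially] assms(3)
    by (simp add: Liminf_const)
  finally show ?thesis .
qed

section \<open>From an essential supremum to a bound at every time\<close>

context nse
begin

lemma cont_u: "continuous_on ({0..T} \<times> UNIV) (\<lambda>(t, x). u t x)"
  using u_space(2)[of "[]"] by (simp add: pds_def)

lemma measurable_u: "t \<in> {0..T} \<Longrightarrow> (\<lambda>x. ennreal ((norm (u t x))\<^sup>2)) \<in> borel_measurable borel"
  using borel_measurable_continuous_onI[OF continuous_on_section[OF cont_u]] by measurable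

text \<open>A null set contains no interval, so the times with \<open>Q\<close> are dense in
  \<open>{0..T}\<close>.\<close>

lemma good_times_dense:
  assumes "AE t in restrict_space lborel {0..T}. Q t" "t \<in> {0..T}"
  obtains s where "\<And>n. s n \<in> {0..T}" "\<And>n. Q (s n)" "s \<longlonglongrightarrow> t"
proof -
  have "\<exists>s\<in>{0..T}. Q s \<and> \<bar>s - t\<bar> \<le> 1 / real (Suc n)" for n
  proof (rule ccontr)
    assume no: "\<not> (\<exists>s\<in>{0..T}. Q s \<and> \<bar>s - t\<bar> \<le> 1 / real (Suc n))"
    have "AE s in lborel. s \<in> {0..T} \<longrightarrow> Q s"
      using assms(1) by (subst (asm) AE_restrict_space_iff) auto
    then obtain N where N: "{s \<in> space lborel. \<not> (s \<in> {0..T} \<longrightarrow> Q s)} \<subseteq> N" "emeasure lborel N = 0" "N \<in> sets lborel"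
      by (rule AE_E)
    define \<delta> where "\<delta> = min (1 / real (Suc n)) (T / 2)"
    have \<delta>: "0 < \<delta>" using T_pos by (simp add: \<delta>_def)
    \<comment> \<open>An interval of length at most \<open>T / 2\<close> fits to the right of
      \<open>t\<close> in the first half of \<open>{0..T}\<close> and to its left in the
      second.\<close>
    define a where "a = (if t \<le> T / 2 then t else t - \<delta>)"
    have "{a<..<a + \<delta>} \<subseteq> N"
    proof
      fix s assume s: "s \<in> {a<..<a + \<delta>}"
      have "\<delta> \<le> 1 / real (Suc n)" "\<delta> \<le> T / 2" by (simp_all add: \<delta>_def)
      then have "s \<in> {0..T}" "\<bar>s - t\<bar> \<le> 1 / real (Suc n)"
        using s assms(2) by (auto simp: a_def abs_le_iff split: if_splits)
      then show "s \<in> N" using no N(1) by auto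
    qed
    then have "emeasure lborel {a<..<a + \<delta>} \<le> emeasure lborel N" by (intro emeasure_mono N)
    then show False using N(2) \<delta> by simp
  qed
  then obtain s where s: "\<And>n. s n \<in> {0..T} \<and> Q (s n) \<and> \<bar>s n - t\<bar> \<le> 1 / real (Suc n)" by metis
  have "(\<lambda>n. s n - t) \<longlonglongrightarrow> 0"
    by (rule Lim_null_comparison[OF _ LIMSEQ_Suc[OF lim_1_over_n]]) (use s in auto)
  then have "s \<longlonglongrightarrow> t" by (simp add: LIM_zero_iff)
  then show thesis using s by (intro that) auto
qed

text \<open>Every time is a limit of times at which the essential supremum is a bound;
  \<open>u\<close> is continuous in time at each point, and Fatou's lemma carries the bound to the
  limit.\<close>

lemma L2_bound_everywhere:
  assumes "LinftL2x {0..T} UNIV u \<le> ennreal K" "0 \<le> K" "t \<in> {0..T}"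
  shows "(\<integral>\<^sup>+x. ennreal ((norm (u t x))\<^sup>2) \<partial>lborel) \<le> ennreal (K\<^sup>2)"
proof -
  have "AE t in restrict_space lborel {0..T}. L2x UNIV (u t) \<le> ennreal K"
    using esssup_AE[of "\<lambda>t. L2x UNIV (u t)" "restrict_space lborel {0..T}"] assms(1)
    unfolding LinftL2x_def by (auto elim!: eventually_mono intro: order_trans)
  then obtain s where s: "\<And>n. s n \<in> {0..T}" "\<And>n. L2x UNIV (u (s n)) \<le> ennreal K" "s \<longlonglongrightarrow> t"
    using good_times_dense assms(3) by metis
  show ?thesis
  proof (rule nn_integral_le_of_tendsto[where h = "\<lambda>n x. ennreal ((norm (u (s n) x))\<^sup>2)"])
    show "(\<lambda>x. ennreal ((norm (u (s n) x))\<^sup>2)) \<in> borel_measurable lborel" for n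
      using measurable_u[OF s(1)] by simp
    show "(\<integral>\<^sup>+x. ennreal ((norm (u (s n) x))\<^sup>2) \<partial>lborel) \<le> ennreal (K\<^sup>2)" for n
      using s(2)[of n] assms(2) by (simp add: L2x_le_iff)
    fix x
    have "continuous_on {0..T} (\<lambda>t. (\<lambda>(t, x). u t x) (t, x))"
      by (rule continuous_on_compose2[OF cont_u]) (auto intro!: continuous_intros)
    then have "continuous_on {0..T} (\<lambda>t. u t x)" by simp
    then have "(\<lambda>n. u (s n) x) \<longlonglongrightarrow> u t x"
      by (rule continuous_on_tendsto_compose[OF _ s(3) assms(3)]) (use s(1) in auto)
    then show "(\<lambda>n. ennreal ((norm (u (s n) x))\<^sup>2)) \<longlonglongrightarrow> ennreal ((norm (u t x))\<^sup>2)"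
      by (intro tendsto_ennrealI tendsto_intros)
  qed
qed

end

lemma loc_const_ge: "6 \<le> loc_const"
  using slice_const_nonneg by (simp add: loc_const_def)

text \<open>Letting the balls grow makes the \<open>M\<close>-dependent terms of the local estimate disappear.\<close>

lemma (in nse_energy) global_bound:
  assumes a0: "L2x UNIV u0 \<le> ennreal a0" "0 \<le> a0" and \<Phi>: "L1tL2x {0..T} UNIV f \<le> ennreal \<Phi>" "0 \<le> \<Phi>"
    and t: "t \<in> {0..T}"
  shows "(\<integral>\<^sup>+x. ennreal ((norm (u t x))\<^sup>2) \<partial>lborel) \<le> ennreal (loc_const * (a0\<^sup>2 + \<Phi>\<^sup>2))"
proof -
  define X where "X n = loc_const * (a0\<^sup>2 + \<Phi>\<^sup>2 + T * (M\<^sup>2 / (real (Suc n))\<^sup>2 + M ^ 6 / real (Suc n) ^ 4))" for n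
  have loc: "(\<integral>\<^sup>+x\<in>cball 0 (real (Suc n)). ennreal ((norm (u t x))\<^sup>2) \<partial>lborel) \<le> ennreal (X n)" for n
  proof -
    have "L2x (cball 0 (2 * real (Suc n))) u0 \<le> ennreal a0"
      using L2x_mono[of _ UNIV] a0(1) by (rule order_trans) simp
    moreover have "L1tL2x {0..T} (cball 0 (2 * real (Suc n))) f \<le> ennreal \<Phi>"
    proof (rule order_trans[OF _ \<Phi>(1)])
      show "L1tL2x {0..T} (cball 0 (2 * real (Suc n))) f \<le> L1tL2x {0..T} UNIV f"
        unfolding L1tL2x_def by (intro nn_integral_mono mult_right_mono L2x_mono) auto
    qed
    ultimately show ?thesis
      using local_bounds(1)[of "real (Suc n)" "2 * real (Suc n)" 0 a0 \<Phi> "X n" t] a0(2) \<Phi>(2) t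
      by (simp add: X_def del: of_nat_Suc)
  qed
  have Xlim: "X \<longlonglongrightarrow> loc_const * (a0\<^sup>2 + \<Phi>\<^sup>2 + T * (0 + 0))"
  proof -
    have "(\<lambda>n. M\<^sup>2 / (real (Suc n))\<^sup>2) \<longlonglongrightarrow> 0" "(\<lambda>n. M ^ 6 / real (Suc n) ^ 4) \<longlonglongrightarrow> 0"
      by real_asymp+
    then show ?thesis unfolding X_def[abs_def] by (intro tendsto_intros)
  qed
  \<comment> \<open>The inner ball stays fixed while the ball of the local estimate grows, so that
    \<open>X\<close> passes to its limit first; the inner radius is then removed by Fatou's
    lemma.\<close>
  have fin: "(\<integral>\<^sup>+x\<in>cball 0 (real (Suc m)). ennreal ((norm (u t x))\<^sup>2) \<partial>lborel) \<le> ennreal (loc_const * (a0\<^sup>2 + \<Phi>\<^sup>2))" for m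
  proof (rule LIMSEQ_le_const)
    show "(\<lambda>n. ennreal (X n)) \<longlonglongrightarrow> ennreal (loc_const * (a0\<^sup>2 + \<Phi>\<^sup>2))"
      using tendsto_ennrealI[OF Xlim] by simp
    show "\<exists>N. \<forall>n\<ge>N. (\<integral>\<^sup>+x\<in>cball 0 (real (Suc m)). ennreal ((norm (u t x))\<^sup>2) \<partial>lborel) \<le> ennreal (X n)"
    proof (intro exI[of _ m] allI impI)
      fix n assume "m \<le> n"
      then have "(\<integral>\<^sup>+x\<in>cball 0 (real (Suc m)). ennreal ((norm (u t x))\<^sup>2) \<partial>lborel) \<le> (\<integral>\<^sup>+x\<in>cball 0 (real (Suc n)). ennreal ((norm (u t x))\<^sup>2) \<partial>lborel)"
        by (intro nn_integral_mono) (auto simp: indicator_def)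
      also have "\<dots> \<le> ennreal (X n)" by (rule loc)
      finally show "(\<integral>\<^sup>+x\<in>cball 0 (real (Suc m)). ennreal ((norm (u t x))\<^sup>2) \<partial>lborel) \<le> ennreal (X n)" .
    qed
  qed
  show ?thesis
  proof (rule nn_integral_le_of_tendsto[where h = "\<lambda>m x. ennreal ((norm (u t x))\<^sup>2) * indicator (cball 0 (real (Suc m))) x", OF _ _ fin])
    show "(\<lambda>x. ennreal ((norm (u t x))\<^sup>2) * indicator (cball 0 (real (Suc m))) x) \<in> borel_measurable lborel" for m
      using measurable_u[OF t] by (intro borel_measurable_times_ennreal borel_measurable_indicator) auto
    fix x :: "real^3"
    obtain m0 where m0: "norm x \<le> real m0" using real_arch_simple by blast
    show "(\<lambda>m. ennreal ((norm (u t x))\<^sup>2) * indicator (cball 0 (real (Suc m))) x) \<longlonglongrightarrow> ennreal ((norm (u t x))\<^sup>2)"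
    proof (rule tendsto_eventually)
      show "\<forall>\<^sub>F m in sequentially. ennreal ((norm (u t x))\<^sup>2) * indicator (cball 0 (real (Suc m))) x = ennreal ((norm (u t x))\<^sup>2)"
        using eventually_ge_at_top[of m0] by eventually_elim (use m0 in auto)
    qed
  qed
qed

text \<open>The choice \<open>M\<^sup>2 = 2 * loc_const * e\<close> puts the powers 1 and 3 of
  \<open>2 * loc_const\<close> in front of the two error terms. The cube dominates, and the other
  \<open>loc_const\<close> is the factor of the local estimate itself.\<close>

definition main_const :: real where "main_const = sqrt (loc_const * (2 * loc_const) ^ 3)"

lemma main_const_nonneg: "0 \<le> main_const"
  using loc_const_ge by (simp add: main_const_def)

text \<open>The last two terms on the right, \<alpha> and \<beta>, have the squares
  \<open>T * e / r^2\<close> and \<open>T * e^3 / r^4\<close>. So the radicand is at most a constant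
  times a sum of four squares, and hence times the square of the sum.\<close>

lemma sqrt_local_bound_le:
  assumes "0 \<le> a" "0 \<le> \<phi>" "0 \<le> e" "0 < T" "0 < r"
  shows "sqrt (loc_const * (a\<^sup>2 + \<phi>\<^sup>2 + T * ((sqrt (2 * loc_const * e))\<^sup>2 / r\<^sup>2 + sqrt (2 * loc_const * e) ^ 6 / r ^ 4)))
    \<le> main_const * (a + \<phi> + e powr (1/2) * T powr (1/2) / r + e powr (3/2) * T powr (1/2) / r\<^sup>2)"
proof -
  define m where "m = 2 * loc_const"
  have m: "1 \<le> m" using loc_const_ge by (simp add: m_def)
  have e32: "e powr (3/2) = e * sqrt e"
  proof (cases "e = 0")
    case False
    then have "e powr (1 + 1/2) = e powr 1 * e powr (1/2)" by (rule_tac powr_add)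
    then show ?thesis using assms(3) False by (simp add: powr_half_sqrt)
  qed simp
  define \<alpha> where "\<alpha> = sqrt e * sqrt T / r"
  define \<beta> where "\<beta> = e * sqrt e * sqrt T / r\<^sup>2"
  have \<alpha>\<beta>: "0 \<le> \<alpha>" "0 \<le> \<beta>" using assms by (auto simp: \<alpha>_def \<beta>_def)
  have \<alpha>2: "\<alpha>\<^sup>2 = T * (e / r\<^sup>2)" using assms by (simp add: \<alpha>_def power_mult_distrib power_divide)
  have \<beta>2: "\<beta>\<^sup>2 = T * (e ^ 3 / r ^ 4)"
  proof -
    have "\<beta>\<^sup>2 = e\<^sup>2 * e * T / (r\<^sup>2)\<^sup>2" using assms by (simp add: \<beta>_def power_mult_distrib power_divide)
    then show ?thesis by (simp add: eval_nat_numeral mult_ac)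
  qed
  have s2: "(sqrt (m * e))\<^sup>2 = m * e" using m assms by simp
  have "sqrt (m * e) ^ 6 = ((sqrt (m * e))\<^sup>2) ^ 3" by (simp flip: power_mult)
  then have s6: "sqrt (m * e) ^ 6 = m ^ 3 * e ^ 3" unfolding s2 by (simp add: power_mult_distrib)
  have mm: "m \<le> m ^ 3" "1 \<le> m ^ 3" using m by (auto intro: one_le_power self_le_power)
  have "a\<^sup>2 + \<phi>\<^sup>2 + T * ((sqrt (m * e))\<^sup>2 / r\<^sup>2 + sqrt (m * e) ^ 6 / r ^ 4) = 1 * a\<^sup>2 + 1 * \<phi>\<^sup>2 + m * \<alpha>\<^sup>2 + m ^ 3 * \<beta>\<^sup>2"
    unfolding s2 s6 \<alpha>2 \<beta>2 by (simp add: distrib_left mult.left_commute[of T])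
  also have "\<dots> \<le> m ^ 3 * a\<^sup>2 + m ^ 3 * \<phi>\<^sup>2 + m ^ 3 * \<alpha>\<^sup>2 + m ^ 3 * \<beta>\<^sup>2"
    using mm by (intro add_mono mult_right_mono) auto
  also have "\<dots> = m ^ 3 * (a\<^sup>2 + \<phi>\<^sup>2 + \<alpha>\<^sup>2 + \<beta>\<^sup>2)" by (simp add: distrib_left)
  also have "\<dots> \<le> m ^ 3 * (a + \<phi> + \<alpha> + \<beta>)\<^sup>2"
  proof (rule mult_left_mono)
    have "0 \<le> 2 * (a * \<phi> + a * \<alpha> + a * \<beta> + \<phi> * \<alpha> + \<phi> * \<beta> + \<alpha> * \<beta>)"
      using assms \<alpha>\<beta> by simp
    then show "a\<^sup>2 + \<phi>\<^sup>2 + \<alpha>\<^sup>2 + \<beta>\<^sup>2 \<le> (a + \<phi> + \<alpha> + \<beta>)\<^sup>2" by (simp add: power2_eq_square algebra_simps)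
  qed (use m in simp)
  finally have "loc_const * (a\<^sup>2 + \<phi>\<^sup>2 + T * ((sqrt (m * e))\<^sup>2 / r\<^sup>2 + sqrt (m * e) ^ 6 / r ^ 4)) \<le> loc_const * (m ^ 3 * (a + \<phi> + \<alpha> + \<beta>)\<^sup>2)"
    using loc_const_ge by (intro mult_left_mono) auto
  then have "sqrt (loc_const * (a\<^sup>2 + \<phi>\<^sup>2 + T * ((sqrt (m * e))\<^sup>2 / r\<^sup>2 + sqrt (m * e) ^ 6 / r ^ 4))) \<le> sqrt (loc_const * (m ^ 3 * (a + \<phi> + \<alpha> + \<beta>)\<^sup>2))"
    by (rule real_sqrt_le_mono)
  also have "\<dots> = main_const * (a + \<phi> + \<alpha> + \<beta>)"
    using assms \<alpha>\<beta> by (simp add: main_const_def m_def real_sqrt_mult mult.assoc[symmetric])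
  finally show ?thesis
    using assms by (simp add: m_def \<alpha>_def \<beta>_def e32 powr_half_sqrt)
qed

lemma (in nse) local_energy_estimate:
  assumes r: "0 < r" "r < R"
  shows "LinftL2x {0..T} (cball x0 (R - r)) u + L2tL2x {0..T} (cball x0 (R - r)) (\<lambda>t. grad (u t))
    \<le> ennreal (2 * main_const) * (L2x (cball x0 R) u0 + L1tL2x {0..T} (cball x0 R) f
        + epowr (energy u0 f T) (1/2) * ennreal (T powr (1/2)) / ennreal r
        + epowr (energy u0 f T) (3/2) * ennreal (T powr (1/2)) / ennreal (r\<^sup>2))"
proof -
  have Efin: "energy u0 f T < \<infinity>" and Lfin: "LinftL2x {0..T} UNIV u < \<infinity>"
    using sol unfolding finite_energy_almost_smooth_solution_def by blast+
  have "L2x UNIV u0 < \<infinity>"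
    using Efin unfolding energy_def by (auto simp: less_top[symmetric] power2_eq_square ennreal_divide_eq_top_iff ennreal_mult_eq_top_iff)
  then obtain aG where aG: "L2x UNIV u0 = ennreal aG" "0 \<le> aG" by (cases "L2x UNIV u0") auto
  obtain \<Phi>G where \<Phi>G: "L1tL2x {0..T} UNIV f = ennreal \<Phi>G" "0 \<le> \<Phi>G"
    using forcing_norm_finite by (cases "L1tL2x {0..T} UNIV f") auto
  define e where "e = (aG + \<Phi>G)\<^sup>2 / 2"
  have e: "energy u0 f T = ennreal e" "0 \<le> e"
  proof -
    have "energy u0 f T = (ennreal (aG + \<Phi>G))\<^sup>2 / ennreal 2" using aG \<Phi>G by (simp add: energy_def)
    also have "\<dots> = ennreal e" using aG \<Phi>G by (simp add: e_def ennreal_power divide_ennreal del: ennreal_numeral ennreal_plus)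
    finally show "energy u0 f T = ennreal e" .
  qed (simp add: e_def)
  obtain K where K: "LinftL2x {0..T} UNIV u = ennreal K" "0 \<le> K"
    using Lfin by (cases "LinftL2x {0..T} UNIV u") auto
  \<comment> \<open>\<open>K\<close> is finite but of unknown size; it makes
    \<open>global_bound\<close> available, whose conclusion no longer contains it.\<close>
  interpret A: nse_energy u p u0 f T K
    by unfold_locales (use K L2_bound_everywhere in auto)
  \<comment> \<open>\<open>aG\<^sup>2 + \<Phi>G\<^sup>2\<close> is at most
    \<open>(aG + \<Phi>G)\<^sup>2 = 2 * e\<close>, so \<open>M\<^sup>2\<close> dominates the bound
    of \<open>global_bound\<close> and depends on the energy alone.\<close>
  define M where "M = sqrt (2 * loc_const * e)"
  have lc: "0 \<le> loc_const" using loc_const_ge by simp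
  have glob: "(\<integral>\<^sup>+x. ennreal ((norm (u t x))\<^sup>2) \<partial>lborel) \<le> ennreal (M\<^sup>2)" if "t \<in> {0..T}" for t
  proof -
    have "aG\<^sup>2 + \<Phi>G\<^sup>2 \<le> 2 * e" using aG \<Phi>G by (simp add: e_def power2_sum)
    then have "loc_const * (aG\<^sup>2 + \<Phi>G\<^sup>2) \<le> M\<^sup>2"
      using lc e mult_left_mono[of "aG\<^sup>2 + \<Phi>G\<^sup>2" "2 * e" loc_const] by (simp add: M_def mult_ac)
    then have "ennreal (loc_const * (aG\<^sup>2 + \<Phi>G\<^sup>2)) \<le> ennreal (M\<^sup>2)" by (rule ennreal_leI)
    moreover have "(\<integral>\<^sup>+x. ennreal ((norm (u t x))\<^sup>2) \<partial>lborel) \<le> ennreal (loc_const * (aG\<^sup>2 + \<Phi>G\<^sup>2))"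
      using aG \<Phi>G that by (intro A.global_bound) auto
    ultimately show ?thesis by (rule order_trans[rotated])
  qed
  interpret B: nse_energy u p u0 f T M
    by unfold_locales (use glob lc e in \<open>auto simp: M_def\<close>)
  have "L2x (cball x0 R) u0 \<le> ennreal aG" using L2x_mono[of "cball x0 R" UNIV u0] aG by simp
  then obtain a where a: "L2x (cball x0 R) u0 = ennreal a" "0 \<le> a"
    by (cases "L2x (cball x0 R) u0") (auto simp: top_unique)
  have "L1tL2x {0..T} (cball x0 R) f \<le> L1tL2x {0..T} UNIV f"
    unfolding L1tL2x_def by (intro nn_integral_mono mult_right_mono L2x_mono) auto
  then obtain \<phi> where \<phi>: "L1tL2x {0..T} (cball x0 R) f = ennreal \<phi>" "0 \<le> \<phi>"
    using \<Phi>G by (cases "L1tL2x {0..T} (cball x0 R) f") (auto simp: top_unique)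
  define X where "X = loc_const * (a\<^sup>2 + \<phi>\<^sup>2 + T * (M\<^sup>2 / r\<^sup>2 + M ^ 6 / r ^ 4))"
  have X0: "0 \<le> X" using lc T_pos by (simp add: X_def M_def)
  note bounds = B.local_bounds[OF r _ a(2) _ \<phi>(2) X_def, of x0]
  have 1: "LinftL2x {0..T} (cball x0 (R - r)) u \<le> ennreal (sqrt X)"
    unfolding LinftL2x_def
  proof (rule esssup_I)
    show "(\<lambda>t. L2x (cball x0 (R - r)) (u t)) \<in> borel_measurable (restrict_space lborel {0..T})"
      by (rule borel_measurable_L2x_time(2)[OF cont_u]) simp
    show "AE t in restrict_space lborel {0..T}. L2x (cball x0 (R - r)) (u t) \<le> ennreal (sqrt X)"
      using bounds(1) a \<phi> X0 by (intro AE_I2) (auto simp: L2x_le_iff)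
  qed
  have 2: "L2tL2x {0..T} (cball x0 (R - r)) (\<lambda>t. grad (u t)) \<le> ennreal (sqrt X)"
    unfolding L2tL2x_def
  proof (rule ennreal_square_le)
    have "(ennreal (sqrt X))\<^sup>2 = ennreal X" using X0 by (simp add: ennreal_power)
    then show "(epowr (\<integral>\<^sup>+t\<in>{0..T}. (L2x (cball x0 (R - r)) (grad (u t)))\<^sup>2 \<partial>lborel) (1/2))\<^sup>2 \<le> (ennreal (sqrt X))\<^sup>2"
      unfolding epowr_half_square using bounds(2) a \<phi> r by simp
  qed
  define Y where "Y = a + \<phi> + e powr (1/2) * T powr (1/2) / r + e powr (3/2) * T powr (1/2) / r\<^sup>2"
  have "LinftL2x {0..T} (cball x0 (R - r)) u + L2tL2x {0..T} (cball x0 (R - r)) (\<lambda>t. grad (u t)) \<le> ennreal (sqrt X) + ennreal (sqrt X)"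
    by (intro add_mono 1 2)
  also have "\<dots> = ennreal (2 * sqrt X)" using X0 by (simp flip: ennreal_plus)
  also have "\<dots> \<le> ennreal (2 * (main_const * Y))"
  proof (intro ennreal_leI mult_left_mono)
    show "sqrt X \<le> main_const * Y"
      unfolding X_def M_def Y_def by (rule sqrt_local_bound_le[OF a(2) \<phi>(2) e(2) T_pos r(1)])
  qed simp
  also have "\<dots> = ennreal (2 * main_const) * ennreal Y"
    using main_const_nonneg a \<phi> e r by (simp add: ennreal_mult Y_def mult.assoc)
  also have "ennreal Y = L2x (cball x0 R) u0 + L1tL2x {0..T} (cball x0 R) f
        + epowr (energy u0 f T) (1/2) * ennreal (T powr (1/2)) / ennreal r
        + epowr (energy u0 f T) (3/2) * ennreal (T powr (1/2)) / ennreal (r\<^sup>2)"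
    unfolding a \<phi> e(1) Y_def using a \<phi> e r
    by (simp add: epowr_def ennreal_mult[symmetric] divide_ennreal)
  finally show ?thesis .
qed

theorem theorem8p2:
  shows "\<exists>C0::real. 0 \<le> C0 \<and>
    (\<forall>(u :: real \<Rightarrow> real^3 \<Rightarrow> real^3) (p :: real \<Rightarrow> real^3 \<Rightarrow> real)
      (u0 :: real^3 \<Rightarrow> real^3) (f :: real \<Rightarrow> real^3 \<Rightarrow> real^3) (T::real).
      finite_energy_almost_smooth_solution u p u0 f T \<longrightarrow>
      (\<forall>t\<in>{0..T}. \<forall>x. div3 (f t) x = 0) \<longrightarrow>
      (\<forall>(x0 :: real^3) (r::real) (R::real). 0 < r \<and> r < R / 2 \<longrightarrow>
        LinftL2x {0..T} (cball x0 (R - r)) u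
          + L2tL2x {0..T} (cball x0 (R - r)) (\<lambda>t. grad (u t))
        \<le> ennreal C0 *
          (L2x (cball x0 R) u0 + L1tL2x {0..T} (cball x0 R) f
            + epowr (energy u0 f T) (1/2) * ennreal (T powr (1/2)) / ennreal r
            + epowr (energy u0 f T) (3/2) * ennreal (T powr (1/2)) / ennreal (r\<^sup>2))))"
\<comment> \<open>The factor 2 comes from adding the two norms, each of which is bounded by
  \<open>sqrt X\<close>.\<close>
proof (intro exI[of _ "2 * main_const"] conjI allI impI)
  show "0 \<le> 2 * main_const" using main_const_nonneg by simp
  fix u p u0 f T x0 and r R :: real
  assume sol: "finite_energy_almost_smooth_solution u p u0 f T" "\<forall>t\<in>{0..T}. \<forall>x. div3 (f t) x = 0"
    and r: "0 < r \<and> r < R / 2"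
  interpret nse u p u0 f T by unfold_locales (use sol in auto)
  show "LinftL2x {0..T} (cball x0 (R - r)) u + L2tL2x {0..T} (cball x0 (R - r)) (\<lambda>t. grad (u t))
        \<le> ennreal (2 * main_const) *
          (L2x (cball x0 R) u0 + L1tL2x {0..T} (cball x0 R) f
            + epowr (energy u0 f T) (1/2) * ennreal (T powr (1/2)) / ennreal r
            + epowr (energy u0 f T) (3/2) * ennreal (T powr (1/2)) / ennreal (r\<^sup>2))"
    by (rule local_energy_estimate) (use r in auto)
qed

end
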